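(* Let $(G,\chi)$ be a $\mathbb{Z}_q$-symmetric $k$-coloured graph ($q\ge2$) with respect to $\theta:\mathbb{Z}_q\to\mathrm{Aut}(G,\chi)$ (acting freely on the vertices), let $\tau:\mathbb{Z}_q\to O(\mathbb{R}^3)$ be a group representation such that $\tau(\mathbb{Z}_q)$ describes ($q$-fold) rotational symmetry in 3-space, and let $(G,\chi,p)$ be a $\mathbb{Z}_q$-generic framework on $r\mathbb{S}^2$ with respect to $\theta$ and $\tau$. If $(G,\chi,p)$ is $\mathbb{Z}_q$-symmetric isostatic, then the quotient $\mathbb{Z}_q$-gain graph $((G_0,\chi_0),\psi)$, $G_0=(V_0,E_0)$, satisfies: (i) $|E_0|=2|V_0|-1+\min\{k,|V_0|-1\}$; (ii) for every nonempty $F_0\subseteq E_0$: $|F_0|\le r_{2,\tau(\mathbb{Z}_q)}(F_0)+\min\{k(F_0),|V(F_0)|-3\}$ if $F_0$ is balanced; and $|F_0|\le r_{2,\tau(\mathbb{Z}_q)}(F_0)+\min\{k(F_0),|V(F_0)|-1\}$ if $F_0$ is unbalanced.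
   Context: Coloured graphs. $G=(V,E)$ is a finite simple graph. A colouring is a map $\chi:V\to\mathcal{C}\cup\{\bullet\}$, where $\chi(v)=\bullet$ means $v$ is uncoloured and every colour of $\mathcal{C}$ is used; $(G,\chi)$ is $k$-coloured if $|\mathcal{C}|=k$. An automorphism of $(G,\chi)$ is a graph automorphism $\pi$ of $G$ with $\chi(\pi(i))=\chi(i)$ for all $i$. $(G,\chi)$ is $\Gamma$-symmetric if there is a group action $\theta:\Gamma\to\mathrm{Aut}(G,\chi)$, always assumed free on $V$; write $\gamma i$ for $\theta(\gamma)(i)$. (Here $\Gamma=\mathbb{Z}_q$.) Quotient gain graph. $G_0=(V_0,E_0)$ is the multigraph (loops allowed) of vertex orbits and edge orbits; fix a representative vertex in each vertex orbit. Each edge orbit joining the orbits of representatives $i$ and $j$ equals $\{\{\gamma i,\gamma\alpha j\}:\gamma\in\Gamma\}$ for some $\alpha\in\Gamma$; orient it from $i$ to $j$ and set $\psi(e)=\alpha$. $\chi_0$ gives each orbit the common colour of its vertices. The gain of a closed walk is the product of the $\psi(e)^{\pm1}$ along it ($+1$ if $e$ is traversed along its orientation, $-1$ otherwise). $F_0\subseteq E_0$ is balanced if all closed walks in $F_0$ have identity gain, otherwise unbalanced. $V(F_0)$ is the set of vertices incident with $F_0$ and $k(F_0)$ is the number of colours in $\mathcal{C}$ on $V(F_0)$. Frameworks (here $d=2$). Given $r:\mathcal{C}\to\mathbb{R}_{>0}$, a framework $(G,\chi,p)$ on $r\mathbb{S}^d$ is given by $p:V\to\mathbb{R}^{d+1}$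 with $\|p(v)\|=r(\chi(v))$ for coloured $v$ and $\|p(v)\|=1$ for uncoloured $v$. It is $\Gamma$-symmetric (with respect to $\theta,\tau$) if $\tau(\gamma)p(i)=p(\gamma i)$ for all $\gamma\in\Gamma$, $i\in V$. Let $\tilde p:V_0\to\mathbb{R}^{d+1}$ be the restriction of $p$ to the representatives. A $\Gamma$-symmetric framework is $\Gamma$-generic if the coordinates of $\tilde p$ and $r$ satisfy no nonzero polynomial with rational coefficients except those in the ideal generated by the defining polynomials of the spheres ($\tilde p(i)\cdot\tilde p(i)-r(\chi_0(i))^2$ for coloured $i$, $\tilde p(i)\cdot\tilde p(i)-1$ for uncoloured $i$). Motions. An infinitesimal motion is a pair $(\dot p,\dot r)$, $\dot p:V\to\mathbb{R}^{d+1}$, $\dot r:\mathcal{C}\to\mathbb{R}$, $\dot r(\bullet)=0$, with $(p(u)-p(v))\cdot(\dot p(u)-\dot p(v))=0$ for $uv\in E$ and $p(v)\cdot\dot p(v)=\dot r(\chi(v))$ for $v\in V$. It is $\Gamma$-symmetric if $\tau(\gamma)\dot p(i)=\dot p(\gamma i)$ for all $\gamma,i$. It is trivial if it is a linear combination of motions of the following kinds: $\dot p(v)=Sp(v)$ for all $v$, $\dot r=0$, with $S$ a skew-symmetric $(d+1)\times(d+1)$ matrix; and, only if $k\ge |V|-(d+1)$, also the motions with $\dot p(v)=x$ for all $v\in V$ and $\dot r(c)=p(v_c)\cdot x$ for each colour $c$ (where $v_c$ is any vertex of colour $c$), where $x\in\mathbb{R}^{d+1}$ satisfies $p(v)\cdot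 x=0$ for all uncoloured $v$ and $(p(u)-p(v))\cdot x=0$ whenever $u,v$ have the same colour. $(G,\chi,p)$ is $\Gamma$-symmetric infinitesimally rigid if every $\Gamma$-symmetric infinitesimal motion is trivial. Orbit rigidity matrix. $O((G_0,\chi_0),\psi,\tilde p)$ is the $(|E_0|+|V_0|)\times((d+1)|V_0|+k)$ matrix with the following rows. For a non-loop edge $e=(i,j)$: $\tilde p(i)-\tau(\psi(e))\tilde p(j)$ in the columns of $i$, $\tilde p(j)-\tau(\psi(e))^{-1}\tilde p(i)$ in the columns of $j$, zeros elsewhere. For a loop $e$ at $i$: $2\tilde p(i)-\tau(\psi(e))\tilde p(i)-\tau(\psi(e))^{-1}\tilde p(i)$ in the columns of $i$, zeros elsewhere. For a vertex $i\in V_0$: $\tilde p(i)$ in the columns of $i$, entry $1$ in the column of the colour $\chi_0(i)$ if $i$ is coloured, zeros elsewhere. (The sign of the colour-column entries is immaterial for rank and row independence.) $(G,\chi,p)$ is $\Gamma$-symmetric independent if this matrix has linearly independent rows, and $\Gamma$-symmetric isostatic if it is $\Gamma$-symmetric independent and $\Gamma$-symmetric infinitesimally rigid. Rank function. When all vertices are uncoloured (all points on the fixed unit sphere $\mathbb{S}^d$), the orbit matrix is the spherical orbit rigidity matrix $O_{\mathbb{S}^d}(G_0,\psi,\tilde p)$. $r_{d,\tau(\Gamma)}$ is the rank function of the $\Gamma$-generic spherical rigidity matroid on $E_0$ (radius fixed): $r_{d,\tau(\Gamma)}(F_0)$ is the rank of the spherical orbit matrix of the subgraph $(V(F_0),F_0)$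 at a generic $\tilde p:V(F_0)\to\mathbb{S}^d$, minus $|V(F_0)|$ (the contribution of the vertex rows).
   Formalization: The balanced bound uses max{0,|V(F_0)|-3} for |V(F_0)|-3 (the literal bound fails for a single non-loop edge), and the entries of τ are assumed algebraic over Q (for other axes rational genericity leaves r_{2,τ} ill-defined and (i) can fail); V is nonempty. *)

theory Defs
  imports
    "HOL-Analysis.Analysis"
    "HOL-Algebra.Group_Action"
    "HOL-Algebra.Elementary_Groups"
    "HOL-Library.Poly_Mapping"
    "HOL-Library.Function_Algebras"
begin

section \<open>Symmetric coloured graphs\<close>

text \<open>Vertices form a set \<open>V\<close>, edges are two-element subsets of \<open>V\<close>.\<close>

definition finite_simple_graph :: "'v set \<Rightarrow> 'v set set \<Rightarrow> bool" where
  "finite_simple_graph V E \<longleftrightarrow>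
     finite V \<and> E \<subseteq> {{u, v} | u v. u \<in> V \<and> v \<in> V \<and> u \<noteq> v}"

text \<open>The value \<open>None\<close> plays the role of the symbol \<open>\<bullet>\<close> (uncoloured).\<close>

definition colouring :: "'v set \<Rightarrow> 'c set \<Rightarrow> ('v \<Rightarrow> 'c option) \<Rightarrow> bool" where
  "colouring V C chi \<longleftrightarrow> chi ` V \<subseteq> insert None (Some ` C) \<and> Some ` C \<subseteq> chi ` V"

definition coloured_aut_group ::
    "'v set \<Rightarrow> 'v set set \<Rightarrow> ('v \<Rightarrow> 'c option) \<Rightarrow> ('v \<Rightarrow> 'v) monoid" where
  "coloured_aut_group V E chi =
     BijGroup V \<lparr>carrier := {f \<in> Bij V.
        (\<forall>u\<in>V. \<forall>v\<in>V. {f u, f v} \<in> E \<longleftrightarrow> {u, v} \<in> E) \<and> (\<forall>i\<in>V. chi (f i) = chi i)}\<rparr>"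

definition free_symmetry ::
    "'g monoid \<Rightarrow> 'v set \<Rightarrow> 'v set set \<Rightarrow> ('v \<Rightarrow> 'c option) \<Rightarrow> ('g \<Rightarrow> 'v \<Rightarrow> 'v) \<Rightarrow> bool" where
  "free_symmetry G V E chi th \<longleftrightarrow>
     th \<in> hom G (coloured_aut_group V E chi) \<and>
     (\<forall>g\<in>carrier G. g \<noteq> \<one>\<^bsub>G\<^esub> \<longrightarrow> (\<forall>i\<in>V. th g i \<noteq> i))"


section \<open>Rotational symmetry in 3-space\<close>

definition orthogonal_group3 :: "(real^3^3) monoid" where
  "orthogonal_group3 = \<lparr>carrier = {A. orthogonal_matrix A}, mult = (**), one = mat 1\<rparr>"

text \<open>Rodrigues' formula for the rotation by the angle \<open>t\<close> about the unit vector \<open>a\<close>.\<close>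

definition rotation3 :: "real^3 \<Rightarrow> real \<Rightarrow> real^3^3" where
  "rotation3 a t = matrix (\<lambda>x. cos t *\<^sub>R x + sin t *\<^sub>R cross3 a x + ((1 - cos t) * (a \<bullet> x)) *\<^sub>R a)"

definition describes_rotation :: "nat \<Rightarrow> (int \<Rightarrow> real^3^3) \<Rightarrow> bool" where
  "describes_rotation q tau \<longleftrightarrow>
     tau \<in> hom (integer_mod_group q) orthogonal_group3 \<and>
     (\<exists>a. norm a = 1 \<and>
        tau ` carrier (integer_mod_group q) = {rotation3 a (2 * pi * real m / real q) | m. m < q})"


section \<open>Quotient gain graphs\<close>

definition vertex_orbits :: "'g monoid \<Rightarrow> 'v set \<Rightarrow> ('g \<Rightarrow> 'v \<Rightarrow> 'v) \<Rightarrow> 'v set set" where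
  "vertex_orbits G V th = orbits G V th"

definition edge_orbits :: "'g monoid \<Rightarrow> 'v set set \<Rightarrow> ('g \<Rightarrow> 'v \<Rightarrow> 'v) \<Rightarrow> 'v set set set" where
  "edge_orbits G E th = orbits G E (\<lambda>g e. th g ` e)"

text \<open>Admissible choices of orbit representatives \<open>rep\<close>, edge orientations
  \<open>src\<close> and \<open>dst\<close>, and gains \<open>psi\<close>.\<close>

definition quotient_gain_graph ::
    "'g monoid \<Rightarrow> 'v set \<Rightarrow> 'v set set \<Rightarrow> ('g \<Rightarrow> 'v \<Rightarrow> 'v) \<Rightarrow> ('v set \<Rightarrow> 'v) \<Rightarrow>
     ('v set set \<Rightarrow> 'v set) \<Rightarrow> ('v set set \<Rightarrow> 'v set) \<Rightarrow> ('v set set \<Rightarrow> 'g) \<Rightarrow> bool" where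
  "quotient_gain_graph G V E th rep src dst psi \<longleftrightarrow>
     (\<forall>X \<in> vertex_orbits G V th. rep X \<in> X) \<and>
     (\<forall>e \<in> edge_orbits G E th.
        src e \<in> vertex_orbits G V th \<and> dst e \<in> vertex_orbits G V th \<and> psi e \<in> carrier G \<and>
        e = {{th g (rep (src e)), th (g \<otimes>\<^bsub>G\<^esub> psi e) (rep (dst e))} | g. g \<in> carrier G})"

text \<open>A walk is a list of edges, each with a flag telling whether it is traversed along its
  orientation.\<close>

fun is_walk :: "('e \<Rightarrow> 'o) \<Rightarrow> ('e \<Rightarrow> 'o) \<Rightarrow> 'e set \<Rightarrow> 'o \<Rightarrow> ('e \<times> bool) list \<Rightarrow> 'o \<Rightarrow> bool" where
  "is_walk src dst F u [] v \<longleftrightarrow> u = v"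
| "is_walk src dst F u ((e, fwd) # w) v \<longleftrightarrow>
     e \<in> F \<and> (if fwd then src e else dst e) = u \<and>
     is_walk src dst F (if fwd then dst e else src e) w v"

fun walk_gain :: "'g monoid \<Rightarrow> ('e \<Rightarrow> 'g) \<Rightarrow> ('e \<times> bool) list \<Rightarrow> 'g" where
  "walk_gain G psi [] = \<one>\<^bsub>G\<^esub>"
| "walk_gain G psi ((e, fwd) # w) =
     (if fwd then psi e else m_inv G (psi e)) \<otimes>\<^bsub>G\<^esub> walk_gain G psi w"

definition balanced ::
    "'g monoid \<Rightarrow> ('e \<Rightarrow> 'o) \<Rightarrow> ('e \<Rightarrow> 'o) \<Rightarrow> ('e \<Rightarrow> 'g) \<Rightarrow> 'e set \<Rightarrow> bool" where
  "balanced G src dst psi F \<longleftrightarrow>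
     (\<forall>u w. is_walk src dst F u w u \<longrightarrow> walk_gain G psi w = \<one>\<^bsub>G\<^esub>)"

definition verts_of :: "('e \<Rightarrow> 'o) \<Rightarrow> ('e \<Rightarrow> 'o) \<Rightarrow> 'e set \<Rightarrow> 'o set" where
  "verts_of src dst F = src ` F \<union> dst ` F"

definition num_colours_on :: "'c set \<Rightarrow> ('o \<Rightarrow> 'c option) \<Rightarrow> 'o set \<Rightarrow> nat" where
  "num_colours_on C chi0 X = card {c \<in> C. \<exists>i\<in>X. chi0 i = Some c}"


section \<open>Genericity\<close>

text \<open>Polynomials over the rationals in variables of type \<open>'x\<close>: finitely supported maps from
  monomials (finitely supported exponent maps) to coefficients, multiplied by convolution.\<close>

type_synonym 'x rat_mpoly = "('x \<Rightarrow>\<^sub>0 nat) \<Rightarrow>\<^sub>0 rat"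

definition mvar :: "'x \<Rightarrow> 'x rat_mpoly" where
  "mvar x = Poly_Mapping.single (Poly_Mapping.single x 1) 1"

definition polys_in :: "'x set \<Rightarrow> 'x rat_mpoly set" where
  "polys_in A = {f. \<forall>m \<in> Poly_Mapping.keys f. Poly_Mapping.keys m \<subseteq> A}"

definition eval_mpoly :: "('x \<Rightarrow> real) \<Rightarrow> 'x rat_mpoly \<Rightarrow> real" where
  "eval_mpoly a f = (\<Sum>m \<in> Poly_Mapping.keys f.
      of_rat (Poly_Mapping.lookup f m) *
      (\<Prod>x \<in> Poly_Mapping.keys m. a x ^ Poly_Mapping.lookup m x))"

text \<open>The variable \<open>Inl (i, m)\<close> stands for the \<open>m\<close>-th coordinate of the point of \<open>i\<close>, the
  variable \<open>Inr c\<close> for the radius of the colour \<open>c\<close>.\<close>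

definition sphere_poly :: "('o \<Rightarrow> 'c option) \<Rightarrow> 'o \<Rightarrow> ('o \<times> 3 + 'c) rat_mpoly" where
  "sphere_poly chi0 i =
     (\<Sum>m\<in>UNIV. mvar (Inl (i, m)) ^ 2) -
     (case chi0 i of None \<Rightarrow> 1 | Some c \<Rightarrow> mvar (Inr c) ^ 2)"

definition sphere_ideal ::
    "'o set \<Rightarrow> 'c set \<Rightarrow> ('o \<Rightarrow> 'c option) \<Rightarrow> ('o \<times> 3 + 'c) rat_mpoly set" where
  "sphere_ideal X C chi0 =
     {\<Sum>i\<in>X. g i * sphere_poly chi0 i | g. \<forall>i\<in>X. g i \<in> polys_in ((X \<times> UNIV) <+> C)}"

definition generic_on_spheres ::
    "'o set \<Rightarrow> 'c set \<Rightarrow> ('o \<Rightarrow> 'c option) \<Rightarrow> ('c \<Rightarrow> real) \<Rightarrow> ('o \<Rightarrow> real^3) \<Rightarrow> bool" where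
  "generic_on_spheres X C chi0 r s \<longleftrightarrow>
     (\<forall>f \<in> polys_in ((X \<times> UNIV) <+> C).
        eval_mpoly (case_sum (\<lambda>(i, m). s i $ m) r) f = 0 \<longrightarrow> f \<in> sphere_ideal X C chi0)"

text \<open>Polynomials with rational coefficients see the matrices of a rotation group only if these
  are algebraic over the rationals, as they are for rotations about a coordinate axis. About a
  transcendental axis a configuration can be generic in the above sense and yet lie on the axis or
  on its orthogonal plane. Algebraicity has to be assumed separately.\<close>

definition algebraic_matrices :: "(real^3^3) set \<Rightarrow> bool" where
  "algebraic_matrices M \<longleftrightarrow> (\<forall>A\<in>M. \<forall>i j. algebraic (A $ i $ j))"


section \<open>Frameworks and infinitesimal rigidity\<close>

definition framework ::
    "'v set \<Rightarrow> 'c set \<Rightarrow> ('v \<Rightarrow> 'c option) \<Rightarrow> ('c \<Rightarrow> real) \<Rightarrow> ('v \<Rightarrow> real^3) \<Rightarrow> bool" where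
  "framework V C chi r p \<longleftrightarrow>
     (\<forall>c\<in>C. 0 < r c) \<and>
     (\<forall>v\<in>V. norm (p v) = (case chi v of None \<Rightarrow> 1 | Some c \<Rightarrow> r c))"

text \<open>Used both for placements and for velocity assignments.\<close>

definition symmetric_placement ::
    "'g monoid \<Rightarrow> 'v set \<Rightarrow> ('g \<Rightarrow> 'v \<Rightarrow> 'v) \<Rightarrow> ('g \<Rightarrow> real^3^3) \<Rightarrow> ('v \<Rightarrow> real^3) \<Rightarrow> bool" where
  "symmetric_placement G V th tau p \<longleftrightarrow>
     (\<forall>g\<in>carrier G. \<forall>i\<in>V. tau g *v p i = p (th g i))"

definition infinitesimal_motion ::
    "'v set \<Rightarrow> 'v set set \<Rightarrow> ('v \<Rightarrow> 'c option) \<Rightarrow> ('v \<Rightarrow> real^3) \<Rightarrow>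
     ('v \<Rightarrow> real^3) \<Rightarrow> ('c \<Rightarrow> real) \<Rightarrow> bool" where
  "infinitesimal_motion V E chi p pd rd \<longleftrightarrow>
     (\<forall>u v. {u, v} \<in> E \<longrightarrow> (p u - p v) \<bullet> (pd u - pd v) = 0) \<and>
     (\<forall>v\<in>V. p v \<bullet> pd v = (case chi v of None \<Rightarrow> 0 | Some c \<Rightarrow> rd c))"

definition rotation_motion ::
    "'v set \<Rightarrow> 'c set \<Rightarrow> ('v \<Rightarrow> real^3) \<Rightarrow> ('v \<Rightarrow> real^3) \<Rightarrow> ('c \<Rightarrow> real) \<Rightarrow> bool" where
  "rotation_motion V C p pd rd \<longleftrightarrow>
     (\<exists>S::real^3^3. transpose S = - S \<and> (\<forall>v\<in>V. pd v = S *v p v) \<and> (\<forall>c\<in>C. rd c = 0))"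

definition translation_motion ::
    "'v set \<Rightarrow> ('v \<Rightarrow> 'c option) \<Rightarrow> ('v \<Rightarrow> real^3) \<Rightarrow>
     ('v \<Rightarrow> real^3) \<Rightarrow> ('c \<Rightarrow> real) \<Rightarrow> bool" where
  "translation_motion V chi p pd rd \<longleftrightarrow>
     (\<exists>x.
        (\<forall>v\<in>V. chi v = None \<longrightarrow> p v \<bullet> x = 0) \<and>
        (\<forall>c. \<forall>u\<in>V. \<forall>v\<in>V. chi u = Some c \<and> chi v = Some c \<longrightarrow> (p u - p v) \<bullet> x = 0) \<and>
        (\<forall>v\<in>V. pd v = x) \<and>
        (\<forall>c. \<forall>v\<in>V. chi v = Some c \<longrightarrow> rd c = p v \<bullet> x))"

text \<open>The condition \<open>card V \<le> card C + 3\<close> is \<open>k \<ge> |V| - (d + 1)\<close> for \<open>d = 2\<close>, with the subtraction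
  moved to the other side because the numbers are naturals.\<close>

definition trivial_motion ::
    "'v set \<Rightarrow> 'c set \<Rightarrow> ('v \<Rightarrow> 'c option) \<Rightarrow> ('v \<Rightarrow> real^3) \<Rightarrow>
     ('v \<Rightarrow> real^3) \<Rightarrow> ('c \<Rightarrow> real) \<Rightarrow> bool" where
  "trivial_motion V C chi p pd rd \<longleftrightarrow>
     (\<exists>(n::nat) (a :: nat \<Rightarrow> real) P R.
        (\<forall>l<n. rotation_motion V C p (P l) (R l) \<or>
               (card V \<le> card C + 3 \<and> translation_motion V chi p (P l) (R l))) \<and>
        (\<forall>v\<in>V. pd v = (\<Sum>l<n. a l *\<^sub>R P l v)) \<and>
        (\<forall>c\<in>C. rd c = (\<Sum>l<n. a l * R l c)))"

definition symmetric_infinitesimally_rigid ::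
    "'g monoid \<Rightarrow> 'v set \<Rightarrow> 'v set set \<Rightarrow> 'c set \<Rightarrow> ('v \<Rightarrow> 'c option) \<Rightarrow>
     ('g \<Rightarrow> 'v \<Rightarrow> 'v) \<Rightarrow> ('g \<Rightarrow> real^3^3) \<Rightarrow> ('v \<Rightarrow> real^3) \<Rightarrow> bool" where
  "symmetric_infinitesimally_rigid G V E C chi th tau p \<longleftrightarrow>
     (\<forall>pd rd. infinitesimal_motion V E chi p pd rd \<and> symmetric_placement G V th tau pd \<longrightarrow>
        trivial_motion V C chi p pd rd)"


section \<open>Orbit rigidity matrices\<close>

text \<open>A real matrix whose columns are indexed by \<open>'x\<close> is given by its family of rows, which are
  elements of the vector space \<open>'x \<Rightarrow> real\<close>. The index types may be larger than the actual index
  sets: the superfluous columns of the orbit matrices below are zero.\<close>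

interpretation row_space: vector_space "\<lambda>(a::real) (f :: 'x \<Rightarrow> real) x. a * f x"
  by unfold_locales (auto simp: fun_eq_iff algebra_simps)

definition rows_independent :: "('w \<Rightarrow> 'x \<Rightarrow> real) \<Rightarrow> 'w set \<Rightarrow> bool" where
  "rows_independent A W \<longleftrightarrow> inj_on A W \<and> row_space.independent (A ` W)"

definition row_rank :: "('w \<Rightarrow> 'x \<Rightarrow> real) \<Rightarrow> 'w set \<Rightarrow> nat" where
  "row_rank A W = row_space.dim (A ` W)"

text \<open>Rows: \<open>Inl e\<close> for an edge \<open>e\<close>, \<open>Inr j\<close> for a vertex \<open>j\<close>. Columns: \<open>Inl (i, m)\<close> for the \<open>m\<close>-th
  coordinate of the vertex \<open>i\<close>, \<open>Inr c\<close> for the colour \<open>c\<close>.\<close>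

definition edge_block ::
    "('e \<Rightarrow> 'o) \<Rightarrow> ('e \<Rightarrow> 'o) \<Rightarrow> ('e \<Rightarrow> 'g) \<Rightarrow> ('g \<Rightarrow> real^3^3) \<Rightarrow> ('o \<Rightarrow> real^3) \<Rightarrow>
     'e \<Rightarrow> 'o \<Rightarrow> real^3" where
  "edge_block src dst psi tau s e i =
     (let T = tau (psi e) in
      if src e = dst e then
        if i = src e then 2 *\<^sub>R s i - T *v s i - matrix_inv T *v s i else 0
      else if i = src e then s i - T *v s (dst e)
      else if i = dst e then s i - matrix_inv T *v s (src e)
      else 0)"

definition orbit_matrix ::
    "('e \<Rightarrow> 'o) \<Rightarrow> ('e \<Rightarrow> 'o) \<Rightarrow> ('e \<Rightarrow> 'g) \<Rightarrow> ('g \<Rightarrow> real^3^3) \<Rightarrow> ('o \<Rightarrow> 'c option) \<Rightarrow>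
     ('o \<Rightarrow> real^3) \<Rightarrow> 'e + 'o \<Rightarrow> 'o \<times> 3 + 'c \<Rightarrow> real" where
  "orbit_matrix src dst psi tau chi0 s w x =
     (case w of
        Inl e \<Rightarrow> (case x of Inl (i, m) \<Rightarrow> edge_block src dst psi tau s e i $ m | Inr c \<Rightarrow> 0)
      | Inr j \<Rightarrow> (case x of Inl (i, m) \<Rightarrow> if i = j then s j $ m else 0
                          | Inr c \<Rightarrow> if chi0 j = Some c then 1 else 0))"

text \<open>The spherical case: all vertices are uncoloured and the colour columns are empty
  (the colour type \<open>unit\<close> is a dummy).\<close>

definition generic_on_unit_sphere :: "'o set \<Rightarrow> ('o \<Rightarrow> real^3) \<Rightarrow> bool" where
  "generic_on_unit_sphere X s \<longleftrightarrow>
     (\<forall>i\<in>X. norm (s i) = 1) \<and>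
     generic_on_spheres X {} (\<lambda>_. None :: unit option) (\<lambda>_. 0) s"

definition spherical_rank ::
    "('e \<Rightarrow> 'o) \<Rightarrow> ('e \<Rightarrow> 'o) \<Rightarrow> ('e \<Rightarrow> 'g) \<Rightarrow> ('g \<Rightarrow> real^3^3) \<Rightarrow> 'e set \<Rightarrow> int" where
  "spherical_rank src dst psi tau F =
     (let X = verts_of src dst F; s = (SOME s. generic_on_unit_sphere X s)
      in int (row_rank (orbit_matrix src dst psi tau (\<lambda>_. None :: unit option) s) (F <+> X))
         - int (card X))"

definition symmetric_independent ::
    "'g monoid \<Rightarrow> 'v set \<Rightarrow> 'v set set \<Rightarrow> ('v \<Rightarrow> 'c option) \<Rightarrow> ('g \<Rightarrow> 'v \<Rightarrow> 'v) \<Rightarrow>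
     ('g \<Rightarrow> real^3^3) \<Rightarrow> ('v \<Rightarrow> real^3) \<Rightarrow> ('v set \<Rightarrow> 'v) \<Rightarrow>
     ('v set set \<Rightarrow> 'v set) \<Rightarrow> ('v set set \<Rightarrow> 'v set) \<Rightarrow> ('v set set \<Rightarrow> 'g) \<Rightarrow> bool" where
  "symmetric_independent G V E chi th tau p rep src dst psi \<longleftrightarrow>
     rows_independent
       (orbit_matrix src dst psi tau (\<lambda>X. chi (rep X)) (\<lambda>X. p (rep X)))
       (edge_orbits G E th <+> vertex_orbits G V th)"

definition symmetric_isostatic ::
    "'g monoid \<Rightarrow> 'v set \<Rightarrow> 'v set set \<Rightarrow> 'c set \<Rightarrow> ('v \<Rightarrow> 'c option) \<Rightarrow> ('g \<Rightarrow> 'v \<Rightarrow> 'v) \<Rightarrow>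
     ('g \<Rightarrow> real^3^3) \<Rightarrow> ('v \<Rightarrow> real^3) \<Rightarrow> ('v set \<Rightarrow> 'v) \<Rightarrow>
     ('v set set \<Rightarrow> 'v set) \<Rightarrow> ('v set set \<Rightarrow> 'v set) \<Rightarrow> ('v set set \<Rightarrow> 'g) \<Rightarrow> bool" where
  "symmetric_isostatic G V E C chi th tau p rep src dst psi \<longleftrightarrow>
     symmetric_independent G V E chi th tau p rep src dst psi \<and>
     symmetric_infinitesimally_rigid G V E C chi th tau p"

end

theory Submission
  imports Defs "Jordan_Normal_Form.Determinant"
begin

text \<open>
  The kernel of the orbit matrix consists of the symmetric infinitesimal motions. If these are
  trivial, averaging over the group leaves only the rotation about the axis and, when every vertex
  orbit has its own colour, the translation along the axis; rank and nullity give (i).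

  For (ii), let \<open>S\<close> be the spherical orbit matrix of \<open>F\<close> at the given points. Deleting the colour
  columns of the independent coloured matrix lowers its rank by at most \<open>k(F)\<close> and leaves \<open>S\<close>. On the
  other hand, the edge rows of \<open>S\<close> alone are independent and annihilate the translation along the
  axis, and in the balanced case all three translations (switched by a potential of the gains).
  Generically these do not annihilate the vertex rows, so that one, respectively \<open>min 3 |V(F)|\<close>,
  vertex rows can be added to the edge rows.

  It remains to compare the rank of \<open>S\<close> at the given points with the generic rank on the unit sphere.
  Modulo the vertex rows, moving the points to the unit sphere only rescales edge rows and columns,
  and the normalised configuration is again generic. The rank at a generic point is maximal also for
  matrices with algebraic coefficients, because a polynomial with such coefficients that vanishes at
  a generic point vanishes everywhere on the spheres.
\<close>

section \<open>Families of rows\<close>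

text \<open>Genericity speaks only of rational polynomials, while the entries of the orbit matrix
  involve the rotation matrices. For a polynomial \<open>D\<close> over a real number field the
  natural rational substitute is its norm, but the norm also vanishes where merely a conjugate of
  \<open>D\<close> does, so at a real point its vanishing does not give that of \<open>D\<close>. At
  a rational point the value of \<open>D\<close> is a number of the field, and its norm is zero only
  if the number is. Hence the detour over rational points, which are dense on the sphere.

  The coordinates of the axis need not lie in the field generated by the matrices. Conditions on the
  axis are therefore expressed by sums over the group, which are polynomial over that field and
  equal projections onto the axis up to the factor \<open>q\<close>.

  \<open>spherical_rank\<close> evaluates at a configuration of its own choosing, so the given
  points have to be compared with an arbitrary generic configuration.\<close>

lemma sum_fun_apply: "(\<Sum>w\<in>W. f w) x = (\<Sum>w\<in>W. f w x)" for f :: "'w \<Rightarrow> 'x \<Rightarrow> real"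
  by (induction W rule: infinite_finite_induct) auto

lemma rows_independent_iff:
  assumes "finite W"
  shows "rows_independent A W \<longleftrightarrow>
    (\<forall>c. (\<forall>x. (\<Sum>w\<in>W. c w * A w x) = 0) \<longrightarrow> (\<forall>w\<in>W. c w = 0))"
proof
  assume ind: "rows_independent A W"
  show "\<forall>c. (\<forall>x. (\<Sum>w\<in>W. c w * A w x) = 0) \<longrightarrow> (\<forall>w\<in>W. c w = 0)"
  proof (intro allI impI)
    fix c assume c: "\<forall>x. (\<Sum>w\<in>W. c w * A w x) = 0"
    have inj: "inj_on A W" and li: "row_space.independent (A ` W)"
      using ind unfolding rows_independent_def by auto
    have "(\<Sum>v\<in>A ` W. (\<lambda>x. c (the_inv_into W A v) * v x)) = (\<Sum>w\<in>W. (\<lambda>x. c w * A w x))"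
      by (subst sum.reindex[OF inj]) (auto simp: the_inv_into_f_f[OF inj])
    also have "\<dots> = 0"
      using c by (auto simp: fun_eq_iff sum_fun_apply)
    finally have "\<forall>v\<in>A ` W. c (the_inv_into W A v) = 0"
      using row_space.independentD[OF li, of "A ` W" "\<lambda>v. c (the_inv_into W A v)"] assms by auto
    then show "\<forall>w\<in>W. c w = 0"
      by (auto simp: the_inv_into_f_f[OF inj])
  qed
next
  assume H: "\<forall>c. (\<forall>x. (\<Sum>w\<in>W. c w * A w x) = 0) \<longrightarrow> (\<forall>w\<in>W. c w = 0)"
  have inj: "inj_on A W"
  proof (rule inj_onI, rule ccontr)
    fix v w assume vw: "v \<in> W" "w \<in> W" "A v = A w" "v \<noteq> w"
    let ?c = "\<lambda>u. if u = v then 1 else if u = w then -1 else (0::real)"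
    have "(\<Sum>u\<in>W. ?c u * A u x) = 0" for x
    proof -
      have "(\<Sum>u\<in>W. ?c u * A u x) = (\<Sum>u\<in>{v,w}. ?c u * A u x)"
        by (rule sum.mono_neutral_right) (use assms vw in auto)
      also have "\<dots> = 0" using vw by simp
      finally show ?thesis .
    qed
    with H[rule_format, of ?c v] vw show False by simp
  qed
  have "row_space.independent (A ` W)"
    unfolding row_space.independent_explicit_module
  proof (intro allI impI)
    fix t u v
    assume t: "finite t" "t \<subseteq> A ` W" and s: "(\<Sum>v\<in>t. (\<lambda>x. u v * v x)) = 0" and v: "v \<in> t"
    let ?c = "\<lambda>w. if A w \<in> t then u (A w) else 0"
    have "(\<Sum>w\<in>W. ?c w * A w x) = 0" for x
    proof -
      have "(\<Sum>w\<in>W. ?c w * A w x) = (\<Sum>v\<in>A ` W. (if v \<in> t then u v else 0) * v x)"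
        by (subst sum.reindex[OF inj]) auto
      also have "\<dots> = (\<Sum>v\<in>t. u v * v x)"
        by (rule sum.mono_neutral_cong_right) (use assms t in auto)
      also have "\<dots> = 0"
        using fun_cong[OF s, of x] by (simp add: sum_fun_apply)
      finally show ?thesis .
    qed
    moreover obtain w where "w \<in> W" "v = A w" using v t by auto
    ultimately show "u v = 0" using H[rule_format, of ?c w] v by auto
  qed
  then show "rows_independent A W" using inj unfolding rows_independent_def by auto
qed

lemmas rows_independentI = rows_independent_iff[THEN iffD2, rule_format]
lemmas rows_independentD = rows_independent_iff[THEN iffD1, rule_format]

lemma rows_independent_subset:
  "rows_independent A W \<Longrightarrow> W' \<subseteq> W \<Longrightarrow> rows_independent A W'"
  unfolding rows_independent_def
  by (auto intro: inj_on_subset dest: row_space.independent_mono[OF _ image_mono])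

lemma row_space_spanI:
  assumes "finite W" "\<And>x. v x = (\<Sum>w\<in>W. c w * A w x)"
  shows "v \<in> row_space.span (A ` W)"
proof -
  have "v = (\<Sum>w\<in>W. (\<lambda>x. c w * A w x))"
    using assms(2) by (auto simp: fun_eq_iff sum_fun_apply)
  also have "\<dots> \<in> row_space.span (A ` W)"
    by (intro row_space.span_sum row_space.span_scale row_space.span_base imageI)
  finally show ?thesis .
qed

lemma card_le_row_rank:
  assumes "finite W" "rows_independent B U" "\<And>u. u \<in> U \<Longrightarrow> B u \<in> row_space.span (A ` W)"
  shows "card U \<le> row_rank A W"
proof -
  obtain D where D: "D \<subseteq> A ` W" "row_space.independent D" "A ` W \<subseteq> row_space.span D"
    "card D = row_space.dim (A ` W)"
    using row_space.basis_exists[of "A ` W"] by metis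
  have "finite D" using D(1) assms(1) finite_subset by blast
  moreover have "B ` U \<subseteq> row_space.span D"
    using assms(3) D(3) row_space.span_minimal[OF D(3) row_space.subspace_span] by auto
  moreover have "row_space.independent (B ` U)" "inj_on B U"
    using assms(2) unfolding rows_independent_def by auto
  ultimately have "card (B ` U) \<le> card D"
    using row_space.independent_span_bound[of D "B ` U"] by auto
  then show ?thesis
    using D(4) \<open>inj_on B U\<close> by (simp add: card_image row_rank_def)
qed

lemma row_rank_basis:
  obtains U where "U \<subseteq> W" "rows_independent A U" "card U = row_rank A W"
proof -
  obtain D where D: "D \<subseteq> A ` W" "row_space.independent D" "A ` W \<subseteq> row_space.span D"
    "card D = row_space.dim (A ` W)"
    using row_space.basis_exists[of "A ` W"] by metis
  obtain U where U: "U \<subseteq> W" "inj_on A U" "D = A ` U"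
    using subset_image_inj[of D A W] D(1) by auto
  then show thesis
    using that[of U] D by (auto simp: rows_independent_def row_rank_def card_image)
qed

text \<open>Since \<open>v\<close> is independent of a basis of \<open>B\<close>, some functional is
  1 at \<open>v\<close> and 0 on \<open>B\<close>. On vectors supported in the finite set
  \<open>Col\<close> a functional is a dot product, and \<open>z\<close> lists its values at the
  unit vectors.\<close>

lemma exists_orthogonal:
  assumes Col: "finite Col" and supp: "\<And>b x. b \<in> B \<Longrightarrow> x \<notin> Col \<Longrightarrow> b x = 0"
    and v: "\<And>x. x \<notin> Col \<Longrightarrow> v x = 0" "v \<notin> row_space.span B"
  obtains z :: "'x \<Rightarrow> real" where "\<And>x. x \<notin> Col \<Longrightarrow> z x = 0"
    "\<And>b. b \<in> B \<Longrightarrow> (\<Sum>x\<in>Col. b x * z x) = 0" "(\<Sum>x\<in>Col. v x * z x) \<noteq> 0"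
proof -
  interpret vector_space_pair "\<lambda>(a::real) (f :: 'x \<Rightarrow> real) x. a * f x"
      "scaleR :: real \<Rightarrow> real \<Rightarrow> real"
    by (rule vector_space_pair.intro[OF row_space.vector_space_axioms real_vector.vector_space_axioms])
  obtain D where D: "D \<subseteq> B" "row_space.independent D" "B \<subseteq> row_space.span D"
    using row_space.maximal_independent_subset[of B] by metis
  have "v \<notin> row_space.span D"
    using v(2) row_space.span_mono[OF D(1)] by auto
  then have "row_space.independent (insert v D)"
    using D(2) by (simp add: row_space.independent_insert)
  then obtain phi :: "('x \<Rightarrow> real) \<Rightarrow> real" where phi: "Vector_Spaces.linear (\<lambda>a f x. a * f x) scaleR phi"
     and pv: "\<And>x. x \<in> insert v D \<Longrightarrow> phi x = (if x = v then 1 else 0)"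
    using linear_independent_extend[of "insert v D" "\<lambda>x. if x = v then 1 else 0"] by blast
  define z where "z x = (if x \<in> Col then phi (\<lambda>y. if y = x then 1 else 0) else 0)" for x
  interpret phi: Vector_Spaces.linear "\<lambda>a f x. a * f x" "scaleR" phi by (rule phi)
  have expand: "phi f = (\<Sum>x\<in>Col. f x * z x)" if "\<And>x. x \<notin> Col \<Longrightarrow> f x = 0" for f
  proof -
    have "f = (\<Sum>x\<in>Col. (\<lambda>y. f x * (if y = x then 1 else 0)))"
    proof
      fix y show "f y = (\<Sum>x\<in>Col. (\<lambda>y. f x * (if y = x then 1 else 0))) y"
        unfolding sum_fun_apply using Col that
        by (cases "y \<in> Col") (auto simp: if_distrib[of "(*) _"] sum.delta cong: if_cong)
    qed
    then have "phi f = (\<Sum>x\<in>Col. phi (\<lambda>y. f x * (if y = x then 1 else 0)))"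
      using phi.sum by metis
    also have "\<dots> = (\<Sum>x\<in>Col. f x * z x)"
      unfolding phi.scale z_def by (intro sum.cong) auto
    finally show ?thesis .
  qed
  have "phi b = 0" if "b \<in> B" for b
  proof -
    have "b \<in> row_space.span D" using that D(3) by auto
    then show ?thesis
    proof (rule row_space.span_induct)
      show "row_space.subspace {b. phi b = 0}"
        using phi.subspace_kernel .
      show "phi x = 0" if "x \<in> D" for x
        using pv that \<open>v \<notin> row_space.span D\<close> row_space.span_base by fastforce
    qed
  qed
  then show thesis
    using that[of z] expand supp v(1) pv[of v] by (metis insertI1 z_def zero_neq_one)
qed

text \<open>Rows and kernel vectors are mutually orthogonal, so together they stay independent, and
  by \<open>ker\<close> nothing nonzero supported in \<open>Col\<close> is orthogonal to all of
  them. They thus form a basis of the space of vectors supported in \<open>Col\<close>.\<close>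

lemma rank_nullity:
  assumes fin: "finite Col" "finite W" "finite L"
    and A: "rows_independent A W" "\<And>w x. w \<in> W \<Longrightarrow> x \<notin> Col \<Longrightarrow> A w x = 0"
    and Z: "rows_independent Z L" "\<And>l x. l \<in> L \<Longrightarrow> x \<notin> Col \<Longrightarrow> Z l x = 0"
    and orth: "\<And>w l. w \<in> W \<Longrightarrow> l \<in> L \<Longrightarrow> (\<Sum>x\<in>Col. A w x * Z l x) = 0"
    and ker: "\<And>z. (\<And>x. x \<notin> Col \<Longrightarrow> z x = 0) \<Longrightarrow>
                 (\<And>w. w \<in> W \<Longrightarrow> (\<Sum>x\<in>Col. A w x * z x) = 0) \<Longrightarrow>
                 \<exists>d. \<forall>x. z x = (\<Sum>l\<in>L. d l * Z l x)"
  shows "card W + card L = card Col"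
proof -
  define M where "M = case_sum A Z"
  define U where "U = W <+> L"
  have fU: "finite U" using fin by (simp add: U_def)
  have split: "(\<Sum>u\<in>U. f u) = (\<Sum>w\<in>W. f (Inl w)) + (\<Sum>l\<in>L. f (Inr l))" for f :: "_ \<Rightarrow> real"
    unfolding U_def using fin by (simp add: sum.Plus)
  have supp: "M u x = 0" if "u \<in> U" "x \<notin> Col" for u x
    using that A(2) Z(2) unfolding M_def U_def by auto
  have indep: "rows_independent M U"
  proof (rule rows_independentI[OF fU])
    fix c u assume c: "\<And>x. (\<Sum>u\<in>U. c u * M u x) = 0" and u: "u \<in> U"
    define v where "v x = (\<Sum>l\<in>L. c (Inr l) * Z l x)" for x
    have v: "(\<Sum>w\<in>W. c (Inl w) * A w x) = - v x" for x
      using c[of x] unfolding split M_def v_def by simp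
    \<comment> \<open>\<open>v\<close> is a combination of kernel vectors and \<open>- v\<close> is
      one of rows, so \<open>v\<close> is orthogonal to itself.\<close>
    have "(\<Sum>x\<in>Col. (\<Sum>w\<in>W. c (Inl w) * A w x) * v x) =
        (\<Sum>x\<in>Col. \<Sum>w\<in>W. \<Sum>l\<in>L. c (Inl w) * c (Inr l) * (A w x * Z l x))"
      unfolding v_def sum_product by (intro sum.cong refl) (simp add: ac_simps)
    also have "\<dots> = (\<Sum>w\<in>W. \<Sum>l\<in>L. c (Inl w) * c (Inr l) * (\<Sum>x\<in>Col. A w x * Z l x))"
      unfolding sum_distrib_left by (subst sum.swap, intro sum.cong refl, subst sum.swap) simp
    also have "\<dots> = 0" by (simp add: orth)
    finally have "(\<Sum>x\<in>Col. v x * v x) = 0" unfolding v by (simp add: sum_negf)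
    then have "v x = 0" if "x \<in> Col" for x
      using fin(1) that sum_nonneg_eq_0_iff[of Col "\<lambda>x. v x * v x"] by simp
    moreover have "v x = 0" if "x \<notin> Col" for x
      using that Z(2) unfolding v_def by simp
    ultimately have "v x = 0" for x by blast
    then have "\<forall>l\<in>L. c (Inr l) = 0" "\<forall>w\<in>W. c (Inl w) = 0"
      using rows_independentD[OF fin(3) Z(1), of "\<lambda>l. c (Inr l)"]
        rows_independentD[OF fin(2) A(1), of "\<lambda>w. c (Inl w)"] v unfolding v_def by auto
    then show "c u = 0" using u unfolding U_def by auto
  qed
  define I :: "'a \<Rightarrow> 'a \<Rightarrow> real" where "I x y = (if y = x then 1 else 0)" for x y
  have expand: "f \<in> row_space.span (I ` Col)" if "\<And>x. x \<notin> Col \<Longrightarrow> f x = 0" for f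
  proof (rule row_space_spanI[OF fin(1), where c = f])
    show "f x = (\<Sum>w\<in>Col. f w * I w x)" for x
      using that fin(1) unfolding I_def
      by (cases "x \<in> Col") (auto simp: if_distrib[of "(*) _"] cong: if_cong)
  qed
  have Iind: "rows_independent I Col"
  proof (rule rows_independentI[OF fin(1)])
    fix c w assume c: "\<And>x. (\<Sum>w\<in>Col. c w * I w x) = 0" and w: "w \<in> Col"
    have "(\<Sum>x\<in>Col. c x * I x w) = c w"
      using w fin(1) unfolding I_def by (auto simp: if_distrib[of "(*) _"] cong: if_cong)
    then show "c w = 0" using c[of w] by simp
  qed
  have "card U \<le> row_rank I Col"
    by (rule card_le_row_rank[OF fin(1) indep]) (use expand supp in blast)
  moreover have "row_rank I Col = card Col"
    using Iind unfolding row_rank_def rows_independent_def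
    by (metis card_image row_space.dim_eq_card_independent)
  moreover have "card Col \<le> row_rank M U"
  proof (rule card_le_row_rank[OF fU Iind])
    fix u assume u: "u \<in> Col"
    show "I u \<in> row_space.span (M ` U)"
    proof (rule ccontr)
      assume n: "I u \<notin> row_space.span (M ` U)"
      obtain z where z: "\<And>x. x \<notin> Col \<Longrightarrow> z x = 0"
        "\<And>b. b \<in> M ` U \<Longrightarrow> (\<Sum>x\<in>Col. b x * z x) = 0" "(\<Sum>x\<in>Col. I u x * z x) \<noteq> 0"
        using exists_orthogonal[OF fin(1) _ _ n] supp u unfolding I_def by (smt (verit) imageE)
      have zA: "(\<Sum>x\<in>Col. A w x * z x) = 0" if "w \<in> W" for w
        using z(2)[of "A w"] that unfolding M_def U_def by force
      have zZ: "(\<Sum>x\<in>Col. Z l x * z x) = 0" if "l \<in> L" for l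
        using z(2)[of "Z l"] that unfolding M_def U_def by force
      \<comment> \<open>\<open>z\<close> is orthogonal to the kernel vectors and, by
        \<open>ker\<close>, a combination of them, hence zero.\<close>
      obtain d where d: "\<And>x. z x = (\<Sum>l\<in>L. d l * Z l x)"
        using ker[OF z(1) zA] by blast
      have "(\<Sum>x\<in>Col. z x * z x) = (\<Sum>x\<in>Col. \<Sum>l\<in>L. d l * (Z l x * z x))"
        by (subst (1) d) (simp add: sum_distrib_right mult.assoc)
      also have "\<dots> = (\<Sum>l\<in>L. d l * (\<Sum>x\<in>Col. Z l x * z x))"
        by (subst sum.swap) (simp add: sum_distrib_left)
      also have "\<dots> = 0" by (simp add: zZ)
      finally have "\<forall>x\<in>Col. z x = 0"
        using fin(1) sum_nonneg_eq_0_iff[of Col "\<lambda>x. z x * z x"] by simp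
      with z(3) show False by simp
    qed
  qed
  moreover have "row_rank M U = card U"
    using indep unfolding row_rank_def rows_independent_def
    by (metis card_image row_space.dim_eq_card_independent)
  moreover have "card U = card W + card L"
    unfolding U_def using fin by (simp add: card_Plus)
  ultimately show ?thesis by simp
qed

text \<open>The truncated rows together with the unit vectors of the deleted columns span all
  original rows, so truncation costs at most \<open>card K\<close> in rank.\<close>

lemma rows_independent_delete_columns:
  assumes fin: "finite W" "finite K" and ind: "rows_independent A W"
  obtains U where "U \<subseteq> W" "card W \<le> card U + card K"
    "rows_independent (\<lambda>w x. if x \<in> K then 0 else A w x) U"
proof -
  define B where "B w x = (if x \<in> K then 0 else A w x)" for w x
  obtain U where U: "U \<subseteq> W" "rows_independent B U" "card U = row_rank B W"
    using row_rank_basis by blast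
  obtain D where D: "D \<subseteq> B ` W" "row_space.independent D" "B ` W \<subseteq> row_space.span D"
    "card D = row_space.dim (B ` W)"
    using row_space.basis_exists[of "B ` W"] by metis
  define I :: "'b \<Rightarrow> 'b \<Rightarrow> real" where "I x y = (if y = x then 1 else 0)" for x y
  have fD: "finite D" using D(1) fin(1) finite_subset by blast
  have "A w \<in> row_space.span (D \<union> I ` K)" if "w \<in> W" for w
  proof -
    have Aw: "A w = B w + (\<Sum>x\<in>K. (\<lambda>y. A w x * I x y))"
    proof
      fix y show "A w y = (B w + (\<Sum>x\<in>K. (\<lambda>y. A w x * I x y))) y"
        unfolding plus_fun_def sum_fun_apply B_def I_def using fin(2)
        by (cases "y \<in> K") (auto simp: if_distrib[of "(*) _"] cong: if_cong)
    qed
    have "B w \<in> row_space.span (D \<union> I ` K)"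
      using D(3) that row_space.span_mono[of D "D \<union> I ` K"] by auto
    moreover have "(\<Sum>x\<in>K. (\<lambda>y. A w x * I x y)) \<in> row_space.span (D \<union> I ` K)"
      by (intro row_space.span_sum row_space.span_scale row_space.span_base) auto
    ultimately show ?thesis
      by (subst Aw) (rule row_space.span_add)
  qed
  then have "card (A ` W) \<le> card (D \<union> I ` K)"
    using row_space.independent_span_bound[of "D \<union> I ` K" "A ` W"] fD fin ind
    unfolding rows_independent_def by auto
  also have "\<dots> \<le> card D + card (I ` K)" by (rule card_Un_le)
  also have "\<dots> \<le> card U + card K"
    using D(4) U(3) card_image_le[OF fin(2), of I] by (simp add: row_rank_def)
  finally have "card W \<le> card U + card K"
    using ind by (simp add: rows_independent_def card_image)
  then show thesis using that[of U] U unfolding B_def by blast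
qed

section \<open>Determinants of square arrays\<close>

text \<open>The size is a number and not a type: it will be the dimension of a number ring or the
  number of rows in a set.\<close>

definition array_det :: "nat \<Rightarrow> (nat \<Rightarrow> nat \<Rightarrow> 'a) \<Rightarrow> 'a :: comm_ring_1" where
  "array_det n A = Determinant.det (Matrix.mat n n (\<lambda>(i, j). A i j))"

lemma array_det_leibniz:
  "array_det n A = (\<Sum>p | p permutes {0..<n}. signof p * (\<Prod>i = 0..<n. A i (p i)))"
proof -
  have "(\<Prod>i = 0..<n. Matrix.mat n n (\<lambda>(i, j). A i j) $$ (i, p i)) = (\<Prod>i = 0..<n. A i (p i))"
    if "p permutes {0..<n}" for p
    by (rule prod.cong) (use that in \<open>auto simp: permutes_def permutes_in_image[OF that, simplified] less_le_trans\<close>)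
  then show ?thesis
    unfolding array_det_def by (subst det_def'[of _ n]) (auto intro!: sum.cong)
qed

lemma array_det_eq_0_iff:
  fixes A :: "nat \<Rightarrow> nat \<Rightarrow> 'a :: idom"
  shows "array_det n A = 0 \<longleftrightarrow> (\<exists>v. (\<exists>i<n. v i \<noteq> 0) \<and> (\<forall>i<n. (\<Sum>j<n. A i j * v j) = 0))"
proof -
  let ?M = "Matrix.mat n n (\<lambda>(i, j). A i j)"
  have "array_det n A = 0 \<longleftrightarrow>
      (\<exists>v. v \<in> carrier_vec n \<and> v \<noteq> 0\<^sub>v n \<and> ?M *\<^sub>v v = 0\<^sub>v n)"
    unfolding array_det_def by (rule det_0_iff_vec_prod_zero) auto
  also have "\<dots> \<longleftrightarrow> (\<exists>v. (\<exists>i<n. v i \<noteq> 0) \<and> (\<forall>i<n. (\<Sum>j<n. A i j * v j) = 0))"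
  proof safe
    fix v assume v: "v \<in> carrier_vec n" "v \<noteq> 0\<^sub>v n" "?M *\<^sub>v v = 0\<^sub>v n"
    have "(\<Sum>j<n. A i j * vec_index v j) = 0" if "i < n" for i
    proof -
      have "vec_index (?M *\<^sub>v v) i = (\<Sum>j<n. A i j * vec_index v j)"
        using that v(1) by (simp add: scalar_prod_def lessThan_atLeast0)
      then show ?thesis using v(3) that by simp
    qed
    moreover have "\<exists>i<n. vec_index v i \<noteq> 0"
      using v(1,2) by (metis carrier_vecD eq_vecI index_zero_vec)
    ultimately show "\<exists>v. (\<exists>i<n. v i \<noteq> 0) \<and> (\<forall>i<n. (\<Sum>j<n. A i j * v j) = 0)" by blast
  next
    fix v i assume v: "i < n" "v i \<noteq> 0" "\<forall>i<n. (\<Sum>j<n. A i j * v j) = 0"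
    have "vec n v \<noteq> 0\<^sub>v n" using v by (metis index_vec index_zero_vec(1))
    moreover have "?M *\<^sub>v vec n v = 0\<^sub>v n"
    proof (rule eq_vecI)
      fix j assume "j < dim_vec (0\<^sub>v n :: 'a vec)"
      then have j: "j < n" by simp
      then show "vec_index (?M *\<^sub>v vec n v) j = vec_index (0\<^sub>v n) j"
        using v(3)[rule_format, OF j] by (simp add: scalar_prod_def lessThan_atLeast0)
    qed simp
    ultimately show "\<exists>v. v \<in> carrier_vec n \<and> v \<noteq> 0\<^sub>v n \<and> ?M *\<^sub>v v = 0\<^sub>v n"
      by (intro exI[of _ "vec n v"]) auto
  qed
  finally show ?thesis .
qed

lemma array_det_transpose: "array_det n (\<lambda>i j. A j i) = array_det n A"
proof -
  have "Matrix.mat n n (\<lambda>(i, j). A j i) = transpose_mat (Matrix.mat n n (\<lambda>(i, j). A i j))"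
    by (rule eq_matI) auto
  then show ?thesis
    unfolding array_det_def using det_transpose[of "Matrix.mat n n (\<lambda>(i, j). A i j)" n] by simp
qed

lemma array_det_hom:
  assumes "comm_ring_hom h"
  shows "array_det n (\<lambda>i j. h (A i j)) = h (array_det n A)"
proof -
  interpret comm_ring_hom h by (rule assms)
  have "Matrix.mat n n (\<lambda>(i, j). h (A i j)) = map_mat h (Matrix.mat n n (\<lambda>(i, j). A i j))"
    by (rule eq_matI) auto
  then show ?thesis unfolding array_det_def by simp
qed

section \<open>Polynomials with rational coefficients\<close>

definition mon_eval :: "('x \<Rightarrow> 'b::comm_ring_1) \<Rightarrow> ('x \<Rightarrow>\<^sub>0 nat) \<Rightarrow> 'b" where
  "mon_eval a m = (\<Prod>x \<in> Poly_Mapping.keys m. a x ^ Poly_Mapping.lookup m x)"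

text \<open>One evaluation for three targets: the reals with \<open>of_rat\<close>, the rationals
  with the identity, and polynomials with \<open>mconst\<close>, where evaluation is
  substitution.\<close>

definition poly_eval :: "(rat \<Rightarrow> 'b::comm_ring_1) \<Rightarrow> ('x \<Rightarrow> 'b) \<Rightarrow> 'x rat_mpoly \<Rightarrow> 'b" where
  "poly_eval h a f = (\<Sum>m \<in> Poly_Mapping.keys f. h (Poly_Mapping.lookup f m) * mon_eval a m)"

definition mconst :: "rat \<Rightarrow> 'x rat_mpoly" where
  "mconst c = Poly_Mapping.single 0 c"

lemma eval_mpoly_eq: "eval_mpoly a f = poly_eval of_rat a f"
  unfolding eval_mpoly_def poly_eval_def mon_eval_def by simp

lemma mon_eval_superset:
  assumes "finite S" "Poly_Mapping.keys m \<subseteq> S"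
  shows "mon_eval a m = (\<Prod>x\<in>S. a x ^ Poly_Mapping.lookup m x)"
  unfolding mon_eval_def
  by (rule prod.mono_neutral_left) (use assms in \<open>auto simp: in_keys_iff\<close>)

lemma mon_eval_add: "mon_eval a (m + n) = mon_eval a m * mon_eval a n"
proof -
  let ?S = "Poly_Mapping.keys m \<union> Poly_Mapping.keys n"
  have "Poly_Mapping.keys (m + n) \<subseteq> ?S" by (rule Poly_Mapping.keys_add)
  then show ?thesis
    by (simp add: mon_eval_superset[of ?S] lookup_add power_add prod.distrib)
qed

lemma mon_eval_0 [simp]: "mon_eval a 0 = 1"
  by (simp add: mon_eval_def)

lemma mon_eval_single [simp]: "mon_eval a (Poly_Mapping.single x n) = a x ^ n"
  by (simp add: mon_eval_def)

lemma mon_eval_cong: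
  "(\<And>x. x \<in> Poly_Mapping.keys m \<Longrightarrow> a x = b x) \<Longrightarrow> mon_eval a m = mon_eval b m"
  unfolding mon_eval_def by (intro prod.cong) auto

lemma mpoly_sum_monomials:
  "f = (\<Sum>m\<in>Poly_Mapping.keys f. Poly_Mapping.single m (Poly_Mapping.lookup f m))"
  by (rule poly_mapping_eqI)
    (auto simp: lookup_sum lookup_single when_def in_keys_iff sum.delta)

lemma comm_ring_hom_mconst: "comm_ring_hom (mconst :: rat \<Rightarrow> 'x rat_mpoly)"
  by unfold_locales (auto simp: mconst_def single_add mult_single)

lemma comm_ring_hom_of_rat: "comm_ring_hom (of_rat :: rat \<Rightarrow> 'a :: field_char_0)"
  by unfold_locales (auto simp: of_rat_add of_rat_mult)

context
  fixes h :: "rat \<Rightarrow> 'b :: comm_ring_1"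
  assumes h: "comm_ring_hom h"
begin

interpretation h: comm_ring_hom h by (rule h)

lemma poly_eval_superset:
  assumes "finite S" "Poly_Mapping.keys f \<subseteq> S"
  shows "poly_eval h a f = (\<Sum>m\<in>S. h (Poly_Mapping.lookup f m) * mon_eval a m)"
  unfolding poly_eval_def
  by (rule sum.mono_neutral_left) (use assms in \<open>auto simp: in_keys_iff\<close>)

lemma poly_eval_add: "poly_eval h a (f + g) = poly_eval h a f + poly_eval h a g"
proof -
  let ?S = "Poly_Mapping.keys f \<union> Poly_Mapping.keys g"
  have "Poly_Mapping.keys (f + g) \<subseteq> ?S" by (rule Poly_Mapping.keys_add)
  then show ?thesis
    by (simp add: poly_eval_superset[of ?S] lookup_add h.hom_add distrib_right sum.distrib)
qed

lemma poly_eval_0 [simp]: "poly_eval h a 0 = 0"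
  by (simp add: poly_eval_def)

lemma poly_eval_sum: "poly_eval h a (\<Sum>i\<in>I. f i) = (\<Sum>i\<in>I. poly_eval h a (f i))"
  by (induction I rule: infinite_finite_induct) (auto simp: poly_eval_add)

lemma poly_eval_single: "poly_eval h a (Poly_Mapping.single m c) = h c * mon_eval a m"
  by (simp add: poly_eval_def)

lemma poly_eval_mult: "poly_eval h a (f * g) = poly_eval h a f * poly_eval h a g"
proof -
  have "f * g = (\<Sum>m\<in>Poly_Mapping.keys f. Poly_Mapping.single m (Poly_Mapping.lookup f m)) *
      (\<Sum>n\<in>Poly_Mapping.keys g. Poly_Mapping.single n (Poly_Mapping.lookup g n))"
    using mpoly_sum_monomials by metis
  also have "\<dots> = (\<Sum>m\<in>Poly_Mapping.keys f. \<Sum>n\<in>Poly_Mapping.keys g.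
      Poly_Mapping.single (m + n) (Poly_Mapping.lookup f m * Poly_Mapping.lookup g n))"
    by (simp add: sum_product mult_single)
  finally have "poly_eval h a (f * g) = (\<Sum>m\<in>Poly_Mapping.keys f. \<Sum>n\<in>Poly_Mapping.keys g.
      h (Poly_Mapping.lookup f m) * mon_eval a m * (h (Poly_Mapping.lookup g n) * mon_eval a n))"
    by (simp add: poly_eval_sum poly_eval_single mon_eval_add h.hom_mult ac_simps)
  then show ?thesis
    by (simp add: sum_product poly_eval_def)
qed

lemma poly_eval_mconst [simp]: "poly_eval h a (mconst c) = h c"
  by (simp add: mconst_def poly_eval_single)

lemma poly_eval_1 [simp]: "poly_eval h a 1 = 1"
  using poly_eval_mconst[of a 1] by (simp add: mconst_def)

lemma poly_eval_mvar [simp]: "poly_eval h a (mvar x) = a x"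
  by (simp add: mvar_def poly_eval_single)

lemma poly_eval_uminus: "poly_eval h a (- f) = - poly_eval h a f"
  using poly_eval_add[of a f "- f"] by (simp add: eq_neg_iff_add_eq_0 add.commute)

lemma poly_eval_diff: "poly_eval h a (f - g) = poly_eval h a f - poly_eval h a g"
  using poly_eval_add[of a f "- g"] by (simp add: poly_eval_uminus)

lemma poly_eval_power: "poly_eval h a (f ^ n) = poly_eval h a f ^ n"
  by (induction n) (auto simp: poly_eval_mult)

lemma poly_eval_prod: "poly_eval h a (\<Prod>i\<in>I. f i) = (\<Prod>i\<in>I. poly_eval h a (f i))"
  by (induction I rule: infinite_finite_induct) (auto simp: poly_eval_mult)

end

lemma poly_eval_of_rat: "poly_eval of_rat (\<lambda>x. of_rat (a x)) f = of_rat (poly_eval (\<lambda>x. x) a f)"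
  unfolding poly_eval_def mon_eval_def
  by (simp add: of_rat_sum of_rat_mult of_rat_prod of_rat_power)

lemma sum_singles: "(\<Sum>x\<in>Poly_Mapping.keys m. Poly_Mapping.single x (Poly_Mapping.lookup m x)) = m"
  by (rule poly_mapping_eqI)
    (auto simp: lookup_sum lookup_single when_def in_keys_iff sum.delta)

lemma mvar_power: "mvar x ^ n = Poly_Mapping.single (Poly_Mapping.single x n) 1"
  by (induction n) (auto simp: mvar_def mult_single single_add[symmetric])

lemma mon_eval_mvar: "mon_eval mvar m = Poly_Mapping.single m 1"
proof -
  have "(\<Prod>x\<in>S. mvar x ^ Poly_Mapping.lookup m x) =
      Poly_Mapping.single (\<Sum>x\<in>S. Poly_Mapping.single x (Poly_Mapping.lookup m x)) 1"
    if "finite S" for S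
    using that by (induction S) (auto simp: mvar_power mult_single)
  then show ?thesis
    unfolding mon_eval_def by (simp add: sum_singles)
qed

lemma poly_eval_mvar_id: "poly_eval mconst mvar f = f"
  unfolding poly_eval_def mon_eval_mvar
  by (subst (3) mpoly_sum_monomials) (simp add: mconst_def mult_single)

lemma polys_in_mconst: "mconst c \<in> polys_in A"
  by (auto simp: polys_in_def mconst_def)

lemma polys_in_0: "0 \<in> polys_in A"
  by (auto simp: polys_in_def)

lemma polys_in_1: "1 \<in> polys_in A"
  by (auto simp: polys_in_def)

lemma polys_in_mvar: "x \<in> A \<Longrightarrow> mvar x \<in> polys_in A"
  by (auto simp: polys_in_def mvar_def)

lemma polys_in_add: "f \<in> polys_in A \<Longrightarrow> g \<in> polys_in A \<Longrightarrow> f + g \<in> polys_in A"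
  unfolding polys_in_def using Poly_Mapping.keys_add[of f g] by blast

lemma polys_in_mult: "f \<in> polys_in A \<Longrightarrow> g \<in> polys_in A \<Longrightarrow> f * g \<in> polys_in A"
  unfolding polys_in_def
  using keys_mult[of f g] Poly_Mapping.keys_add by (fastforce simp: subset_iff)

lemma polys_in_sum: "(\<And>i. i \<in> I \<Longrightarrow> f i \<in> polys_in A) \<Longrightarrow> (\<Sum>i\<in>I. f i) \<in> polys_in A"
  by (induction I rule: infinite_finite_induct) (auto intro: polys_in_add polys_in_0)

lemma polys_in_prod: "(\<And>i. i \<in> I \<Longrightarrow> f i \<in> polys_in A) \<Longrightarrow> (\<Prod>i\<in>I. f i) \<in> polys_in A"
  by (induction I rule: infinite_finite_induct) (auto intro: polys_in_mult polys_in_1)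

lemma polys_in_power: "f \<in> polys_in A \<Longrightarrow> f ^ n \<in> polys_in A"
  by (induction n) (auto intro: polys_in_mult polys_in_1)

text \<open>Substituting every variable by itself returns the polynomial
  (\<open>poly_eval_mvar_id\<close>), which exhibits it as a sum of products of constants and
  variables.\<close>

lemma polys_in_induct [consumes 1, case_names const var add mult]:
  assumes f: "f \<in> polys_in A"
    and const: "\<And>c. P (mconst c)" and var: "\<And>x. x \<in> A \<Longrightarrow> P (mvar x)"
    and add: "\<And>f g. P f \<Longrightarrow> P g \<Longrightarrow> P (f + g)" and mult: "\<And>f g. P f \<Longrightarrow> P g \<Longrightarrow> P (f * g)"
  shows "P f"
proof -
  have 0: "P 0" and 1: "P 1"
    using const[of 0] const[of 1] by (auto simp: mconst_def)
  have pow: "P (f ^ n)" if "P f" for f n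
    by (induction n) (auto intro: 1 mult that)
  have "P (mon_eval mvar m)" if "Poly_Mapping.keys m \<subseteq> A" for m
  proof -
    have "P (\<Prod>x\<in>S. mvar x ^ Poly_Mapping.lookup m x)" if "finite S" "S \<subseteq> A" for S
      using that by (induction S) (auto intro: 1 mult pow var)
    then show ?thesis unfolding mon_eval_def using that by simp
  qed
  then have tm: "P (mconst (Poly_Mapping.lookup f m) * mon_eval mvar m)" if "m \<in> Poly_Mapping.keys f" for m
    using f that by (auto simp: polys_in_def intro!: mult const)
  have "P (\<Sum>m\<in>S. g m)" if "finite S" "\<And>m. m \<in> S \<Longrightarrow> P (g m)" for S and g :: "('a \<Rightarrow>\<^sub>0 nat) \<Rightarrow> _"
    using that by (induction S) (auto intro: 0 add)
  then have "P (poly_eval mconst mvar f)"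
    unfolding poly_eval_def by (simp add: tm)
  then show ?thesis by (simp add: poly_eval_mvar_id)
qed

lemma poly_eval_in_polys_in:
  assumes "f \<in> polys_in A" "\<And>x. x \<in> A \<Longrightarrow> a x \<in> polys_in B"
  shows "poly_eval mconst a f \<in> polys_in B"
  using assms(1)
  by (induction rule: polys_in_induct)
    (auto simp: poly_eval_add poly_eval_mult comm_ring_hom_mconst assms(2)
      intro: polys_in_mconst polys_in_add polys_in_mult)

text \<open>Leibniz's formula is a polynomial in the entries and so commutes with
  evaluation.\<close>

lemma polys_in_array_det:
  assumes "\<And>i j. i < n \<Longrightarrow> j < n \<Longrightarrow> M i j \<in> polys_in A"
  shows "\<exists>f\<in>polys_in A. \<forall>a. poly_eval of_rat a f =
      (array_det n (\<lambda>i j. poly_eval of_rat a (M i j)) :: 'b :: field_char_0)"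
proof
  have sg: "(signof p :: 'x rat_mpoly) = mconst (signof p)" for p :: "nat \<Rightarrow> nat"
    by (simp add: sign_def mconst_def flip: single_uminus)
  show "array_det n M \<in> polys_in A"
    unfolding array_det_leibniz sg
    by (intro polys_in_sum polys_in_mult polys_in_mconst polys_in_prod assms)
      (auto simp: permutes_def permutes_in_image)
  show "\<forall>a. poly_eval of_rat a (array_det n M) =
      (array_det n (\<lambda>i j. poly_eval of_rat a (M i j)) :: 'b)"
    unfolding array_det_leibniz sg
    by (simp add: poly_eval_sum poly_eval_mult poly_eval_prod comm_ring_hom_of_rat)
qed

no_notation Matrix.vec_index (infixl "$" 100)
no_notation Matrix.scalar_prod (infix "\<bullet>" 70)
hide_const (open) Matrix.mat Determinant.det

section \<open>Polynomial functions with algebraic coefficients\<close>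

interpretation rat_space: vector_space "\<lambda>(c::rat) (x::real). of_rat c * x"
  by unfold_locales (auto simp: of_rat_add of_rat_mult algebra_simps)

text \<open>A subring of the reals of finite dimension over the rationals, that is, a real number
  field. The finite dimension turns multiplication by an element into a rational matrix.\<close>

definition number_ring :: "real set \<Rightarrow> bool" where
  "number_ring K \<longleftrightarrow> (\<exists>T. finite T \<and> K = rat_space.span T) \<and> 1 \<in> K \<and> (\<forall>x\<in>K. \<forall>y\<in>K. x * y \<in> K)"

lemma rat_span_mult:
  assumes "\<And>a b. a \<in> S \<Longrightarrow> b \<in> T \<Longrightarrow> a * b \<in> rat_space.span U"
    and x: "x \<in> rat_space.span S" and y: "y \<in> rat_space.span T"
  shows "x * y \<in> rat_space.span U"
proof -
  have "a * y \<in> rat_space.span U" if "a \<in> S" for a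
    using y
  proof (rule rat_space.span_induct)
    show "rat_space.subspace {y. a * y \<in> rat_space.span U}"
      using rat_space.span_scale[of "a * _" U]
      by (auto simp: rat_space.subspace_def distrib_left mult.left_commute[of a]
          intro: rat_space.span_zero rat_space.span_add)
  qed (use assms(1) that in auto)
  with x show ?thesis
  proof (elim rat_space.span_induct)
    show "rat_space.subspace {x. x * y \<in> rat_space.span U}"
      unfolding rat_space.subspace_def
      by (auto simp: distrib_right mult.assoc
          intro: rat_space.span_zero rat_space.span_add rat_space.span_scale)
  qed auto
qed

text \<open>Divided by its leading coefficient, the polynomial \<open>p\<close> expresses
  \<open>\<alpha> ^ d\<close> by lower powers, so the products of generators of \<open>K\<close>
  with the powers below \<open>d\<close> span a ring.\<close>

lemma number_ring_adjoin:
  assumes K: "number_ring K" and alg: "algebraic (\<alpha>::real)"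
  obtains K' where "number_ring K'" "K \<subseteq> K'" "\<alpha> \<in> K'"
proof -
  obtain T where T: "finite T" "K = rat_space.span T" and 1: "1 \<in> K"
    and mult: "\<And>x y. x \<in> K \<Longrightarrow> y \<in> K \<Longrightarrow> x * y \<in> K"
    using K unfolding number_ring_def by auto
  obtain p where p: "\<And>i. coeff p i \<in> \<int>" "p \<noteq> 0" "poly p \<alpha> = 0"
    using alg unfolding algebraic_def by auto
  define d where "d = degree p"
  define P where "P = (\<lambda>i. \<alpha> ^ i) ` {..<d}"
  have rat: "\<exists>c. of_rat c = coeff p i / lead_coeff p" for i
    using p(1)[of i] p(1)[of d] unfolding d_def
    by (metis Ints_cases Rats_cases Rats_divide Rats_of_int)
  then obtain c where c: "\<And>i. of_rat (c i) = coeff p i / lead_coeff p" by metis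
  have "0 = (\<Sum>i\<le>d. coeff p i * \<alpha> ^ i) / lead_coeff p"
    using p(3) unfolding poly_altdef d_def by simp
  also have "\<dots> = (\<Sum>i\<le>d. of_rat (c i) * \<alpha> ^ i)"
    by (simp add: c sum_divide_distrib)
  also have "\<dots> = (\<Sum>i<d. of_rat (c i) * \<alpha> ^ i) + \<alpha> ^ d"
    using p(2) by (simp add: c d_def lessThan_Suc_atMost[symmetric])
  finally have red: "\<alpha> ^ d = - (\<Sum>i<d. of_rat (c i) * \<alpha> ^ i)" by simp
  have pow: "\<alpha> ^ n \<in> rat_space.span P" for n
  proof (induction n rule: less_induct)
    case (less n)
    show ?case
    proof (cases "n < d")
      case True
      then show ?thesis unfolding P_def by (auto intro: rat_space.span_base)
    next
      case False
      have "\<alpha> ^ n = \<alpha> ^ (n - d) * \<alpha> ^ d" using False by (simp flip: power_add)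
      also have "\<dots> = - (\<Sum>i<d. of_rat (c i) * \<alpha> ^ (n - d + i))"
        unfolding red by (simp add: sum_distrib_left power_add ac_simps)
      also have "\<dots> \<in> rat_space.span P"
        by (intro rat_space.span_neg rat_space.span_sum rat_space.span_scale less.IH)
          (use False in auto)
      finally show ?thesis .
    qed
  qed
  define U where "U = {t * \<alpha> ^ i | t i. t \<in> T \<and> i < d}"
  have KP: "x * \<alpha> ^ n \<in> rat_space.span U" if "x \<in> K" for x n
    by (rule rat_span_mult[OF _ that[unfolded T(2)] pow])
      (auto simp: U_def P_def intro!: rat_space.span_base)
  show thesis
  proof (rule that[of "rat_space.span U"])
    show "K \<subseteq> rat_space.span U" using KP[of _ 0] by auto
    then have "1 \<in> rat_space.span U" using 1 by auto
    show "\<alpha> \<in> rat_space.span U" using KP[OF 1, of 1] by simp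
    have "a * b \<in> rat_space.span U" if ab: "a \<in> U" "b \<in> U" for a b
    proof -
      obtain t i where a: "a = t * \<alpha> ^ i" "t \<in> T" using ab(1) unfolding U_def by blast
      obtain t' j where b: "b = t' * \<alpha> ^ j" "t' \<in> T" using ab(2) unfolding U_def by blast
      have "t * t' \<in> K" using a(2) b(2) by (auto simp: T(2) intro: rat_space.span_base mult[unfolded T(2)])
      from KP[OF this, of "i + j"] show ?thesis by (simp add: a b power_add ac_simps)
    qed
    then have "\<forall>x\<in>rat_space.span U. \<forall>y\<in>rat_space.span U. x * y \<in> rat_space.span U"
      using rat_span_mult by blast
    moreover have "U = (\<lambda>(t, i). t * \<alpha> ^ i) ` (T \<times> {..<d})"
      unfolding U_def by auto
    then have "finite U" using T(1) by simp
    ultimately show "number_ring (rat_space.span U)"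
      using \<open>1 \<in> rat_space.span U\<close> unfolding number_ring_def by blast
  qed
qed

lemma number_ring_exists:
  assumes "finite B" "\<And>x. x \<in> B \<Longrightarrow> algebraic (x::real)"
  obtains K where "number_ring K" "B \<subseteq> K"
proof -
  have "\<exists>K. number_ring K \<and> B \<subseteq> K"
    using assms
  proof (induction B)
    case empty
    have "x * y \<in> rat_space.span {1}" if "x \<in> rat_space.span {1}" "y \<in> rat_space.span {1}" for x y
      by (rule rat_span_mult[OF _ that]) (auto intro: rat_space.span_base)
    then have "number_ring (rat_space.span {1})"
      unfolding number_ring_def by (auto intro: rat_space.span_base)
    then show ?case by blast
  next
    case (insert x B)
    then obtain K where "number_ring K" "B \<subseteq> K" by auto
    with number_ring_adjoin[of K x] insert.prems show ?case by (metis insert_iff insert_subset subset_trans)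
  qed
  then show thesis using that by blast
qed

definition rat_basis :: "real set \<Rightarrow> nat \<Rightarrow> (nat \<Rightarrow> real) \<Rightarrow> bool" where
  "rat_basis K d e \<longleftrightarrow> (\<forall>i<d. e i \<in> K) \<and> (\<forall>x\<in>K. \<exists>c. x = (\<Sum>i<d. of_rat (c i) * e i)) \<and>
     (\<forall>c. (\<Sum>i<d. of_rat (c i) * e i) = 0 \<longrightarrow> (\<forall>i<d. c i = 0))"

lemma number_ring_basis:
  assumes K: "number_ring K"
  obtains d e where "rat_basis K d e"
proof -
  obtain T where T: "finite T" "K = rat_space.span T" using K unfolding number_ring_def by auto
  obtain D where D: "D \<subseteq> T" "rat_space.independent D" "T \<subseteq> rat_space.span D"
    using rat_space.maximal_independent_subset[of T] by metis
  have fD: "finite D" using D(1) T(1) finite_subset by blast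
  have span: "K = rat_space.span D"
    using D T(2) rat_space.span_minimal[OF D(3) rat_space.subspace_span] rat_space.span_mono[OF D(1)]
    by auto
  obtain e where e: "bij_betw e {..<card D} D"
    using ex_bij_betw_nat_finite[OF fD] by (auto simp: atLeast0LessThan)
  then have inj: "inj_on e {..<card D}" and im: "e ` {..<card D} = D" by (auto simp: bij_betw_def)
  show thesis
  proof (rule that[of "card D" e], unfold rat_basis_def, intro conjI allI impI ballI)
    show "e i \<in> K" if "i < card D" for i
      using that im unfolding span by (auto intro: rat_space.span_base)
  next
    fix x assume "x \<in> K"
    then obtain u where "x = (\<Sum>v\<in>D. of_rat (u v) * v)"
      unfolding span using rat_space.span_finite[OF fD] by auto
    also have "\<dots> = (\<Sum>i<card D. of_rat (u (e i)) * e i)"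
      by (rule sum.reindex_bij_betw[OF e, symmetric])
    finally show "\<exists>c. x = (\<Sum>i<card D. of_rat (c i) * e i)" by (rule exI[of _ "\<lambda>i. u (e i)"])
  next
    fix c assume c: "(\<Sum>i<card D. of_rat (c i) * e i) = 0"
    let ?u = "\<lambda>v. c (the_inv_into {..<card D} e v)"
    have "(\<Sum>v\<in>D. of_rat (?u v) * v) = (\<Sum>i<card D. of_rat (?u (e i)) * e i)"
      by (rule sum.reindex_bij_betw[OF e, symmetric])
    also have "\<dots> = 0"
      using c by (simp add: the_inv_into_f_f[OF inj])
    finally have "\<forall>v\<in>D. ?u v = 0"
      using rat_space.independentD[OF D(2) fD subset_refl, of ?u] by blast
    then have "?u (e i) = 0" if "i < card D" for i
      using im that by blast
    then show "c i = 0" if "i < card D" for i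
      using that by (simp add: the_inv_into_f_f[OF inj])
  qed
qed

lemma number_ring_rat_mem: "number_ring K \<Longrightarrow> of_rat c \<in> K"
  unfolding number_ring_def using rat_space.span_scale[of 1 _ c] by auto

text \<open>Polynomial functions of a configuration with coefficients in \<open>K\<close>. Functions
  serve as well as formal polynomials here, because only their values, their continuity and their
  rational components enter.\<close>

inductive_set coord_polys :: "real set \<Rightarrow> 'o set \<Rightarrow> (('o \<Rightarrow> real^3) \<Rightarrow> real) set"
  for K :: "real set" and X :: "'o set" where
  const: "k \<in> K \<Longrightarrow> (\<lambda>_. k) \<in> coord_polys K X"
| coord: "i \<in> X \<Longrightarrow> (\<lambda>y. y i $ m) \<in> coord_polys K X"
| add: "f \<in> coord_polys K X \<Longrightarrow> g \<in> coord_polys K X \<Longrightarrow> (\<lambda>y. f y + g y) \<in> coord_polys K X"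
| mult: "f \<in> coord_polys K X \<Longrightarrow> g \<in> coord_polys K X \<Longrightarrow> (\<lambda>y. f y * g y) \<in> coord_polys K X"

text \<open>The value 0 at the dummy radius is the one in \<open>generic_on_unit_sphere\<close>, so
  that both evaluate at the same point.\<close>

definition coords :: "('o \<Rightarrow> real^3) \<Rightarrow> 'o \<times> 3 + unit \<Rightarrow> real" where
  "coords y = case_sum (\<lambda>(i, m). y i $ m) (\<lambda>_. 0)"

text \<open>Coefficients are split into their components along \<open>e\<close>. Products are
  brought back to this form by the structure constants \<open>t\<close> of the ring,
  \<open>e k * e l\<close> being an element of \<open>K\<close> again.\<close>

lemma coord_polys_representation:
  assumes K: "number_ring K"
    and e: "\<And>i. i < d \<Longrightarrow> e i \<in> K" "\<And>x. x \<in> K \<Longrightarrow> \<exists>c. x = (\<Sum>i<d. of_rat (c i) * e i)"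
    and D: "D \<in> coord_polys K X"
  shows "\<exists>f. (\<forall>j<d. f j \<in> polys_in ((X \<times> UNIV) <+> {})) \<and>
    (\<forall>y. D y = (\<Sum>j<d. poly_eval of_rat (coords y) (f j) * e j))"
  using D
proof (induction rule: coord_polys.induct)
  case (const k)
  then obtain c where "k = (\<Sum>i<d. of_rat (c i) * e i)" using e(2) by blast
  then show ?case
    by (intro exI[of _ "\<lambda>i. mconst (c i)"]) (auto simp: comm_ring_hom_of_rat polys_in_mconst)
next
  case (coord i m)
  \<comment> \<open>A coordinate function is spread over the basis by multiplying it with 1, written
    in terms of \<open>e\<close>.\<close>
  have "1 \<in> K" using K by (simp add: number_ring_def)
  then obtain c where c: "1 = (\<Sum>i<d. of_rat (c i) * e i)" using e(2) by blast
  have "y i $ m = (\<Sum>j<d. of_rat (c j) * y i $ m * e j)" for y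
  proof -
    have "y i $ m = y i $ m * (\<Sum>i<d. of_rat (c i) * e i)" by (simp flip: c)
    then show ?thesis by (simp add: sum_distrib_left ac_simps)
  qed
  then show ?case using coord
    by (intro exI[of _ "\<lambda>j. mconst (c j) * mvar (Inl (i, m))"])
      (auto simp: comm_ring_hom_of_rat poly_eval_mult coords_def
        intro!: polys_in_mconst polys_in_mult polys_in_mvar)
next
  case (add f g)
  then obtain f' g' where "\<forall>j<d. f' j \<in> polys_in ((X \<times> UNIV) <+> {})"
    "\<forall>y. f y = (\<Sum>j<d. poly_eval of_rat (coords y) (f' j) * e j)"
    "\<forall>j<d. g' j \<in> polys_in ((X \<times> UNIV) <+> {})"
    "\<forall>y. g y = (\<Sum>j<d. poly_eval of_rat (coords y) (g' j) * e j)" by blast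
  then show ?case
    by (intro exI[of _ "\<lambda>j. f' j + g' j"])
      (auto simp: comm_ring_hom_of_rat poly_eval_add sum.distrib distrib_right intro: polys_in_add)
next
  case (mult f g)
  then obtain f' g' where f: "\<forall>j<d. f' j \<in> polys_in ((X \<times> UNIV) <+> {})"
    "\<forall>y. f y = (\<Sum>j<d. poly_eval of_rat (coords y) (f' j) * e j)"
    and g: "\<forall>j<d. g' j \<in> polys_in ((X \<times> UNIV) <+> {})"
    "\<forall>y. g y = (\<Sum>j<d. poly_eval of_rat (coords y) (g' j) * e j)" by blast
  have "\<exists>c. e k * e l = (\<Sum>i<d. of_rat (c i) * e i)" if "k < d" "l < d" for k l
    using K e that unfolding number_ring_def by blast
  then obtain t where t: "e k * e l = (\<Sum>j<d. of_rat (t k l j) * e j)" if "k < d" "l < d" for k l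
    by metis
  define h where "h j = (\<Sum>k<d. \<Sum>l<d. mconst (t k l j) * (f' k * g' l))" for j
  have "f y * g y = (\<Sum>j<d. poly_eval of_rat (coords y) (h j) * e j)" for y
  proof -
    let ?F = "\<lambda>k. poly_eval of_rat (coords y) (f' k)" and ?G = "\<lambda>k. poly_eval of_rat (coords y) (g' k)"
    have "f y * g y = (\<Sum>k<d. \<Sum>l<d. ?F k * ?G l * (e k * e l))"
      using f g by (simp add: sum_product ac_simps)
    also have "\<dots> = (\<Sum>k<d. \<Sum>l<d. \<Sum>j<d. of_rat (t k l j) * (?F k * ?G l) * e j)"
      by (intro sum.cong refl) (simp add: t sum_distrib_left ac_simps)
    also have "\<dots> = (\<Sum>j<d. \<Sum>k<d. \<Sum>l<d. of_rat (t k l j) * (?F k * ?G l) * e j)"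
    proof -
      have "(\<Sum>k<d. \<Sum>l<d. \<Sum>j<d. of_rat (t k l j) * (?F k * ?G l) * e j) =
          (\<Sum>k<d. \<Sum>j<d. \<Sum>l<d. of_rat (t k l j) * (?F k * ?G l) * e j)"
        by (rule sum.cong[OF refl]) (rule sum.swap)
      also have "\<dots> = (\<Sum>j<d. \<Sum>k<d. \<Sum>l<d. of_rat (t k l j) * (?F k * ?G l) * e j)"
        by (rule sum.swap)
      finally show ?thesis .
    qed
    also have "\<dots> = (\<Sum>j<d. poly_eval of_rat (coords y) (h j) * e j)"
      unfolding h_def
      by (simp add: comm_ring_hom_of_rat poly_eval_sum poly_eval_mult sum_distrib_right)
    finally show ?thesis .
  qed
  moreover have "\<forall>j<d. h j \<in> polys_in ((X \<times> UNIV) <+> {})"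
    unfolding h_def using f(1) g(1) by (auto intro!: polys_in_sum polys_in_mult polys_in_mconst)
  ultimately show ?case by blast
qed

lemma sphere_ideal_vanishes:
  assumes "f \<in> sphere_ideal X C (\<lambda>_. None)" "\<And>i. i \<in> X \<Longrightarrow> norm (y i) = 1"
  shows "poly_eval of_rat (coords y) f = 0"
proof -
  obtain g where "f = (\<Sum>i\<in>X. g i * sphere_poly (\<lambda>_. None) i)"
    using assms(1) unfolding sphere_ideal_def by auto
  moreover have "poly_eval of_rat (coords y) (sphere_poly (\<lambda>_. None) i) = 0" if "i \<in> X" for i
  proof -
    have "poly_eval of_rat (coords y) (sphere_poly (\<lambda>_. None) i) = (\<Sum>m\<in>UNIV. (y i $ m)\<^sup>2) - 1"
      unfolding sphere_poly_def coords_def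
      by (simp add: comm_ring_hom_of_rat poly_eval_diff poly_eval_sum poly_eval_power)
    also have "(\<Sum>m\<in>UNIV. (y i $ m)\<^sup>2) = (norm (y i))\<^sup>2"
      by (simp add: norm_vec_def L2_set_def sum_nonneg)
    finally show ?thesis using assms(2)[OF that] by simp
  qed
  ultimately show ?thesis
    by (simp add: comm_ring_hom_of_rat poly_eval_sum poly_eval_mult)
qed

text \<open>Multiplication by \<open>D\<close> on \<open>K\<close> is given in a rational basis \<open>e\<close> by a matrix of rational
  polynomials. Its determinant vanishes at the generic point \<open>s\<close>, hence at all points of the
  spheres, and at a rational point it vanishes only if \<open>D\<close> does.\<close>

lemma generic_zero_imp_zero_rational:
  assumes K: "number_ring K" and s: "generic_on_unit_sphere X s"
    and D: "D \<in> coord_polys K X" and zero: "D s = 0"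
    and y: "\<And>i. y i = (\<chi> m. of_rat (w i m))" "\<And>i. i \<in> X \<Longrightarrow> norm (y i) = 1"
  shows "D y = 0"
proof -
  obtain d e where "rat_basis K d e" by (rule number_ring_basis[OF K])
  then have e: "\<And>i. i < d \<Longrightarrow> e i \<in> K"
    "\<And>x. x \<in> K \<Longrightarrow> \<exists>c. x = (\<Sum>i<d. of_rat (c i) * e i)"
    "\<And>c. (\<Sum>i<d. of_rat (c i) * e i) = 0 \<Longrightarrow> \<forall>i<d. c i = 0"
    unfolding rat_basis_def by auto
  let ?A = "(X \<times> UNIV) <+> {}"
  \<comment> \<open>Row \<open>i\<close> of \<open>M\<close> will hold the components of
    \<open>D * e i\<close>.\<close>
  have "\<forall>i. \<exists>f. i < d \<longrightarrow> (\<forall>j<d. f j \<in> polys_in ?A) \<and>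
      (\<forall>y. D y * e i = (\<Sum>j<d. poly_eval of_rat (coords y) (f j) * e j))"
    using coord_polys_representation[OF K e(1,2) coord_polys.mult[OF D coord_polys.const[OF e(1)]]]
    by simp
  from choice[OF this] obtain M where "\<forall>i. i < d \<longrightarrow> (\<forall>j<d. M i j \<in> polys_in ?A) \<and>
      (\<forall>y. D y * e i = (\<Sum>j<d. poly_eval of_rat (coords y) (M i j) * e j))" ..
  then have M: "\<And>i j. i < d \<Longrightarrow> j < d \<Longrightarrow> M i j \<in> polys_in ?A"
    "\<And>i y. i < d \<Longrightarrow> D y * e i = (\<Sum>j<d. poly_eval of_rat (coords y) (M i j) * e j)"
    by auto
  have "\<exists>f\<in>polys_in ?A. \<forall>a. poly_eval of_rat a f =
      (array_det d (\<lambda>i j. poly_eval of_rat a (M i j)) :: real)"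
    by (rule polys_in_array_det) (rule M(1))
  then obtain f where f: "f \<in> polys_in ?A" "\<forall>a. poly_eval of_rat a f =
      (array_det d (\<lambda>i j. poly_eval of_rat a (M i j)) :: real)" ..
  have "1 \<in> K" using K by (simp add: number_ring_def)
  then obtain c where "1 = (\<Sum>i<d. of_rat (c i) * e i)" using e(2) by blast
  then have "\<exists>i<d. e i \<noteq> 0" by (intro ccontr[of "\<exists>i<d. e i \<noteq> 0"]) auto
  \<comment> \<open>The matrix \<open>M\<close> maps \<open>e\<close> to \<open>D\<close> times
    \<open>e\<close>; at \<open>s\<close>, where \<open>D\<close> is zero, the nonzero vector
    \<open>e\<close> is therefore in the kernel.\<close>
  then have "array_det d (\<lambda>i j. poly_eval of_rat (coords s) (M i j)) = 0"
    unfolding array_det_eq_0_iff using M(2)[of _ s] zero by (intro exI[of _ e]) auto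
  then have "eval_mpoly (coords s) f = 0"
    using f(2) by (simp add: eval_mpoly_eq)
  then have ideal: "f \<in> sphere_ideal X {} (\<lambda>_. None :: unit option)"
    using s f(1) unfolding generic_on_unit_sphere_def generic_on_spheres_def coords_def by blast
  define a where "a = case_sum (\<lambda>(i, m). w i m) (\<lambda>_::unit. 0)"
  have a: "coords y = (\<lambda>x. of_rat (a x))"
    unfolding coords_def a_def by (auto simp: fun_eq_iff y(1) split: sum.split)
  have "of_rat (array_det d (\<lambda>i j. poly_eval (\<lambda>x. x) a (M i j))) =
      (array_det d (\<lambda>i j. of_rat (poly_eval (\<lambda>x. x) a (M i j))) :: real)"
    by (rule array_det_hom[OF comm_ring_hom_of_rat, symmetric])
  also have "\<dots> = array_det d (\<lambda>i j. poly_eval of_rat (coords y) (M i j))"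
    by (simp add: a poly_eval_of_rat)
  also have "\<dots> = poly_eval of_rat (coords y) f" using f(2) by simp
  also have "\<dots> = 0" by (rule sphere_ideal_vanishes[OF ideal y(2)])
  \<comment> \<open>The determinant is now one of rational numbers, so there is a rational left
    kernel vector \<open>v\<close>. By independence of \<open>e\<close> it yields a nonzero number
    of \<open>K\<close>, and \<open>D y\<close> times that number is zero.\<close>
  finally have "array_det d (\<lambda>i j. poly_eval (\<lambda>x. x) a (M j i)) = 0"
    by (subst array_det_transpose) simp
  then obtain v where v: "\<exists>i<d. v i \<noteq> 0"
    "\<And>j. j < d \<Longrightarrow> (\<Sum>i<d. poly_eval (\<lambda>x. x) a (M i j) * v i) = 0"
    unfolding array_det_eq_0_iff by blast
  have "D y * (\<Sum>i<d. of_rat (v i) * e i) = (\<Sum>i<d. of_rat (v i) * (D y * e i))"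
    by (simp add: sum_distrib_left ac_simps)
  also have "\<dots> = (\<Sum>i<d. of_rat (v i) * (\<Sum>j<d. of_rat (poly_eval (\<lambda>x. x) a (M i j)) * e j))"
    by (intro sum.cong refl) (simp add: M(2) a poly_eval_of_rat)
  also have "\<dots> = (\<Sum>j<d. of_rat (\<Sum>i<d. poly_eval (\<lambda>x. x) a (M i j) * v i) * e j)"
    by (simp add: sum_distrib_left sum_distrib_right of_rat_sum of_rat_mult ac_simps)
      (rule sum.swap)
  also have "\<dots> = 0" by (simp add: v(2))
  finally show ?thesis using e(3)[of v] v(1) by auto
qed

section \<open>Density of rational points on the sphere\<close>

lemma rational_sequence: "\<exists>c. (\<lambda>n. of_rat (c n)) \<longlonglongrightarrow> (x::real)"
proof -
  have "x \<in> closure \<rat>" by (simp add: Rats_closure_real)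
  then obtain f where f: "\<And>n. f n \<in> \<rat>" "f \<longlonglongrightarrow> x"
    unfolding closure_sequential by auto
  then have "\<forall>n. \<exists>c. f n = of_rat c" by (metis Rats_cases)
  then obtain c where "\<And>n. f n = of_rat (c n)" by metis
  then have "f = (\<lambda>n. of_rat (c n))" by auto
  with f(2) show ?thesis by blast
qed

text \<open>Stereographic projection from \<open>(0, 0, 1)\<close> maps rational points to rational points.\<close>

lemma rational_points_dense_sphere:
  fixes x :: "real^3"
  assumes "norm x = 1"
  obtains W :: "nat \<Rightarrow> 3 \<Rightarrow> rat" where
    "\<And>n. norm (\<chi> m. real_of_rat (W n m)) = 1" "(\<lambda>n. \<chi> m. of_rat (W n m)) \<longlonglongrightarrow> x"
proof (cases "x $ 3 = 1")
  \<comment> \<open>The centre of the projection has no image, but is a rational point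
    itself.\<close>
  case True
  have n: "(x $ 1)\<^sup>2 + (x $ 2)\<^sup>2 + (x $ 3)\<^sup>2 = 1"
    using assms by (simp add: norm_vec_def L2_set_def sum_3)
  then have "x $ 1 = 0" "x $ 2 = 0" using True by (auto simp: sum_power2_eq_zero_iff)
  then have "x = (\<chi> m. of_rat (if m = 3 then 1 else 0))"
    using True unfolding Finite_Cartesian_Product.vec_eq_iff forall_3 by simp
  then show thesis
    using assms by (intro that[of "\<lambda>n m. if m = 3 then 1 else 0"]) auto
next
  case False
  have n: "(x $ 1)\<^sup>2 + (x $ 2)\<^sup>2 + (x $ 3)\<^sup>2 = 1"
    using assms by (simp add: norm_vec_def L2_set_def sum_3)
  define a b where "a = x $ 1 / (1 - x $ 3)" and "b = x $ 2 / (1 - x $ 3)"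
  obtain c where c: "(\<lambda>n. of_rat (c n)) \<longlonglongrightarrow> a" using rational_sequence by blast
  obtain d where d: "(\<lambda>n. of_rat (d n)) \<longlonglongrightarrow> b" using rational_sequence by blast
  define S where "S a b = (\<chi> m. if m = 1 then 2 * a / (1 + a\<^sup>2 + b\<^sup>2)
      else if m = 2 then 2 * b / (1 + a\<^sup>2 + b\<^sup>2) else (a\<^sup>2 + b\<^sup>2 - 1) / (1 + a\<^sup>2 + b\<^sup>2) :: real^3)"
    for a b :: real
  define W where "W n m = (if m = 1 then 2 * c n / (1 + (c n)\<^sup>2 + (d n)\<^sup>2)
      else if m = 2 then 2 * d n / (1 + (c n)\<^sup>2 + (d n)\<^sup>2)
      else ((c n)\<^sup>2 + (d n)\<^sup>2 - 1) / (1 + (c n)\<^sup>2 + (d n)\<^sup>2))" for n and m :: 3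
  have WS: "(\<chi> m. real_of_rat (W n m)) = S (of_rat (c n)) (of_rat (d n))" for n
    unfolding W_def S_def
    by (auto simp: Finite_Cartesian_Product.vec_eq_iff of_rat_divide of_rat_mult of_rat_add of_rat_diff of_rat_power)
  have pos: "1 + a\<^sup>2 + b\<^sup>2 > 0" for a b :: real
    by (smt (verit) zero_le_power2)
  have "norm (S a b) = 1" for a b
  proof -
    let ?t = "1 + a\<^sup>2 + b\<^sup>2"
    have "(2 * a / ?t)\<^sup>2 + (2 * b / ?t)\<^sup>2 + ((a\<^sup>2 + b\<^sup>2 - 1) / ?t)\<^sup>2 =
        ((2 * a)\<^sup>2 + (2 * b)\<^sup>2 + (a\<^sup>2 + b\<^sup>2 - 1)\<^sup>2) / ?t\<^sup>2"
      by (simp add: power_divide add_divide_distrib)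
    also have "(2 * a)\<^sup>2 + (2 * b)\<^sup>2 + (a\<^sup>2 + b\<^sup>2 - 1)\<^sup>2 = ?t\<^sup>2"
      by (simp add: power2_eq_square algebra_simps)
    finally show ?thesis
      using pos[of a b] by (simp add: norm_vec_def L2_set_def sum_3 S_def)
  qed
  moreover have "S a b = x"
  proof -
    have nz: "1 - x $ 3 \<noteq> 0" using False by simp
    have t: "1 + a\<^sup>2 + b\<^sup>2 = 2 / (1 - x $ 3)"
    proof -
      have "(1 - x $ 3)\<^sup>2 * (1 + a\<^sup>2 + b\<^sup>2) = (1 - x $ 3)\<^sup>2 + (x $ 1)\<^sup>2 + (x $ 2)\<^sup>2"
        unfolding a_def b_def using nz by (simp add: power_divide distrib_left)
      also have "\<dots> = 2 * (1 - x $ 3)" using n by (simp add: power2_eq_square algebra_simps)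
      finally have "(1 - x $ 3) * ((1 - x $ 3) * (1 + a\<^sup>2 + b\<^sup>2)) = (1 - x $ 3) * 2"
        by (simp add: power2_eq_square ac_simps)
      then have "(1 - x $ 3) * (1 + a\<^sup>2 + b\<^sup>2) = 2"
        by (rule mult_left_cancel[OF nz, THEN iffD1])
      then show ?thesis using nz by (simp add: eq_divide_eq ac_simps)
    qed
    have "2 * a / (1 + a\<^sup>2 + b\<^sup>2) = x $ 1" "2 * b / (1 + a\<^sup>2 + b\<^sup>2) = x $ 2"
      unfolding t using nz by (auto simp: a_def b_def)
    moreover have "(a\<^sup>2 + b\<^sup>2 - 1) / (1 + a\<^sup>2 + b\<^sup>2) = x $ 3"
    proof -
      have "a\<^sup>2 + b\<^sup>2 - 1 = 2 / (1 - x $ 3) - 2" using t by simp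
      also have "\<dots> = x $ 3 * (2 / (1 - x $ 3))" using nz by (simp add: field_simps)
      finally have "a\<^sup>2 + b\<^sup>2 - 1 = x $ 3 * (1 + a\<^sup>2 + b\<^sup>2)" unfolding t .
      then show ?thesis using pos[of a b] by simp
    qed
    ultimately show ?thesis unfolding S_def by (auto simp: Finite_Cartesian_Product.vec_eq_iff forall_3)
  qed
  moreover have "(\<lambda>n. S (of_rat (c n)) (of_rat (d n))) \<longlonglongrightarrow> S a b"
    unfolding S_def
    by (rule vec_tendstoI) (use c d pos[of a b] in \<open>auto intro!: tendsto_intros\<close>)
  ultimately show thesis
    using that[of W] unfolding WS by metis
qed

lemma coord_polys_tendsto:
  assumes "D \<in> coord_polys K X" "\<And>i. i \<in> X \<Longrightarrow> (\<lambda>n. Y n i) \<longlonglongrightarrow> y i"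
  shows "(\<lambda>n. D (Y n)) \<longlonglongrightarrow> D y"
  using assms(1)
  by induction (auto intro!: tendsto_intros assms(2))

text \<open>Approximation by rational points and continuity of \<open>D\<close> reduce this to
  \<open>generic_zero_imp_zero_rational\<close>.\<close>

theorem generic_zero_imp_zero:
  assumes K: "number_ring K" and s: "generic_on_unit_sphere X s"
    and D: "D \<in> coord_polys K X" and zero: "D s = 0"
    and y: "\<And>i. i \<in> X \<Longrightarrow> norm (y i) = 1"
  shows "D y = 0"
proof -
  have "\<exists>W. (\<forall>n. norm (\<chi> m. real_of_rat (W n m)) = 1) \<and>
      (i \<in> X \<longrightarrow> (\<lambda>n. \<chi> m. of_rat (W n m)) \<longlonglongrightarrow> y i)" for i
  proof -
    \<comment> \<open>The rational case wants rational coordinates at every index, so indices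
      outside \<open>X\<close> receive a unit vector to approximate as well.\<close>
    have "norm (if i \<in> X then y i else axis 1 1) = 1" using y by simp
    from rational_points_dense_sphere[OF this] obtain W
      where "\<And>n. norm (\<chi> m. real_of_rat (W n m)) = 1"
        "(\<lambda>n. \<chi> m. of_rat (W n m)) \<longlonglongrightarrow> (if i \<in> X then y i else axis 1 1)"
      by blast
    then show ?thesis by (intro exI[of _ W]) auto
  qed
  then obtain W where W: "\<And>i n. norm (\<chi> m. real_of_rat (W i n m)) = 1"
    "\<And>i. i \<in> X \<Longrightarrow> (\<lambda>n. \<chi> m. of_rat (W i n m)) \<longlonglongrightarrow> y i" by metis
  define Y where "Y n i = (\<chi> m. real_of_rat (W i n m))" for n i
  have "D (Y n) = 0" for n
    by (rule generic_zero_imp_zero_rational[OF K s D zero, of _ "\<lambda>i. W i n"])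
      (use W(1) in \<open>auto simp: Y_def\<close>)
  moreover have "(\<lambda>n. D (Y n)) \<longlonglongrightarrow> D y"
    by (rule coord_polys_tendsto[OF D]) (use W(2) in \<open>simp add: Y_def\<close>)
  ultimately show ?thesis by (simp add: LIMSEQ_const_iff)
qed

section \<open>Rank at generic configurations\<close>

lemma coord_polys_sum:
  assumes "number_ring K" "\<And>i. i \<in> I \<Longrightarrow> f i \<in> coord_polys K X"
  shows "(\<lambda>y. \<Sum>i\<in>I. f i y) \<in> coord_polys K X"
  using assms(2) number_ring_rat_mem[OF assms(1), of 0]
  by (induction I rule: infinite_finite_induct) (auto intro: coord_polys.intros)

lemma coord_polys_prod:
  assumes "number_ring K" "\<And>i. i \<in> I \<Longrightarrow> f i \<in> coord_polys K X"
  shows "(\<lambda>y. \<Prod>i\<in>I. f i y) \<in> coord_polys K X"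
  using assms(2) number_ring_rat_mem[OF assms(1), of 1]
  by (induction I rule: infinite_finite_induct) (auto intro: coord_polys.intros)

lemma coord_polys_diff:
  assumes "number_ring K" "f \<in> coord_polys K X" "g \<in> coord_polys K X"
  shows "(\<lambda>y. f y - g y) \<in> coord_polys K X"
proof -
  have "(\<lambda>y. f y + (-1) * g y) \<in> coord_polys K X"
    using assms number_ring_rat_mem[OF assms(1), of "-1"] by (intro coord_polys.intros) auto
  then show ?thesis by simp
qed

text \<open>The Gram determinant condenses the independence of the rows of a rectangular matrix into
  a single polynomial condition. Over the reals this is an equivalence, the dot product being
  definite.\<close>

lemma gram_det_nonzero_iff:
  assumes fin: "finite W" "finite Col" and supp: "\<And>w x. w \<in> W \<Longrightarrow> x \<notin> Col \<Longrightarrow> B w x = 0"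
    and h: "bij_betw h {..<n} W"
  shows "array_det n (\<lambda>i j. \<Sum>x\<in>Col. B (h i) x * B (h j) x) \<noteq> 0 \<longleftrightarrow> rows_independent B W"
proof
  assume det: "array_det n (\<lambda>i j. \<Sum>x\<in>Col. B (h i) x * B (h j) x) \<noteq> 0"
  show "rows_independent B W"
  proof (rule rows_independentI[OF fin(1)])
    fix c w assume c: "\<And>x. (\<Sum>w\<in>W. c w * B w x) = 0" and w: "w \<in> W"
    have "(\<Sum>j<n. (\<Sum>x\<in>Col. B (h i) x * B (h j) x) * c (h j)) = 0" for i
    proof -
      have "(\<Sum>j<n. (\<Sum>x\<in>Col. B (h i) x * B (h j) x) * c (h j)) =
          (\<Sum>w\<in>W. (\<Sum>x\<in>Col. B (h i) x * B w x) * c w)"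
        by (rule sum.reindex_bij_betw[OF h])
      also have "\<dots> = (\<Sum>x\<in>Col. B (h i) x * (\<Sum>w\<in>W. c w * B w x))"
        by (simp add: sum_distrib_left sum_distrib_right ac_simps) (rule sum.swap)
      finally show ?thesis by (simp add: c)
    qed
    then have "\<forall>i<n. c (h i) = 0"
      using det unfolding array_det_eq_0_iff not_ex by (elim allE[of _ "\<lambda>i. c (h i)"]) auto
    then show "c w = 0" using h w by (auto simp: bij_betw_def)
  qed
next
  assume ind: "rows_independent B W"
  show "array_det n (\<lambda>i j. \<Sum>x\<in>Col. B (h i) x * B (h j) x) \<noteq> 0"
  proof
    assume "array_det n (\<lambda>i j. \<Sum>x\<in>Col. B (h i) x * B (h j) x) = 0"
    then obtain v where v: "\<exists>i<n. v i \<noteq> 0"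
      "\<And>i. i < n \<Longrightarrow> (\<Sum>j<n. (\<Sum>x\<in>Col. B (h i) x * B (h j) x) * v j) = 0"
      unfolding array_det_eq_0_iff by blast
    \<comment> \<open>\<open>f\<close> is the combination of rows with coefficients
      \<open>v\<close>; its squared norm is the Gram form at \<open>v\<close>.\<close>
    define f where "f x = (\<Sum>j<n. v j * B (h j) x)" for x
    have "(\<Sum>x\<in>Col. f x * f x) =
        (\<Sum>x\<in>Col. \<Sum>i<n. \<Sum>j<n. v i * (B (h i) x * B (h j) x * v j))"
      unfolding f_def sum_product by (intro sum.cong refl) (simp add: ac_simps)
    also have "\<dots> = (\<Sum>i<n. \<Sum>j<n. \<Sum>x\<in>Col. v i * (B (h i) x * B (h j) x * v j))"
      by (subst sum.swap, intro sum.cong refl, rule sum.swap)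
    also have "\<dots> = (\<Sum>i<n. v i * (\<Sum>j<n. (\<Sum>x\<in>Col. B (h i) x * B (h j) x) * v j))"
      by (simp add: sum_distrib_left sum_distrib_right)
    also have "\<dots> = 0" by (simp add: v(2))
    finally have "f x = 0" if "x \<in> Col" for x
      using fin(2) that sum_nonneg_eq_0_iff[of Col "\<lambda>x. f x * f x"] by simp
    moreover have "f x = 0" if "x \<notin> Col" for x
      unfolding f_def using supp that h by (auto simp: bij_betw_def intro!: sum.neutral)
    ultimately have f: "f x = 0" for x by blast
    let ?c = "\<lambda>w. v (the_inv_into {..<n} h w)"
    have inv: "the_inv_into {..<n} h (h j) = j" if "j < n" for j
      using h that by (auto simp: bij_betw_def the_inv_into_f_f)
    have "(\<Sum>w\<in>W. ?c w * B w x) = f x" for x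
      unfolding f_def sum.reindex_bij_betw[OF h, symmetric] by (intro sum.cong) (auto simp: inv)
    then have "\<forall>w\<in>W. ?c w = 0"
      using rows_independentD[OF fin(1) ind, of ?c] f by auto
    then have "\<forall>i<n. v i = 0"
      using h inv by (metis bij_betwE lessThan_iff)
    with v(1) show False by blast
  qed
qed

text \<open>The Gram determinant is a polynomial over \<open>K\<close> in the coordinates. It does
  not vanish at the unit configuration \<open>u\<close>, so it cannot vanish at a generic
  one.\<close>

lemma rows_independent_generic:
  assumes K: "number_ring K" and s: "generic_on_unit_sphere X s"
    and fin: "finite W" "finite Col"
    and A: "\<And>w x. w \<in> W \<Longrightarrow> x \<in> Col \<Longrightarrow> (\<lambda>y. A y w x) \<in> coord_polys K X"
      "\<And>y w x. w \<in> W \<Longrightarrow> x \<notin> Col \<Longrightarrow> A y w x = 0"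
    and u: "\<And>i. i \<in> X \<Longrightarrow> norm (u i) = 1" "rows_independent (A u) W"
  shows "rows_independent (A s) W"
proof -
  obtain h where h: "bij_betw h {..<card W} W"
    using ex_bij_betw_nat_finite[OF fin(1)] by (auto simp: atLeast0LessThan)
  define D where "D y = array_det (card W) (\<lambda>i j. \<Sum>x\<in>Col. A y (h i) x * A y (h j) x)" for y
  have sg: "signof p \<in> K" for p :: "nat \<Rightarrow> nat"
    using number_ring_rat_mem[OF K, of "signof p"] by simp
  have hW: "h i \<in> W" if "i < card W" for i using h that by (auto simp: bij_betw_def)
  have "D \<in> coord_polys K X"
    unfolding D_def array_det_leibniz
    by (intro coord_polys_sum[OF K] coord_polys_prod[OF K] coord_polys.mult coord_polys.const A(1) hW sg)
      (auto simp: permutes_in_image dest: permutes_in_image)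
  moreover have "D u \<noteq> 0"
    unfolding D_def using gram_det_nonzero_iff[OF fin _ h, of "A u"] A(2) u(2) by simp
  ultimately have "D s \<noteq> 0"
    using generic_zero_imp_zero[OF K s, of D u] u(1) by blast
  then show ?thesis
    unfolding D_def using gram_det_nonzero_iff[OF fin _ h, of "A s"] A(2) by simp
qed

section \<open>Normalising a generic configuration\<close>

text \<open>A polynomial relation among the directions of the points becomes, after multiplication by a
  power of the product of all radii, a polynomial relation among the points and the radii; setting
  all radii to \<open>1\<close> recovers the former.\<close>

lemma generic_normalise:
  assumes fin: "finite X0" "finite C" and gen: "generic_on_spheres X0 C chi r s"
    and norm_s: "\<And>i. i \<in> X0 \<Longrightarrow> norm (s i) = (case chi i of None \<Rightarrow> 1 | Some c \<Rightarrow> r c)"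
    and pos: "\<And>c. c \<in> C \<Longrightarrow> 0 < r c"
    and chi: "\<And>i c. i \<in> X0 \<Longrightarrow> chi i = Some c \<Longrightarrow> c \<in> C" and X: "X \<subseteq> X0"
  shows "generic_on_unit_sphere X (\<lambda>i. s i /\<^sub>R norm (s i))"
proof -
  define u where "u i = s i /\<^sub>R norm (s i)" for i
  define a where "a = case_sum (\<lambda>(i, m). s i $ m) r"
  have pos_s: "norm (s i) > 0" if "i \<in> X0" for i
    using norm_s[OF that] pos chi[OF that] by (auto split: option.split)
  define R where "R = (\<Prod>c\<in>C. mvar (Inr c :: 'a \<times> 3 + 'b))"
  define rho where "rho = (\<Prod>c\<in>C. r c)"
  \<comment> \<open>The substitution sets all radii to 1, keeps the points of \<open>X\<close> and
    sends all others to (1, 0, 0), where their sphere polynomials become zero.\<close>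
  define sub :: "'a \<times> 3 + 'b \<Rightarrow> ('a \<times> 3 + unit) rat_mpoly" where
    "sub = case_sum (\<lambda>(i, m). if i \<in> X then mvar (Inl (i, m)) else mconst (if m = 1 then 1 else 0)) (\<lambda>_. 1)"
  let ?B = "(X0 \<times> UNIV) <+> C" and ?A = "(X \<times> UNIV) <+> {}"
  note homs = comm_ring_hom_of_rat comm_ring_hom_mconst
  have rho: "rho \<noteq> 0" using pos by (force simp: rho_def fin)
  have R: "R ^ N \<in> polys_in ?B" "poly_eval of_rat a R = rho" "poly_eval mconst sub R = 1" for N
    unfolding R_def rho_def
    by (auto simp: homs poly_eval_prod a_def sub_def intro!: polys_in_power polys_in_prod polys_in_mvar)
  have lift: "\<exists>N g. g \<in> polys_in ?B \<and> poly_eval of_rat a g = rho ^ N * poly_eval of_rat (coords u) f \<and>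
      poly_eval mconst sub g = f" if "f \<in> polys_in ?A" for f
    using that
  proof (induction rule: polys_in_induct)
    case (const c)
    show ?case by (intro exI[of _ 0] exI[of _ "mconst c"]) (auto simp: homs polys_in_mconst)
  next
    case (var x)
    then obtain i m where x: "x = Inl (i, m)" "i \<in> X" by auto
    with X have i: "i \<in> X0" by auto
    show ?case
    proof (cases "chi i")
      case None
      then have "u i = s i" using norm_s[OF i] by (simp add: u_def)
      then show ?thesis using x i
        by (intro exI[of _ 0] exI[of _ "mvar (Inl (i, m))"])
          (auto simp: homs a_def sub_def coords_def intro!: polys_in_mvar)
    next
      case (Some c)
      then have c: "c \<in> C" using chi i by auto
      \<comment> \<open>Multiplying \<open>u i\<close> by \<open>rho\<close> gives
        \<open>s i\<close> times the product of the other radii, which is polynomial.\<close>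
      have "rho = r c * (\<Prod>c'\<in>C - {c}. r c')"
        unfolding rho_def using fin(2) c by (simp add: prod.remove)
      moreover have "s i = r c *\<^sub>R u i"
        using norm_s[OF i] pos[OF c] Some by (simp add: u_def)
      ultimately show ?thesis using x i
        by (intro exI[of _ 1] exI[of _ "mvar (Inl (i, m)) * (\<Prod>c'\<in>C - {c}. mvar (Inr c'))"])
          (auto simp: homs poly_eval_mult poly_eval_prod a_def sub_def coords_def
            intro!: polys_in_mult polys_in_prod polys_in_mvar)
    qed
  next
    case (add f1 f2)
    then obtain N1 g1 N2 g2 where "g1 \<in> polys_in ?B" "poly_eval of_rat a g1 = rho ^ N1 * poly_eval of_rat (coords u) f1"
      "poly_eval mconst sub g1 = f1" "g2 \<in> polys_in ?B"
      "poly_eval of_rat a g2 = rho ^ N2 * poly_eval of_rat (coords u) f2" "poly_eval mconst sub g2 = f2"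
      by blast
    \<comment> \<open>Powers of \<open>R\<close> bring both summands to the common exponent;
      \<open>sub\<close> sends them to 1.\<close>
    then show ?case
      by (intro exI[of _ "N1 + N2"] exI[of _ "g1 * R ^ N2 + g2 * R ^ N1"])
        (auto simp: homs poly_eval_mult poly_eval_add poly_eval_power R power_add algebra_simps
          intro!: polys_in_mult polys_in_add)
  next
    case (mult f1 f2)
    then obtain N1 g1 N2 g2 where "g1 \<in> polys_in ?B" "poly_eval of_rat a g1 = rho ^ N1 * poly_eval of_rat (coords u) f1"
      "poly_eval mconst sub g1 = f1" "g2 \<in> polys_in ?B"
      "poly_eval of_rat a g2 = rho ^ N2 * poly_eval of_rat (coords u) f2" "poly_eval mconst sub g2 = f2"
      by blast
    then show ?case
      by (intro exI[of _ "N1 + N2"] exI[of _ "g1 * g2"])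
        (auto simp: homs poly_eval_mult power_add intro!: polys_in_mult)
  qed
  have "f \<in> sphere_ideal X {} (\<lambda>_. None)"
    if f: "f \<in> polys_in ?A" and zero: "eval_mpoly (coords u) f = 0" for f
  proof -
    obtain N g where g: "g \<in> polys_in ?B" "poly_eval of_rat a g = rho ^ N * poly_eval of_rat (coords u) f"
      "poly_eval mconst sub g = f" using lift[OF f] by blast
    have "eval_mpoly a g = 0" using g(2) zero by (simp add: eval_mpoly_eq)
    then have "g \<in> sphere_ideal X0 C chi"
      using gen g(1) unfolding generic_on_spheres_def a_def by blast
    then obtain h where h: "g = (\<Sum>i\<in>X0. h i * sphere_poly chi i)" "\<forall>i\<in>X0. h i \<in> polys_in ?B"
      unfolding sphere_ideal_def by blast
    have sp: "poly_eval mconst sub (sphere_poly chi i) = (if i \<in> X then sphere_poly (\<lambda>_. None) i else 0)" for i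
      unfolding sphere_poly_def sub_def
      by (auto simp: homs poly_eval_diff poly_eval_add poly_eval_sum poly_eval_power sum_3 mconst_def split: option.split)
    have "f = (\<Sum>i\<in>X0. poly_eval mconst sub (h i) * (if i \<in> X then sphere_poly (\<lambda>_. None) i else 0))"
      unfolding g(3)[symmetric] h(1) by (simp add: homs poly_eval_sum poly_eval_mult sp)
    also have "\<dots> = (\<Sum>i\<in>X. poly_eval mconst sub (h i) * sphere_poly (\<lambda>_. None) i)"
      by (rule sum.mono_neutral_cong_right) (use X fin in auto)
    finally have "f = (\<Sum>i\<in>X. poly_eval mconst sub (h i) * sphere_poly (\<lambda>_. None) i)" .
    moreover have "\<forall>i\<in>X. poly_eval mconst sub (h i) \<in> polys_in ?A"
      using h(2) X unfolding sub_def
      by (auto intro!: poly_eval_in_polys_in[of _ ?B] polys_in_mvar polys_in_mconst polys_in_1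
          split: sum.split)
    ultimately show ?thesis unfolding sphere_ideal_def
      by (intro CollectI exI[of _ "\<lambda>i. poly_eval mconst sub (h i)"]) auto
  qed
  moreover have "norm (u i) = 1" if "i \<in> X" for i
    using pos_s[of i] that X by (auto simp: u_def)
  ultimately show ?thesis
    unfolding generic_on_unit_sphere_def generic_on_spheres_def u_def coords_def by auto
qed

section \<open>Rotation groups\<close>

lemma rotation3_apply:
  "rotation3 a t *v x = cos t *\<^sub>R x + sin t *\<^sub>R cross3 a x + ((1 - cos t) * (a \<bullet> x)) *\<^sub>R a"
proof -
  have "linear (\<lambda>x. cos t *\<^sub>R x + sin t *\<^sub>R cross3 a x + ((1 - cos t) * (a \<bullet> x)) *\<^sub>R a)"
    by (rule linearI) (simp_all add: cross_add_right cross_mult_right algebra_simps)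
  from matrix_works[OF this[folded linear_matrix_vector_mul_eq]] show ?thesis
    unfolding rotation3_def .
qed

lemma cross_inner_assoc: "cross3 x y \<bullet> z = x \<bullet> cross3 y z"
  by (simp add: cross3_simps)

lemma skew_matrix_cross:
  assumes "transpose S = - (S :: real^3^3)"
  obtains w where "\<And>x. S *v x = cross3 w x"
proof -
  have S: "S $ j $ i = - S $ i $ j" for i j
    using arg_cong[OF assms, of "\<lambda>M. M $ i $ j"] by (simp add: transpose_def)
  have "S *v x = cross3 (vector [S $ 3 $ 2, S $ 1 $ 3, S $ 2 $ 1]) x" for x
    using S[of 1 1] S[of 2 2] S[of 3 3] S[of 2 1] S[of 3 1] S[of 3 2]
    by (simp add: Finite_Cartesian_Product.vec_eq_iff forall_3 matrix_vector_mult_def sum_3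
        cross3_def vector_3)
  then show thesis using that by blast
qed

locale rotation_group =
  fixes q :: nat and tau :: "int \<Rightarrow> real^3^3" and a :: "real^3" and Z :: "int monoid"
  assumes q2: "q \<ge> 2" and Z_def: "Z = integer_mod_group q" and norm_a: "norm a = 1"
    and tau_hom: "tau \<in> hom Z orthogonal_group3"
    and tau_image: "tau ` carrier Z = {rotation3 a (2 * pi * real m / real q) | m. m < q}"
begin

lemma group_Z: "group Z" by (simp add: Z_def)

lemma carrier_Z: "carrier Z = {0..<int q}"
  using q2 by (simp add: Z_def carrier_integer_mod_group)

lemma finite_Z: "finite (carrier Z)" by (simp add: carrier_Z)

lemma card_Z: "card (carrier Z) = q" by (simp add: carrier_Z)

lemma orthogonal_tau: "g \<in> carrier Z \<Longrightarrow> orthogonal_matrix (tau g)"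
  using tau_hom unfolding hom_def orthogonal_group3_def by auto

lemma tau_mult: "g \<in> carrier Z \<Longrightarrow> h \<in> carrier Z \<Longrightarrow> tau (g \<otimes>\<^bsub>Z\<^esub> h) *v x = tau g *v (tau h *v x)"
  using tau_hom unfolding hom_def orthogonal_group3_def by (auto simp: matrix_vector_mul_assoc)

lemma tau_inner [simp]: "g \<in> carrier Z \<Longrightarrow> (tau g *v x) \<bullet> (tau g *v y) = x \<bullet> y"
  using orthogonal_tau[of g] unfolding orthogonal_matrix_def
  by (metis dot_lmul_matrix inner_commute matrix_vector_mul_assoc matrix_vector_mul_lid
      transpose_matrix_vector vector_transpose_matrix)

lemma tau_v_mult_tau [simp]: "g \<in> carrier Z \<Longrightarrow> (tau g *v x) v* tau g = x"
  using orthogonal_tau[of g] unfolding orthogonal_matrix_def transpose_matrix_vector[symmetric]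
  by (metis matrix_vector_mul_assoc matrix_vector_mul_lid)

lemma tau_mult_v_tau [simp]: "g \<in> carrier Z \<Longrightarrow> tau g *v (x v* tau g) = x"
  using orthogonal_tau[of g] unfolding orthogonal_matrix_def transpose_matrix_vector[symmetric]
  by (metis matrix_vector_mul_assoc matrix_vector_mul_lid)

lemma transpose_tau_tau: "g \<in> carrier Z \<Longrightarrow> transpose (tau g) *v (tau g *v x) = x"
  by simp

lemma matrix_inv_tau:
  assumes "g \<in> carrier Z" shows "matrix_inv (tau g) = transpose (tau g)"
proof -
  let ?T = "tau g"
  have o: "?T ** transpose ?T = mat 1" "transpose ?T ** ?T = mat 1"
    using orthogonal_tau[OF assms] by (auto simp: orthogonal_matrix_def)
  then have "?T ** matrix_inv ?T = mat 1 \<and> matrix_inv ?T ** ?T = mat 1"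
    unfolding matrix_inv_def by (rule someI2[of _ "transpose ?T", OF conjI]) auto
  then show ?thesis
    by (metis o(2) matrix_mul_assoc matrix_mul_lid matrix_mul_rid)
qed

lemma tau_rotation:
  assumes "g \<in> carrier Z" obtains t where "tau g = rotation3 a t"
  using tau_image assms by blast

lemma tau_axis [simp]: "g \<in> carrier Z \<Longrightarrow> tau g *v a = a"
  using norm_a by (elim tau_rotation)
    (simp add: rotation3_apply norm_eq_1 algebra_simps)

lemma tau_cross_axis: "g \<in> carrier Z \<Longrightarrow> tau g *v cross3 a x = cross3 a (tau g *v x)"
  by (elim tau_rotation)
    (simp add: rotation3_apply cross_add_right cross_mult_right dot_cross_self)

lemma axis_inner_tau [simp]: "g \<in> carrier Z \<Longrightarrow> a \<bullet> (tau g *v x) = a \<bullet> x"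
  using tau_inner[of g a x] by simp

lemma tau_diff: "tau g *v (x - y) = tau g *v x - tau g *v y"
  by (rule matrix_vector_mult_diff_distrib)

text \<open>The rotation by \<open>t = 2 * pi / q\<close> alone suffices. If it fixes
  \<open>x\<close>, the part \<open>y\<close> of \<open>x\<close> orthogonal to \<open>a\<close>
  satisfies \<open>eq\<close>, whose right-hand side is orthogonal to \<open>y\<close>; and
  \<open>q \<ge> 2\<close> keeps \<open>t\<close> in the interval from 0 (excluded) to pi, so
  \<open>cos t < 1\<close>.\<close>

lemma fixed_imp_axis:
  assumes "\<And>g. g \<in> carrier Z \<Longrightarrow> tau g *v x = x"
  shows "x = (a \<bullet> x) *\<^sub>R a"
proof -
  define t where "t = 2 * pi / real q"
  have "rotation3 a t \<in> tau ` carrier Z"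
    unfolding tau_image t_def using q2 by (intro CollectI exI[of _ 1]) auto
  then have fix_t: "rotation3 a t *v x = x" using assms by auto
  have ct: "cos t < 1"
  proof -
    have "0 < t" "t \<le> pi" using q2 by (auto simp: t_def field_simps)
    then show ?thesis using cos_monotone_0_pi[of 0 t] by simp
  qed
  define y where "y = x - (a \<bullet> x) *\<^sub>R a"
  have eq: "(1 - cos t) *\<^sub>R y = sin t *\<^sub>R cross3 a x"
    using fix_t unfolding rotation3_apply y_def by (simp add: algebra_simps)
  have "cross3 a x \<bullet> y = 0"
    unfolding y_def by (simp add: inner_diff_right dot_cross_self inner_commute)
  then have "(1 - cos t) * (y \<bullet> y) = 0"
    using arg_cong[OF eq, of "\<lambda>v. v \<bullet> y"] by simp
  then show ?thesis using ct by (simp add: y_def)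
qed

section \<open>Averaging over the rotation group\<close>

lemma bij_mult: "h \<in> carrier Z \<Longrightarrow> bij_betw (\<lambda>g. h \<otimes>\<^bsub>Z\<^esub> g) (carrier Z) (carrier Z)"
  using group.inj_on_cmult[OF group_Z] group.surj_const_mult[OF group_Z]
  by (auto simp: bij_betw_def)

text \<open>Up to the factor \<open>q\<close> the projection onto the axis, but written with the
  entries of the rotation matrices. These can be put into a coefficient ring that need not contain
  the coordinates of \<open>a\<close>.\<close>

definition orbit_sum :: "real^3 \<Rightarrow> real^3" where
  "orbit_sum x = (\<Sum>g\<in>carrier Z. tau g *v x)"

text \<open>Invariance under the group puts the sum on the axis, and all summands have the same
  component along \<open>a\<close>.\<close>

lemma orbit_sum_eq: "orbit_sum x = (real q * (a \<bullet> x)) *\<^sub>R a"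
proof -
  have "tau h *v orbit_sum x = orbit_sum x" if h: "h \<in> carrier Z" for h
  proof -
    have "tau h *v orbit_sum x = (\<Sum>g\<in>carrier Z. tau (h \<otimes>\<^bsub>Z\<^esub> g) *v x)"
      unfolding orbit_sum_def using h
      by (simp add: linear_sum[OF matrix_vector_mul_linear] tau_mult)
    also have "\<dots> = orbit_sum x"
      unfolding orbit_sum_def by (rule sum.reindex_bij_betw[OF bij_mult[OF h]])
    finally show ?thesis .
  qed
  then have "orbit_sum x = (a \<bullet> orbit_sum x) *\<^sub>R a" by (rule fixed_imp_axis)
  also have "a \<bullet> orbit_sum x = real q * (a \<bullet> x)"
    by (simp add: orbit_sum_def inner_sum_right card_Z)
  finally show ?thesis .
qed

text \<open>For a general orthogonal matrix the determinant appears as a factor. Since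
  \<open>tau g\<close> fixes \<open>a\<close> and commutes with \<open>cross3 a\<close>, comparing
  both sides on a nonzero product \<open>cross3 a b\<close> shows that the factor is 1.\<close>

lemma tau_cross:
  assumes g: "g \<in> carrier Z"
  shows "cross3 (tau g *v x) (tau g *v y) = tau g *v cross3 x y"
proof -
  have "\<not> (\<forall>b. cross3 a b = 0)"
    using norm_a cross_eq_0[of a] norm_and_cross_eq_0[of a]
    by (metis norm_zero orthogonal_def vector_choose_size norm_eq_zero zero_neq_one
        cross_dot_cancel inner_zero_right linorder_not_le cross_basis_nonzero)
  then obtain b where b: "cross3 a b \<noteq> 0" by blast
  have "cross3 (tau g *v a) (tau g *v b) = Determinants.det (tau g) *\<^sub>R (tau g *v cross3 a b)"
    by (rule cross_orthogonal_matrix[OF orthogonal_tau[OF g]])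
  then have "tau g *v cross3 a b = Determinants.det (tau g) *\<^sub>R (tau g *v cross3 a b)"
    using g by (simp add: tau_cross_axis)
  then have "transpose (tau g) *v (tau g *v cross3 a b) =
      transpose (tau g) *v (Determinants.det (tau g) *\<^sub>R (tau g *v cross3 a b))" by simp
  then have "cross3 a b = Determinants.det (tau g) *\<^sub>R cross3 a b"
    by (simp only: matrix_vector_mult_scaleR transpose_tau_tau[OF g])
  then have "Determinants.det (tau g) = 1" using b by (metis scaleR_cancel_right scaleR_one)
  then show ?thesis
    using cross_orthogonal_matrix[OF orthogonal_tau[OF g], of x y] by simp
qed

text \<open>Averaging over the group projects the angular velocity \<open>w\<close> and the translation \<open>x\<close> onto the
  axis.\<close>

lemma symmetric_rigid_motion:
  assumes "\<And>g. g \<in> carrier Z \<Longrightarrow> tau g *v z = cross3 w (tau g *v y) + x"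
  shows "z = (a \<bullet> w) *\<^sub>R cross3 a y + (a \<bullet> x) *\<^sub>R a"
proof -
  \<comment> \<open>Pairing with a test vector \<open>v\<close> moves \<open>w\<close> and
    \<open>x\<close> out of the sum over the group, leaving orbit sums of \<open>cross3 y v\<close>
    and \<open>v\<close>.\<close>
  have "z \<bullet> v = ((a \<bullet> w) *\<^sub>R cross3 a y + (a \<bullet> x) *\<^sub>R a) \<bullet> v" for v
  proof -
    have "z \<bullet> v = w \<bullet> (tau g *v cross3 y v) + x \<bullet> (tau g *v v)" if g: "g \<in> carrier Z" for g
    proof -
      have "z \<bullet> v = (cross3 w (tau g *v y) + x) \<bullet> (tau g *v v)"
        using tau_inner[OF g, of z v] assms[OF g] by simp
      also have "\<dots> = w \<bullet> cross3 (tau g *v y) (tau g *v v) + x \<bullet> (tau g *v v)"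
        by (simp add: inner_add_left cross_inner_assoc)
      finally show ?thesis by (simp add: tau_cross[OF g])
    qed
    then have "(\<Sum>g\<in>carrier Z. z \<bullet> v) =
        (\<Sum>g\<in>carrier Z. w \<bullet> (tau g *v cross3 y v) + x \<bullet> (tau g *v v))"
      by (rule sum.cong[OF refl])
    also have "\<dots> = w \<bullet> orbit_sum (cross3 y v) + x \<bullet> orbit_sum v"
      by (simp add: orbit_sum_def sum.distrib inner_sum_right)
    finally have "real q * (z \<bullet> v) = real q * ((a \<bullet> w) * (a \<bullet> cross3 y v) + (a \<bullet> x) * (a \<bullet> v))"
      by (simp add: orbit_sum_eq card_Z inner_commute algebra_simps)
    moreover have "a \<bullet> cross3 y v = cross3 a y \<bullet> v" by (simp add: cross_inner_assoc)
    ultimately show ?thesis using q2 by (simp add: inner_add_left)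
  qed
  then show ?thesis by (metis vector_eq_ldot inner_commute)
qed

section \<open>Rotation matrices as coefficients\<close>

lemma coord_polys_tau:
  assumes K: "number_ring K" and tau_K: "\<And>g i j. g \<in> carrier Z \<Longrightarrow> tau g $ i $ j \<in> K"
    and "g \<in> carrier Z" "i \<in> X"
  shows "(\<lambda>y. (tau g *v y i) $ m) \<in> coord_polys K X"
    "(\<lambda>y. (transpose (tau g) *v y i) $ m) \<in> coord_polys K X"
  unfolding matrix_vector_mult_def transpose_def
  using assms by (auto intro!: coord_polys_sum[OF K] coord_polys.intros)

lemma coord_polys_orbit_sum:
  assumes K: "number_ring K" and tau_K: "\<And>g i j. g \<in> carrier Z \<Longrightarrow> tau g $ i $ j \<in> K"
    and "i \<in> X"
  shows "(\<lambda>y. orbit_sum (y i) $ m) \<in> coord_polys K X"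
  unfolding orbit_sum_def sum_component
  using assms by (auto intro!: coord_polys_sum[OF K] coord_polys_tau[OF K tau_K])

lemma number_ring_tau:
  assumes "algebraic_matrices (tau ` carrier Z)"
  obtains K where "number_ring K" "\<And>g i j. g \<in> carrier Z \<Longrightarrow> tau g $ i $ j \<in> K"
proof -
  let ?B = "(\<lambda>(g, i, j). tau g $ i $ j) ` (carrier Z \<times> UNIV \<times> UNIV)"
  have "finite ?B" using finite_Z by simp
  moreover have "algebraic x" if "x \<in> ?B" for x
    using that assms by (auto simp: algebraic_matrices_def)
  ultimately obtain K where "number_ring K" "?B \<subseteq> K" using number_ring_exists by metis
  then show thesis by (intro that[of K]) (auto simp: image_subset_iff)
qed

end

section \<open>Position of generic points relative to the axis\<close>

locale generic_rotation = rotation_group +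
  fixes X :: "'o set" and u :: "'o \<Rightarrow> real^3"
  assumes algebraic: "algebraic_matrices (tau ` carrier Z)"
    and finite_X: "finite X" and generic: "generic_on_unit_sphere X u"
begin

text \<open>A point in the plane orthogonal to the axis has orbit sum zero. These are equations over
  \<open>K\<close>, so by genericity every unit vector would satisfy them, but the pole
  \<open>a\<close> does not.\<close>

lemma axis_component_nonzero:
  assumes i: "i \<in> X" shows "a \<bullet> u i \<noteq> 0"
proof
  assume "a \<bullet> u i = 0"
  then have zero: "orbit_sum (u i) $ m = 0" for m by (simp add: orbit_sum_eq)
  obtain K where K: "number_ring K" "\<And>g i j. g \<in> carrier Z \<Longrightarrow> tau g $ i $ j \<in> K"
    using number_ring_tau[OF algebraic] by blast
  have "orbit_sum a $ m = 0" for m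
  proof -
    have "(\<lambda>y. orbit_sum (y i) $ m) \<in> coord_polys K X"
      by (rule coord_polys_orbit_sum[OF K i])
    from generic_zero_imp_zero[OF K(1) generic this, of "\<lambda>_. a"] zero norm_a
    show ?thesis by simp
  qed
  then have "orbit_sum a = 0" by (simp add: Finite_Cartesian_Product.vec_eq_iff)
  then show False using norm_a q2 by (auto simp: orbit_sum_eq norm_eq_1)
qed

text \<open>Equal heights mean equal orbit sums, again equations over \<open>K\<close>; the opposite
  poles \<open>a\<close> and \<open>- a\<close> violate them.\<close>

lemma axis_component_inj:
  assumes i: "i \<in> X" and j: "j \<in> X" and ij: "i \<noteq> j" shows "a \<bullet> u i \<noteq> a \<bullet> u j"
proof
  assume "a \<bullet> u i = a \<bullet> u j"
  then have zero: "orbit_sum (u i) $ m - orbit_sum (u j) $ m = 0" for m by (simp add: orbit_sum_eq)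
  obtain K where K: "number_ring K" "\<And>g i j. g \<in> carrier Z \<Longrightarrow> tau g $ i $ j \<in> K"
    using number_ring_tau[OF algebraic] by blast
  have "orbit_sum a $ m - orbit_sum (- a) $ m = 0" for m
  proof -
    have "(\<lambda>y. orbit_sum (y i) $ m - orbit_sum (y j) $ m) \<in> coord_polys K X"
      by (intro coord_polys_diff[OF K(1)] coord_polys_orbit_sum[OF K] i j)
    from generic_zero_imp_zero[OF K(1) generic this, of "\<lambda>k. if k = i then a else - a"] zero norm_a ij
    show ?thesis by simp
  qed
  then have "orbit_sum a = orbit_sum (- a)" by (simp add: Finite_Cartesian_Product.vec_eq_iff)
  then have "a \<bullet> orbit_sum a = a \<bullet> orbit_sum (- a)" by simp
  then show False using norm_a q2 by (simp add: orbit_sum_eq norm_eq_1)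
qed

text \<open>A point on the axis is fixed by the group. Being fixed is a system of equations over
  \<open>K\<close>, so by genericity all unit vectors would be fixed and hence lie on the
  axis.\<close>

lemma cross_axis_nonzero:
  assumes i: "i \<in> X" shows "cross3 a (u i) \<noteq> 0"
proof
  assume "cross3 a (u i) = 0"
  then have "tau g *v u i = cos t *\<^sub>R u i + ((1 - cos t) * (a \<bullet> u i)) *\<^sub>R a"
    if "tau g = rotation3 a t" for g t
    using that by (simp add: rotation3_apply)
  moreover have "u i = (a \<bullet> u i) *\<^sub>R a"
  proof -
    have "cross3 a (cross3 a (u i)) = (a \<bullet> u i) *\<^sub>R a - (a \<bullet> a) *\<^sub>R u i"
      by (simp add: Lagrange)
    then show ?thesis using \<open>cross3 a (u i) = 0\<close> norm_a by (simp add: norm_eq_1)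
  qed
  ultimately have fix_u: "tau g *v u i = u i" if "g \<in> carrier Z" for g
    using that by (metis matrix_vector_mult_scaleR tau_axis)
  then have zero: "(tau g *v u i) $ m - u i $ m = 0" if "g \<in> carrier Z" for g m
    using that by simp
  obtain K where K: "number_ring K" "\<And>g i j. g \<in> carrier Z \<Longrightarrow> tau g $ i $ j \<in> K"
    using number_ring_tau[OF algebraic] by blast
  have all: "x = (a \<bullet> x) *\<^sub>R a" if x: "norm x = 1" for x
  proof (rule fixed_imp_axis)
    fix g assume g: "g \<in> carrier Z"
    have "(tau g *v x) $ m - x $ m = 0" for m
    proof -
      have "(\<lambda>y. (tau g *v y i) $ m - y i $ m) \<in> coord_polys K X"
        by (intro coord_polys_diff[OF K(1)] coord_polys_tau[OF K g i] coord_polys.coord i)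
      from generic_zero_imp_zero[OF K(1) generic this, of "\<lambda>_. x"] zero[OF g] x
      show ?thesis by simp
    qed
    then show "tau g *v x = x" by (simp add: Finite_Cartesian_Product.vec_eq_iff)
  qed
  have "cross3 a x = 0" if "norm x = 1" for x
    by (subst all[OF that]) (simp add: cross_mult_right)
  then have "cross3 a (axis k 1) = 0" for k by (simp add: norm_axis_1)
  moreover have "a \<noteq> 0" using norm_a by auto
  ultimately show False using cross_basis_nonzero[of a] by blast
qed

text \<open>By genericity one configuration with independent rotated points is enough. The witness
  \<open>v\<close> places them at distinct vectors of the standard basis, which is possible for at
  most three points.\<close>

lemma rotated_points_independent:
  assumes Y: "Y \<subseteq> X" "card Y \<le> 3" and h: "\<And>i. i \<in> Y \<Longrightarrow> h i \<in> carrier Z"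
    and zero: "(\<Sum>i\<in>Y. d i *\<^sub>R (tau (h i) *v u i)) = 0" and i: "i \<in> Y"
  shows "d i = 0"
proof -
  obtain K where K: "number_ring K" "\<And>g i j. g \<in> carrier Z \<Longrightarrow> tau g $ i $ j \<in> K"
    using number_ring_tau[OF algebraic] by blast
  have fY: "finite Y" using Y finite_X finite_subset by blast
  then obtain k :: "'o \<Rightarrow> 3" where k: "inj_on k Y"
    using Y(2) card_le_inj[of Y "UNIV :: 3 set"] by auto
  define A where "A y i m = (tau (h i) *v y i) $ m" for y :: "'o \<Rightarrow> real^3" and i m
  define v where "v i = transpose (tau (h i)) *v axis (k i) 1" for i
  \<comment> \<open>The witness has to be a configuration of unit vectors on all of
    \<open>X\<close>, hence a default value outside \<open>Y\<close>.\<close>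
  have unit: "norm (if i \<in> Y then v i else axis 1 1) = 1" for i
  proof (cases "i \<in> Y")
    case True
    have "tau (h i) *v v i = axis (k i) 1" using h[OF True] by (simp add: v_def)
    then have "v i \<bullet> v i = 1" using tau_inner[OF h[OF True], of "v i" "v i"] by (simp add: inner_axis_axis)
    then show ?thesis using True by (simp add: norm_eq_1)
  qed simp
  have "rows_independent (A u) Y"
  proof (rule rows_independent_generic[OF K(1) generic fY finite])
    show "(\<lambda>y. A y w x) \<in> coord_polys K X" if "w \<in> Y" for w x
      unfolding A_def using that Y h by (intro coord_polys_tau[OF K]) auto
    show "norm (if i \<in> Y then v i else axis 1 1) = 1" for i by (rule unit)
    show "rows_independent (A (\<lambda>i. if i \<in> Y then v i else axis 1 1)) Y"
    proof (rule rows_independentI[OF fY])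
      fix c w assume c: "\<And>x. (\<Sum>i\<in>Y. c i * A (\<lambda>i. if i \<in> Y then v i else axis 1 1) i x) = 0" and w: "w \<in> Y"
      have "(\<Sum>i\<in>Y. c i * A (\<lambda>i. if i \<in> Y then v i else axis 1 1) i (k w)) = (\<Sum>i\<in>Y. if i = w then c i else 0)"
        by (intro sum.cong refl)
          (use h k w in \<open>auto simp: A_def v_def axis_def inj_on_def\<close>)
      then show "c w = 0" using c[of "k w"] fY w by simp
    qed
  qed auto
  moreover have "(\<Sum>i\<in>Y. d i * A u i m) = 0" for m
    using arg_cong[OF zero, of "\<lambda>x. x $ m"] by (simp add: A_def)
  ultimately show ?thesis using rows_independentD[OF fY, of "A u" d] i by blast
qed

end

section \<open>Balanced gain graphs\<close>

lemma is_walk_append: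
  "is_walk src dst F u (w1 @ w2) v \<longleftrightarrow> (\<exists>m. is_walk src dst F u w1 m \<and> is_walk src dst F m w2 v)"
  by (induction src dst F u w1 v arbitrary: rule: is_walk.induct) auto

definition reverse_walk :: "('e \<times> bool) list \<Rightarrow> ('e \<times> bool) list" where
  "reverse_walk w = rev (map (\<lambda>(e, fwd). (e, \<not> fwd)) w)"

lemma is_walk_reverse: "is_walk src dst F u w v \<Longrightarrow> is_walk src dst F v (reverse_walk w) u"
  by (induction src dst F u w v rule: is_walk.induct)
    (auto simp: reverse_walk_def is_walk_append split: if_splits)

context
  fixes G :: "'g monoid" (structure)
  assumes group_G: "group G"
begin

interpretation group G by (rule group_G)

lemma walk_gain_closed:
  assumes "is_walk src dst F u w v" "\<And>e. e \<in> F \<Longrightarrow> psi e \<in> carrier G"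
  shows "walk_gain G psi w \<in> carrier G"
  using assms(1)
proof (induction w arbitrary: u)
  case (Cons x w)
  then show ?case using assms(2) by (cases x) auto
qed simp

lemma walk_gain_append:
  assumes "is_walk src dst F u w1 v" "is_walk src dst F v' w2 v''" "\<And>e. e \<in> F \<Longrightarrow> psi e \<in> carrier G"
  shows "walk_gain G psi (w1 @ w2) = walk_gain G psi w1 \<otimes> walk_gain G psi w2"
  using assms(1)
proof (induction w1 arbitrary: u)
  case Nil
  then show ?case using walk_gain_closed[OF assms(2,3)] by simp
next
  case (Cons x w1)
  obtain e fwd where x: "x = (e, fwd)" by (cases x)
  have w1: "is_walk src dst F (if fwd then dst e else src e) w1 v" and e: "e \<in> F"
    using Cons.prems by (auto simp: x)
  show ?case
    using Cons.IH[OF w1] walk_gain_closed[OF w1 assms(3)] walk_gain_closed[OF assms(2,3)] assms(3)[OF e]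
    by (simp add: x m_assoc)
qed

lemma walk_gain_reverse:
  assumes "is_walk src dst F u w v" "\<And>e. e \<in> F \<Longrightarrow> psi e \<in> carrier G"
  shows "walk_gain G psi (reverse_walk w) = inv (walk_gain G psi w)"
  using assms(1)
proof (induction w arbitrary: u)
  case (Cons x w)
  obtain e fwd where x: "x = (e, fwd)" by (cases x)
  have w: "is_walk src dst F (if fwd then dst e else src e) w v" and e: "e \<in> F"
    using Cons.prems by (auto simp: x)
  have "is_walk src dst F (if fwd then dst e else src e) [(e, \<not> fwd)] (if fwd then src e else dst e)"
    using e by simp
  from walk_gain_append[OF is_walk_reverse[OF w] this assms(2)]
  have "walk_gain G psi (reverse_walk (x # w)) =
      walk_gain G psi (reverse_walk w) \<otimes> walk_gain G psi [(e, \<not> fwd)]"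
    by (simp add: reverse_walk_def x)
  then show ?case
    using Cons.IH[OF w] walk_gain_closed[OF w assms(2)] assms(2)[OF e] by (auto simp: x inv_mult_group)
qed (simp add: reverse_walk_def)

text \<open>The potential of a vertex is the gain of a walk to it from the root of its component.\<close>

lemma balanced_potential:
  assumes bal: "balanced G src dst psi F" and psi: "\<And>e. e \<in> F \<Longrightarrow> psi e \<in> carrier G"
  obtains h where "\<And>v. h v \<in> carrier G" "\<And>e. e \<in> F \<Longrightarrow> h (dst e) = h (src e) \<otimes> psi e"
proof -
  define conn where "conn u v \<longleftrightarrow> (\<exists>w. is_walk src dst F u w v)" for u v
  have refl: "conn u u" for u unfolding conn_def by (rule exI[of _ "[]"]) simp
  have sym: "conn v u" if uv: "conn u v" for u v
  proof -
    obtain w where "is_walk src dst F u w v" using uv unfolding conn_def by blast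
    from is_walk_reverse[OF this] show ?thesis unfolding conn_def by (rule exI)
  qed
  have trans: "conn u v" if um: "conn u m" and mv: "conn m v" for u m v
  proof -
    obtain w1 w2 where "is_walk src dst F u w1 m" "is_walk src dst F m w2 v"
      using um mv unfolding conn_def by blast
    then have "is_walk src dst F u (w1 @ w2) v" by (auto simp: is_walk_append)
    then show ?thesis unfolding conn_def by (rule exI)
  qed
  define root where "root v = (SOME u. conn v u)" for v
  have root: "conn v (root v)" for v unfolding root_def by (rule someI[of _ v]) (rule refl)
  have root_eq: "root u = root v" if "conn u v" for u v
  proof -
    \<comment> \<open>Equal predicates lead to equal choices, so each component has a single
      root.\<close>
    have "conn u = conn v" using that sym trans by blast
    then show ?thesis by (simp add: root_def)
  qed
  have "\<forall>v. \<exists>w. is_walk src dst F (root v) w v" using sym[OF root] unfolding conn_def by blast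
  then obtain W where W: "\<And>v. is_walk src dst F (root v) (W v) v" by metis
  show thesis
  proof (rule that[of "\<lambda>v. walk_gain G psi (W v)"])
    show cl: "walk_gain G psi (W v) \<in> carrier G" for v by (rule walk_gain_closed[OF W psi])
    fix e assume e: "e \<in> F"
    let ?i = "src e" and ?j = "dst e"
    have ew: "is_walk src dst F ?i [(e, True)] ?j" using e by simp
    then have "root ?j = root ?i" using root_eq unfolding conn_def by metis
    then have Wj: "is_walk src dst F ?j (reverse_walk (W ?j)) (root ?i)"
      using is_walk_reverse[OF W[of ?j]] by simp
    \<comment> \<open>Completes a closed walk: from the root to \<open>src e\<close>, along
      \<open>e\<close>, and back from \<open>dst e\<close>. Its trivial gain is the equation for the
      potential.\<close>
    have tail: "is_walk src dst F ?i ([(e, True)] @ reverse_walk (W ?j)) (root ?i)"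
      using ew Wj is_walk_append by metis
    then have "is_walk src dst F (root ?i) (W ?i @ ([(e, True)] @ reverse_walk (W ?j))) (root ?i)"
      using W[of ?i] is_walk_append by metis
    then have "walk_gain G psi (W ?i @ ([(e, True)] @ reverse_walk (W ?j))) = \<one>"
      using bal unfolding balanced_def by blast
    also have "walk_gain G psi (W ?i @ ([(e, True)] @ reverse_walk (W ?j))) =
        walk_gain G psi (W ?i) \<otimes> (walk_gain G psi [(e, True)] \<otimes> walk_gain G psi (reverse_walk (W ?j)))"
      by (simp only: walk_gain_append[OF W tail psi] walk_gain_append[OF ew Wj psi])
    also have "walk_gain G psi [(e, True)] = psi e" using psi[OF e] by simp
    also have "walk_gain G psi (reverse_walk (W ?j)) = inv (walk_gain G psi (W ?j))"
      by (rule walk_gain_reverse[OF W psi])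
    finally show "walk_gain G psi (W ?j) = walk_gain G psi (W ?i) \<otimes> psi e"
      using cl[of ?i] cl[of ?j] psi[OF e]
      by (metis inv_closed inv_equality inv_inv m_assoc m_closed)
  qed
qed

end

section \<open>Evaluating the orbit matrix\<close>

definition velocity :: "('o \<times> 3 + 'c \<Rightarrow> real) \<Rightarrow> 'o \<Rightarrow> real^3" where
  "velocity z i = (\<chi> m. z (Inl (i, m)))"

lemma sum_columns:
  assumes "finite Y" "finite C"
  shows "(\<Sum>x\<in>(Y \<times> UNIV) <+> C. f x * z x) =
    (\<Sum>i\<in>Y. velocity f i \<bullet> velocity z i) + (\<Sum>c\<in>C. f (Inr c) * z (Inr c))"
proof -
  have "(\<Sum>x\<in>(Y \<times> UNIV) <+> C. f x * z x) =
      (\<Sum>x\<in>Y \<times> UNIV. f (Inl x) * z (Inl x)) + (\<Sum>c\<in>C. f (Inr c) * z (Inr c))"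
    using assms by (subst sum.Plus) auto
  also have "(\<Sum>x\<in>Y \<times> UNIV. f (Inl x) * z (Inl x)) = (\<Sum>i\<in>Y. \<Sum>m\<in>UNIV. f (Inl (i, m)) * z (Inl (i, m)))"
    by (simp add: sum.cartesian_product)
  finally show ?thesis by (simp add: velocity_def inner_vec_def)
qed

lemma velocity_edge_row [simp]:
  "velocity (orbit_matrix src dst psi tau chi0 s (Inl e)) i = edge_block src dst psi tau s e i"
  by (simp add: velocity_def orbit_matrix_def Finite_Cartesian_Product.vec_eq_iff)

lemma velocity_vertex_row [simp]:
  "velocity (orbit_matrix src dst psi tau chi0 s (Inr j)) i = (if i = j then s j else 0)"
  by (simp add: velocity_def orbit_matrix_def Finite_Cartesian_Product.vec_eq_iff)

lemma vertex_row_eval: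
  assumes "finite Y" "finite C" "j \<in> Y" "\<And>c. chi0 j = Some c \<Longrightarrow> c \<in> C"
  shows "(\<Sum>x\<in>(Y \<times> UNIV) <+> C. orbit_matrix src dst psi tau chi0 s (Inr j) x * z x) =
    s j \<bullet> velocity z j + (case chi0 j of None \<Rightarrow> 0 | Some c \<Rightarrow> z (Inr c))"
proof -
  have "(\<Sum>i\<in>Y. (if i = j then s j else 0) \<bullet> velocity z i) = (\<Sum>i\<in>Y. if i = j then s j \<bullet> velocity z j else 0)"
    by (intro sum.cong) auto
  also have "\<dots> = s j \<bullet> velocity z j" using assms by simp
  finally have 1: "(\<Sum>i\<in>Y. (if i = j then s j else 0) \<bullet> velocity z i) = s j \<bullet> velocity z j" .
  have "(\<Sum>c\<in>C. (if chi0 j = Some c then 1 else 0) * z (Inr c)) =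
      (case chi0 j of None \<Rightarrow> 0 | Some c \<Rightarrow> z (Inr c))"
    using assms by (auto split: option.split simp: if_distrib[of "\<lambda>x. x * _"] cong: if_cong)
  then show ?thesis
    unfolding sum_columns[OF assms(1,2)] velocity_vertex_row 1 by (simp add: orbit_matrix_def)
qed

context rotation_group begin

text \<open>Orthogonality moves the inverse rotation to the other factor of the inner product. Loops
  and other edges then yield the same expression, the length condition of the lifted edge at the
  representative of \<open>src e\<close>.\<close>

lemma edge_row_eval:
  assumes "finite Y" "finite C" "src e \<in> Y" "dst e \<in> Y" "psi e \<in> carrier Z"
  shows "(\<Sum>x\<in>(Y \<times> UNIV) <+> C. orbit_matrix src dst psi tau chi0 s (Inl e) x * z x) =
    (s (src e) - tau (psi e) *v s (dst e)) \<bullet>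
      (velocity z (src e) - tau (psi e) *v velocity z (dst e))"
proof -
  let ?T = "tau (psi e)" and ?i = "src e" and ?j = "dst e"
  have tr: "(x v* ?T) \<bullet> y = x \<bullet> (?T *v y)" for x y
    by (simp add: dot_lmul_matrix)
  have inv: "matrix_inv ?T *v x = x v* ?T" for x
    using matrix_inv_tau[OF assms(5)] by simp
  have 0: "(\<Sum>c\<in>C. orbit_matrix src dst psi tau chi0 s (Inl e) (Inr c) * z (Inr c)) = 0"
    by (simp add: orbit_matrix_def)
  have "(\<Sum>i\<in>Y. edge_block src dst psi tau s e i \<bullet> velocity z i) =
      (s ?i - ?T *v s ?j) \<bullet> (velocity z ?i - ?T *v velocity z ?j)"
  proof (cases "?i = ?j")
    case True
    have "(\<Sum>i\<in>Y. edge_block src dst psi tau s e i \<bullet> velocity z i) =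
        (\<Sum>i\<in>Y. if i = ?i then (2 *\<^sub>R s ?i - ?T *v s ?i - s ?i v* ?T) \<bullet> velocity z ?i else 0)"
      by (intro sum.cong) (auto simp: edge_block_def True Let_def inv)
    also have "\<dots> = (2 *\<^sub>R s ?i - ?T *v s ?i - s ?i v* ?T) \<bullet> velocity z ?i"
      using assms by simp
    also have "\<dots> = (s ?i - ?T *v s ?i) \<bullet> (velocity z ?i - ?T *v velocity z ?i)"
      using tau_inner[OF assms(5), of "s ?i" "velocity z ?i"]
      by (simp add: inner_diff_left inner_diff_right tr)
    finally show ?thesis using True by simp
  next
    case False
    have "(\<Sum>i\<in>Y. edge_block src dst psi tau s e i \<bullet> velocity z i) =
        (\<Sum>i\<in>{?i, ?j}. edge_block src dst psi tau s e i \<bullet> velocity z i)"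
      by (rule sum.mono_neutral_right) (use assms in \<open>auto simp: edge_block_def Let_def\<close>)
    also have "\<dots> = (s ?i - ?T *v s ?j) \<bullet> velocity z ?i + (s ?j - s ?i v* ?T) \<bullet> velocity z ?j"
      using False by (auto simp: edge_block_def Let_def inv)
    also have "\<dots> = (s ?i - ?T *v s ?j) \<bullet> (velocity z ?i - ?T *v velocity z ?j)"
      using tau_inner[OF assms(5), of "s ?j" "velocity z ?j"]
      by (simp add: inner_diff_left inner_diff_right tr)
    finally show ?thesis .
  qed
  then show ?thesis unfolding sum_columns[OF assms(1,2)] velocity_edge_row 0 by simp
qed

end

text \<open>Both kinds of generators have the form \<open>cross3 w (p v) + x\<close> with conditions
  on \<open>x\<close> that are linear, so a linear combination collapses to one angular velocity and
  one translation.\<close>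

lemma trivial_motion_rigid:
  assumes "trivial_motion V C chi p pd rd"
  obtains w x where "\<forall>v\<in>V. pd v = cross3 w (p v) + x"
    "\<forall>v\<in>V. chi v = None \<longrightarrow> p v \<bullet> x = 0"
    "\<forall>c. \<forall>u\<in>V. \<forall>v\<in>V. chi u = Some c \<and> chi v = Some c \<longrightarrow> (p u - p v) \<bullet> x = 0"
proof -
  define rigid where "rigid f w x \<longleftrightarrow> (\<forall>v\<in>V. f v = cross3 w (p v) + x) \<and>
    (\<forall>v\<in>V. chi v = None \<longrightarrow> p v \<bullet> x = 0) \<and>
    (\<forall>c. \<forall>u\<in>V. \<forall>v\<in>V. chi u = Some c \<and> chi v = Some c \<longrightarrow> (p u - p v) \<bullet> x = 0)" for f w x
  obtain n a P R where P: "\<forall>l<(n::nat). rotation_motion V C p (P l) (R l) \<or>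
      (card V \<le> card C + 3 \<and> translation_motion V chi p (P l) (R l))"
    and pd: "\<forall>v\<in>V. pd v = (\<Sum>l<n. a l *\<^sub>R P l v)"
    using assms unfolding trivial_motion_def by blast
  have one: "\<exists>w x. rigid (P l) w x" if "l < n" for l
    using P[rule_format, OF that]
  proof
    assume "rotation_motion V C p (P l) (R l)"
    then obtain S :: "real^3^3" where S: "transpose S = - S" "\<forall>v\<in>V. P l v = S *v p v"
      unfolding rotation_motion_def by blast
    then show ?thesis
      using skew_matrix_cross[OF S(1)] unfolding rigid_def
      by (metis add.right_neutral inner_zero_right)
  next
    assume "card V \<le> card C + 3 \<and> translation_motion V chi p (P l) (R l)"
    then obtain x where "rigid (P l) 0 x"
      unfolding translation_motion_def rigid_def by auto
    then show ?thesis by blast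
  qed
  have "\<exists>w x. rigid (\<lambda>v. \<Sum>l<m. a l *\<^sub>R P l v) w x" if "m \<le> n" for m
    using that
  proof (induction m)
    case 0
    show ?case by (intro exI[of _ 0]) (simp add: rigid_def)
  next
    case (Suc m)
    then obtain w x where wx: "rigid (\<lambda>v. \<Sum>l<m. a l *\<^sub>R P l v) w x" by auto
    obtain w' x' where wx': "rigid (P m) w' x'" using one[of m] Suc.prems by auto
    have "rigid (\<lambda>v. \<Sum>l<Suc m. a l *\<^sub>R P l v) (w + a m *\<^sub>R w') (x + a m *\<^sub>R x')"
      using wx wx' unfolding rigid_def
      by (simp add: cross_add_left cross_mult_left scaleR_add_right inner_add_right)
    then show ?case by blast
  qed
  then obtain w x where "rigid (\<lambda>v. \<Sum>l<n. a l *\<^sub>R P l v) w x" by blast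
  then show thesis using that[of w x] pd unfolding rigid_def by auto
qed

section \<open>Quotients of symmetric frameworks\<close>

locale symmetric_framework = rotation_group q tau a Z
  for q tau a Z +
  fixes V :: "'v set" and E :: "'v set set" and C :: "'c set" and chi :: "'v \<Rightarrow> 'c option"
    and th :: "int \<Rightarrow> 'v \<Rightarrow> 'v" and r :: "'c \<Rightarrow> real" and p :: "'v \<Rightarrow> real^3"
    and rep :: "'v set \<Rightarrow> 'v" and src dst :: "'v set set \<Rightarrow> 'v set" and psi :: "'v set set \<Rightarrow> int"
    and V0 :: "'v set set" and E0 :: "'v set set set"
    and chi0 :: "'v set \<Rightarrow> 'c option" and s :: "'v set \<Rightarrow> real^3"
  assumes graph: "finite_simple_graph V E" and V_nonempty: "V \<noteq> {}"
    and col: "colouring V C chi"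
    and action: "free_symmetry Z V E chi th"
    and V0_def: "V0 = vertex_orbits Z V th" and E0_def: "E0 = edge_orbits Z E th"
    and quotient: "quotient_gain_graph Z V E th rep src dst psi"
    and chi0_def: "chi0 = (\<lambda>X. chi (rep X))" and s_def: "s = (\<lambda>X. p (rep X))"
    and fw: "framework V C chi r p" and sym: "symmetric_placement Z V th tau p"
    and algebraic: "algebraic_matrices (tau ` carrier Z)"
    and generic: "generic_on_spheres V0 C chi0 r s"
    and independent: "symmetric_independent Z V E chi th tau p rep src dst psi"
begin

section \<open>Orbits, representatives and quotient data\<close>

lemma finite_V: "finite V" using graph by (simp add: finite_simple_graph_def)

lemma finite_E: "finite E"
proof -
  have "E \<subseteq> Pow V" using graph unfolding finite_simple_graph_def by auto
  then show ?thesis using finite_V finite_subset by auto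
qed

lemma th_hom: "th \<in> hom Z (coloured_aut_group V E chi)"
  using action by (simp add: free_symmetry_def)

lemma chi_th: "g \<in> carrier Z \<Longrightarrow> v \<in> V \<Longrightarrow> chi (th g v) = chi v"
  using th_hom unfolding hom_def coloured_aut_group_def by auto

lemma th_group_action: "group_action Z V th"
proof -
  have "th \<in> hom Z (BijGroup V)"
    using th_hom unfolding hom_def coloured_aut_group_def BijGroup_def by auto
  then show ?thesis
    unfolding group_action_def group_hom_def group_hom_axioms_def
    using group_Z group_BijGroup by auto
qed

sublocale action: group_action Z V th by (rule th_group_action)

lemma th_mem: "g \<in> carrier Z \<Longrightarrow> v \<in> V \<Longrightarrow> th g v \<in> V"
  by (rule action.element_image) auto

lemma th_mult: "g \<in> carrier Z \<Longrightarrow> h \<in> carrier Z \<Longrightarrow> v \<in> V \<Longrightarrow> th (g \<otimes>\<^bsub>Z\<^esub> h) v = th g (th h v)"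
  by (rule action.composition_rule)

lemma one_Z: "\<one>\<^bsub>Z\<^esub> \<in> carrier Z" using group_Z by (simp add: group.is_monoid)

lemma th_one: "v \<in> V \<Longrightarrow> th \<one>\<^bsub>Z\<^esub> v = v"
  using action.id_eq_one by (metis restrict_apply')

lemma th_free:
  assumes g: "g \<in> carrier Z" and h: "h \<in> carrier Z" and v: "v \<in> V" and eq: "th g v = th h v"
  shows "g = h"
proof -
  have i: "inv\<^bsub>Z\<^esub> h \<in> carrier Z" using group_Z h by simp
  have "th (inv\<^bsub>Z\<^esub> h \<otimes>\<^bsub>Z\<^esub> g) v = th (inv\<^bsub>Z\<^esub> h \<otimes>\<^bsub>Z\<^esub> h) v"
    using th_mult[OF i g v] th_mult[OF i h v] eq by simp
  also have "\<dots> = v" using group.l_inv[OF group_Z h] th_one[OF v] by simp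
  finally have "inv\<^bsub>Z\<^esub> h \<otimes>\<^bsub>Z\<^esub> g = \<one>\<^bsub>Z\<^esub>"
    using action v g i group_Z unfolding free_symmetry_def
    by (meson group.is_monoid monoid.m_closed)
  then show ?thesis using g h i group_Z
    by (metis group.inv_equality group.inv_inv)
qed

lemma rep_mem:
  assumes "X \<in> V0" shows "rep X \<in> X" "rep X \<in> V" "X = orbit Z th (rep X)"
proof -
  show r: "rep X \<in> X" using quotient assms unfolding quotient_gain_graph_def V0_def by blast
  obtain v where v: "v \<in> V" "X = orbit Z th v"
    using assms unfolding V0_def vertex_orbits_def orbits_def by blast
  show rV: "rep X \<in> V" using r v th_mem unfolding orbit_def by auto
  have "rep X \<in> orbit Z th v" using r v by simp
  then have "orbit Z th v = orbit Z th (rep X)"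
    using action.orbit_sym[OF v(1) rV] action.orbit_trans[OF v(1) rV] action.orbit_trans[OF rV v(1)]
      th_mem v(1) rV unfolding orbit_def by blast
  then show "X = orbit Z th (rep X)" using v by simp
qed

lemma vertex_cases:
  assumes "v \<in> V" obtains g X where "g \<in> carrier Z" "X \<in> V0" "v = th g (rep X)"
proof -
  have "v \<in> orbit Z th v" by (rule action.orbit_refl[OF assms])
  moreover have X: "orbit Z th v \<in> V0"
    using assms unfolding V0_def vertex_orbits_def orbits_def by blast
  ultimately have "v \<in> orbit Z th (rep (orbit Z th v))" using rep_mem(3)[OF X] by simp
  then show thesis using that X unfolding orbit_def by blast
qed

text \<open>With \<open>vertex_cases\<close>, every vertex is \<open>th g (rep X)\<close> for
  exactly one pair, so velocities prescribed at the representatives extend consistently to all of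
  \<open>V\<close>. The uniqueness of \<open>g\<close> is the freeness of the action.\<close>

lemma vertex_unique:
  assumes "g \<in> carrier Z" "h \<in> carrier Z" "X \<in> V0" "Y \<in> V0" "th g (rep X) = th h (rep Y)"
  shows "X = Y" "g = h"
proof -
  have "th g (rep X) \<in> X" "th h (rep Y) \<in> Y"
    using assms rep_mem(3) unfolding orbit_def by blast+
  then show "X = Y"
    using action.disjoint_union assms(3-5) unfolding V0_def vertex_orbits_def by fastforce
  then show "g = h" using assms th_free rep_mem(2) by blast
qed

lemma finite_V0: "finite V0" using finite_V unfolding V0_def vertex_orbits_def orbits_def by simp

lemma finite_E0: "finite E0" using finite_E unfolding E0_def edge_orbits_def orbits_def by simp

lemma V0_nonempty: "V0 \<noteq> {}"
  using V_nonempty unfolding V0_def vertex_orbits_def orbits_def by blast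

lemma edge_data:
  assumes "e \<in> E0"
  shows "src e \<in> V0" "dst e \<in> V0" "psi e \<in> carrier Z"
    "e = {{th g (rep (src e)), th (g \<otimes>\<^bsub>Z\<^esub> psi e) (rep (dst e))} | g. g \<in> carrier Z}"
  using quotient assms unfolding quotient_gain_graph_def V0_def E0_def by blast+

lemma edge_cases:
  assumes "{u, v} \<in> E"
  obtains e g where "e \<in> E0" "g \<in> carrier Z"
    "{u, v} = {th g (rep (src e)), th (g \<otimes>\<^bsub>Z\<^esub> psi e) (rep (dst e))}"
proof -
  have uv: "u \<in> V" "v \<in> V" using graph assms unfolding finite_simple_graph_def by (auto simp: subset_iff doubleton_eq_iff)
  define e where "e = orbit Z (\<lambda>g e. th g ` e) {u, v}"
  have e: "e \<in> E0" unfolding e_def E0_def edge_orbits_def orbits_def using assms by blast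
  have "th \<one>\<^bsub>Z\<^esub> ` {u, v} \<in> e" unfolding e_def orbit_def using one_Z by blast
  then have "{u, v} \<in> e" using uv by (simp add: th_one)
  then obtain g where "g \<in> carrier Z"
    "{u, v} = {th g (rep (src e)), th (g \<otimes>\<^bsub>Z\<^esub> psi e) (rep (dst e))}"
    using edge_data(4)[OF e] by blast
  then show thesis using that e by blast
qed

lemma chi0_C: "X \<in> V0 \<Longrightarrow> chi0 X = Some c \<Longrightarrow> c \<in> C"
  using col rep_mem(2)[of X] unfolding chi0_def colouring_def by force

lemma finite_C: "finite C"
proof -
  have "Some ` C \<subseteq> chi ` V" using col by (simp add: colouring_def)
  then have "finite (Some ` C)" using finite_V finite_surj by blast
  then show ?thesis by (rule finite_imageD) simp
qed

lemma colour_used: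
  assumes "c \<in> C" shows "\<exists>X\<in>V0. chi0 X = Some c"
proof -
  have "Some c \<in> chi ` V" using col assms unfolding colouring_def by blast
  then obtain v where v: "v \<in> V" "chi v = Some c" by force
  then obtain g X where "g \<in> carrier Z" "X \<in> V0" "v = th g (rep X)" using vertex_cases by blast
  then show ?thesis using v chi_th rep_mem(2) unfolding chi0_def by force
qed

lemma norm_s: "X \<in> V0 \<Longrightarrow> norm (s X) = (case chi0 X of None \<Rightarrow> 1 | Some c \<Rightarrow> r c)"
  using fw rep_mem(2) unfolding framework_def s_def chi0_def by blast

lemma r_pos: "c \<in> C \<Longrightarrow> 0 < r c" using fw by (simp add: framework_def)

lemma norm_s_pos: "X \<in> V0 \<Longrightarrow> 0 < norm (s X)"
  using norm_s r_pos chi0_C by (auto split: option.split)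

lemma p_th: "g \<in> carrier Z \<Longrightarrow> X \<in> V0 \<Longrightarrow> p (th g (rep X)) = tau g *v s X"
  using sym rep_mem(2) unfolding symmetric_placement_def s_def by force

definition u :: "'v set \<Rightarrow> real^3" where
  "u X = s X /\<^sub>R norm (s X)"

lemma s_eq: "X \<in> V0 \<Longrightarrow> s X = norm (s X) *\<^sub>R u X"
  using norm_s_pos[of X] by (simp add: u_def)

lemma u_generic: "Y \<subseteq> V0 \<Longrightarrow> generic_on_unit_sphere Y u"
  unfolding u_def
  by (rule generic_normalise[OF finite_V0 finite_C generic norm_s r_pos chi0_C])

sublocale generic_rotation q tau a Z V0 u
  by unfold_locales (use algebraic finite_V0 u_generic in auto)

abbreviation coloured_matrix where
  "coloured_matrix \<equiv> orbit_matrix src dst psi tau chi0 s"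

abbreviation spherical_matrix :: "('v set \<Rightarrow> real^3) \<Rightarrow> 'v set set + 'v set \<Rightarrow> 'v set \<times> 3 + unit \<Rightarrow> real" where
  "spherical_matrix y \<equiv> orbit_matrix src dst psi tau (\<lambda>_. None) y"

lemma coloured_rows_independent: "rows_independent coloured_matrix (E0 <+> V0)"
  using independent unfolding symmetric_independent_def V0_def E0_def chi0_def s_def .

lemma orbit_edge_row:
  assumes "e \<in> E0" "finite D"
  shows "(\<Sum>x\<in>(V0 \<times> UNIV) <+> D. orbit_matrix src dst psi tau ch y (Inl e) x * z x) =
    (y (src e) - tau (psi e) *v y (dst e)) \<bullet>
      (velocity z (src e) - tau (psi e) *v velocity z (dst e))"
  by (rule edge_row_eval) (use assms edge_data[OF assms(1)] finite_V0 in auto)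

lemma coloured_vertex_row:
  assumes "X \<in> V0"
  shows "(\<Sum>x\<in>(V0 \<times> UNIV) <+> C. coloured_matrix (Inr X) x * z x) =
    s X \<bullet> velocity z X + (case chi0 X of None \<Rightarrow> 0 | Some c \<Rightarrow> z (Inr c))"
  by (rule vertex_row_eval) (use assms chi0_C finite_V0 finite_C in auto)

lemma spherical_vertex_row:
  assumes "X \<in> V0"
  shows "(\<Sum>x\<in>(V0 \<times> UNIV) <+> {}. spherical_matrix y (Inr X) x * z x) = y X \<bullet> velocity z X"
  using vertex_row_eval[of V0 "{}" X "\<lambda>_. None" src dst psi tau y z] assms finite_V0 by simp

lemma axis_s_nonzero: "X \<in> V0 \<Longrightarrow> a \<bullet> s X \<noteq> 0"
  using axis_component_nonzero[of X] norm_s_pos[of X] s_eq[of X] by (metis inner_scaleR_right less_irrefl mult_eq_0_iff)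

lemma cross_s_nonzero: "X \<in> V0 \<Longrightarrow> cross3 a (s X) \<noteq> 0"
  using cross_axis_nonzero[of X] norm_s_pos[of X] s_eq[of X] by (metis cross_mult_right less_irrefl scaleR_eq_0_iff)

subsection \<open>The edge count\<close>

text \<open>Spread over the orbits by the group, a kernel vector becomes a symmetric motion, so
  rigidity bounds the kernel from above. The number \<open>\<beta>\<close> is the axis component of
  a translation orthogonal to uncoloured points and to differences of equally coloured ones; unless
  each orbit has a colour of its own, one of these conditions forces it to be zero.\<close>

lemma kernel_motion:
  assumes rigid: "symmetric_infinitesimally_rigid Z V E C chi th tau p"
    and orth: "\<And>w. w \<in> E0 <+> V0 \<Longrightarrow> (\<Sum>x\<in>(V0 \<times> UNIV) <+> C. coloured_matrix w x * z x) = 0"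
  obtains \<alpha> \<beta> where "\<And>X. X \<in> V0 \<Longrightarrow> velocity z X = \<alpha> *\<^sub>R cross3 a (s X) + \<beta> *\<^sub>R a"
    "card C \<noteq> card V0 \<Longrightarrow> \<beta> = 0"
proof -
  have "\<forall>v. \<exists>g X. v \<in> V \<longrightarrow> g \<in> carrier Z \<and> X \<in> V0 \<and> v = th g (rep X)"
    using vertex_cases by metis
  then obtain G orb where GO: "\<And>v. v \<in> V \<Longrightarrow> G v \<in> carrier Z \<and> orb v \<in> V0 \<and> v = th (G v) (rep (orb v))"
    by metis
  define pd where "pd v = tau (G v) *v velocity z (orb v)" for v
  \<comment> \<open>The matrix has +1 in the colour column, whereas the condition for a motion has
    the radius velocity on the other side of the equation.\<close>
  define rd where "rd c = - z (Inr c)" for c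
  have pd: "pd (th g (rep X)) = tau g *v velocity z X" if "g \<in> carrier Z" "X \<in> V0" for g X
  proof -
    have "th g (rep X) \<in> V" using that th_mem rep_mem(2) by blast
    from GO[OF this] that vertex_unique[of "G (th g (rep X))" g "orb (th g (rep X))" X]
    show ?thesis unfolding pd_def by auto
  qed
  have edge: "(p u - p v) \<bullet> (pd u - pd v) = 0" if uv_E: "{u, v} \<in> E" for u v
  proof -
    obtain e g where e: "e \<in> E0" and g: "g \<in> carrier Z"
      and uv: "{u, v} = {th g (rep (src e)), th (g \<otimes>\<^bsub>Z\<^esub> psi e) (rep (dst e))}"
      using edge_cases[OF uv_E] by blast
    let ?A = "th g (rep (src e))" and ?B = "th (g \<otimes>\<^bsub>Z\<^esub> psi e) (rep (dst e))"
    let ?T = "tau (psi e)"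
    have gp: "g \<otimes>\<^bsub>Z\<^esub> psi e \<in> carrier Z"
      using group_Z g edge_data(3)[OF e] by (simp add: group.is_monoid monoid.m_closed)
    have "(p ?A - p ?B) \<bullet> (pd ?A - pd ?B) =
        (tau g *v (s (src e) - ?T *v s (dst e))) \<bullet>
        (tau g *v (velocity z (src e) - ?T *v velocity z (dst e)))"
      using g gp edge_data[OF e] by (simp add: p_th pd tau_mult tau_diff)
    also have "\<dots> = (s (src e) - ?T *v s (dst e)) \<bullet> (velocity z (src e) - ?T *v velocity z (dst e))"
      using g by simp
    also have "\<dots> = 0"
      using orth[of "Inl e"] e orbit_edge_row[OF e finite_C, of chi0 s z]
      by auto
    finally have AB: "(p ?A - p ?B) \<bullet> (pd ?A - pd ?B) = 0" .
    have "u = ?A \<and> v = ?B \<or> u = ?B \<and> v = ?A" using uv by (auto simp: doubleton_eq_iff)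
    moreover have "(p ?B - p ?A) \<bullet> (pd ?B - pd ?A) = (p ?A - p ?B) \<bullet> (pd ?A - pd ?B)"
      by (simp add: inner_diff_left inner_diff_right)
    ultimately show ?thesis using AB by (elim disjE conjE) (simp_all only:)
  qed
  have vertex: "s X \<bullet> velocity z X = (case chi0 X of None \<Rightarrow> 0 | Some c \<Rightarrow> rd c)" if "X \<in> V0" for X
    using orth[of "Inr X"] that
      coloured_vertex_row[OF that, of z]
    unfolding rd_def by (auto simp: InrI split: option.split_asm option.split)
  have "infinitesimal_motion V E chi p pd rd"
    unfolding infinitesimal_motion_def
  proof (intro conjI allI impI ballI)
    fix v assume "v \<in> V"
    then obtain g X where v: "g \<in> carrier Z" "X \<in> V0" "v = th g (rep X)" by (rule vertex_cases)
    then have "p v \<bullet> pd v = s X \<bullet> velocity z X" by (simp add: p_th pd)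
    then show "p v \<bullet> pd v = (case chi v of None \<Rightarrow> 0 | Some c \<Rightarrow> rd c)"
      using vertex[OF v(2)] v chi_th rep_mem(2) by (simp add: chi0_def)
  qed (use edge in auto)
  moreover have "symmetric_placement Z V th tau pd"
    unfolding symmetric_placement_def
  proof (intro ballI)
    fix h v assume h: "h \<in> carrier Z" and "v \<in> V"
    then obtain g X where v: "g \<in> carrier Z" "X \<in> V0" "v = th g (rep X)" using vertex_cases by blast
    have hg: "h \<otimes>\<^bsub>Z\<^esub> g \<in> carrier Z" using group_Z h v by (simp add: group.is_monoid monoid.m_closed)
    have "th h v = th (h \<otimes>\<^bsub>Z\<^esub> g) (rep X)" using th_mult[OF h v(1) rep_mem(2)[OF v(2)]] v by simp
    then show "tau h *v pd v = pd (th h v)" using pd h v hg by (simp add: tau_mult)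
  qed
  ultimately have "trivial_motion V C chi p pd rd"
    using rigid unfolding symmetric_infinitesimally_rigid_def by blast
  then obtain w x where rigid_wx: "\<forall>v\<in>V. pd v = cross3 w (p v) + x"
    "\<forall>v\<in>V. chi v = None \<longrightarrow> p v \<bullet> x = 0"
    "\<forall>c. \<forall>u\<in>V. \<forall>v\<in>V. chi u = Some c \<and> chi v = Some c \<longrightarrow> (p u - p v) \<bullet> x = 0"
    by (rule trivial_motion_rigid)
  have wx: "pd v = cross3 w (p v) + x" if "v \<in> V" for v
    using rigid_wx(1) that by blast
  have none: "p v \<bullet> x = 0" if "v \<in> V" "chi v = None" for v
    using rigid_wx(2) that by blast
  have same: "(p u - p v) \<bullet> x = 0" if "u \<in> V" "v \<in> V" "chi u = Some c" "chi v = Some c" for u v c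
    using rigid_wx(3) that by blast
  show thesis
  proof (rule that[of "a \<bullet> w" "a \<bullet> x"])
    fix X assume X: "X \<in> V0"
    show "velocity z X = (a \<bullet> w) *\<^sub>R cross3 a (s X) + (a \<bullet> x) *\<^sub>R a"
    proof (rule symmetric_rigid_motion)
      fix g assume g: "g \<in> carrier Z"
      have "th g (rep X) \<in> V" using g X th_mem rep_mem(2) by blast
      from wx[OF this] show "tau g *v velocity z X = cross3 w (tau g *v s X) + x"
        using g X by (simp add: pd p_th)
    qed
  next
    assume k: "card C \<noteq> card V0"
    have mem: "th g (rep X) \<in> V" "chi (th g (rep X)) = chi0 X" if "g \<in> carrier Z" "X \<in> V0" for g X
      using that th_mem rep_mem(2) chi_th by (auto simp: chi0_def)
    \<comment> \<open>Summed over the group, the conditions on \<open>x\<close> become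
      \<open>q * (a \<bullet> y) * (a \<bullet> x) = 0\<close>.\<close>
    have sum: "orbit_sum y \<bullet> x = 0" if "\<And>g. g \<in> carrier Z \<Longrightarrow> (tau g *v y) \<bullet> x = 0" for y
      unfolding orbit_sum_def inner_sum_left using that by (intro sum.neutral) auto
    show "a \<bullet> x = 0"
    proof (cases "\<exists>X\<in>V0. chi0 X = None")
      case True
      then obtain X where X: "X \<in> V0" "chi0 X = None" by blast
      have "orbit_sum (s X) \<bullet> x = 0"
      proof (rule sum)
        fix g assume g: "g \<in> carrier Z"
        show "(tau g *v s X) \<bullet> x = 0"
          using none[OF mem(1)[OF g X(1)]] mem(2)[OF g X(1)] X p_th[OF g X(1)] by simp
      qed
      then show ?thesis using axis_s_nonzero[OF X(1)] q2 by (simp add: orbit_sum_eq)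
    next
      case False
      \<comment> \<open>With no uncoloured orbit, an injective \<open>chi0\<close> would be a
        bijection onto the colours and give \<open>card C = card V0\<close>.\<close>
      have "\<not> inj_on chi0 V0"
      proof
        assume "inj_on chi0 V0"
        then have "card V0 = card (chi0 ` V0)" by (simp add: card_image)
        also have "chi0 ` V0 = Some ` C"
        proof
          have "chi0 X \<in> Some ` C" if "X \<in> V0" for X
            using that False chi0_C by (cases "chi0 X") auto
          then show "chi0 ` V0 \<subseteq> Some ` C" by blast
          have "Some c \<in> chi0 ` V0" if "c \<in> C" for c
            using colour_used[OF that] by (auto intro: rev_image_eqI)
          then show "Some ` C \<subseteq> chi0 ` V0" by blast
        qed
        also have "card (Some ` C) = card C" by (simp add: card_image)
        finally show False using k by simp
      qed
      then obtain X Y where XY: "X \<in> V0" "Y \<in> V0" "X \<noteq> Y" "chi0 X = chi0 Y"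
        unfolding inj_on_def by blast
      then obtain c where c: "chi0 X = Some c" "chi0 Y = Some c" using False by auto
      have "orbit_sum (s X - s Y) \<bullet> x = 0"
      proof (rule sum)
        fix g assume g: "g \<in> carrier Z"
        show "(tau g *v (s X - s Y)) \<bullet> x = 0"
          using same[OF mem(1)[OF g XY(1)] mem(1)[OF g XY(2)]] mem(2)[OF g] XY c p_th[OF g]
          by (simp add: tau_diff)
      qed
      \<comment> \<open>Equal colours mean equal radii, so the distinct heights of the normalised
        points stay distinct.\<close>
      moreover have "a \<bullet> (s X - s Y) \<noteq> 0"
      proof -
        have n: "norm (s X) = r c" "norm (s Y) = r c" using norm_s XY c by auto
        have "a \<bullet> (s X - s Y) = r c * (a \<bullet> u X - a \<bullet> u Y)"
        proof -
          have "a \<bullet> s X = r c * (a \<bullet> u X)" "a \<bullet> s Y = r c * (a \<bullet> u Y)"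
            using arg_cong[OF s_eq[OF XY(1)], of "\<lambda>v. a \<bullet> v"] arg_cong[OF s_eq[OF XY(2)], of "\<lambda>v. a \<bullet> v"]
            by (simp_all only: n inner_scaleR_right)
          then show ?thesis by (simp only: inner_diff_right right_diff_distrib)
        qed
        then show ?thesis
          using axis_component_inj[OF XY(1-3)] n norm_s_pos[OF XY(1)] by auto
      qed
      ultimately show ?thesis using q2 by (simp add: orbit_sum_eq)
    qed
  qed
qed

text \<open>There are \<open>3 * ?n + ?k\<close> columns and \<open>card E0 + ?n\<close> independent
  rows. The kernel has dimension 2 if \<open>?k = ?n\<close> and 1 if \<open>?k < ?n\<close>, which
  the minimum expresses; larger \<open>?k\<close> cannot occur, as distinct colours sit on distinct
  orbits.\<close>

lemma edge_count:
  assumes rigid: "symmetric_infinitesimally_rigid Z V E C chi th tau p"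
  shows "int (card E0) = 2 * int (card V0) - 1 + min (int (card C)) (int (card V0) - 1)"
proof -
  let ?k = "card C" and ?n = "card V0"
  \<comment> \<open>One orbit for each colour. If there are as many colours as orbits,
    \<open>rho\<close> is onto, so every orbit is the chosen one of its colour and the radius
    velocities of the translation are consistent.\<close>
  define rho where "rho c = (SOME X. X \<in> V0 \<and> chi0 X = Some c)" for c
  have rho: "rho c \<in> V0" "chi0 (rho c) = Some c" if "c \<in> C" for c
    using someI_ex[of "\<lambda>X. X \<in> V0 \<and> chi0 X = Some c"] colour_used[OF that]
    unfolding rho_def by auto
  have inj: "inj_on rho C" using rho(2) by (metis inj_onI option.inject)
  have im: "rho ` C \<subseteq> V0" using rho(1) by blast
  have kn: "?k \<le> ?n" using card_inj_on_le[OF inj im finite_V0] .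
  define Col where "Col = (V0 \<times> (UNIV :: 3 set)) <+> C"
  \<comment> \<open>Index 0 is the rotation about the axis, any other index the translation along
    it. The minus sign compensates the entries +1 in the colour columns.\<close>
  define motion :: "nat \<Rightarrow> 'v set \<times> 3 + 'c \<Rightarrow> real" where
    "motion l x = (case x of
        Inl (X, m) \<Rightarrow> if X \<in> V0 then (if l = 0 then cross3 a (s X) else a) $ m else 0
      | Inr c \<Rightarrow> if l \<noteq> 0 \<and> c \<in> C then - (a \<bullet> s (rho c)) else 0)" for l x
  define L :: "nat set" where "L = (if ?k = ?n then {0, 1} else {0})"
  have vel: "velocity (motion l) X = (if l = 0 then cross3 a (s X) else a)" if "X \<in> V0" for l X
    using that by (simp add: velocity_def motion_def Finite_Cartesian_Product.vec_eq_iff)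
  obtain X0 where X0: "X0 \<in> V0" using V0_nonempty by blast
  have fin: "finite Col" "finite (E0 <+> V0)" "finite L"
    using finite_V0 finite_E0 finite_C by (auto simp: Col_def L_def)
  have "card (E0 <+> V0) + card L = card Col"
  proof (rule rank_nullity[OF fin coloured_rows_independent])
    show "coloured_matrix w x = 0" if "w \<in> E0 <+> V0" "x \<notin> Col" for w x
      using that edge_data chi0_C unfolding Col_def orbit_matrix_def edge_block_def
      by (auto split: sum.split simp: Let_def)
    show "motion l x = 0" if "l \<in> L" "x \<notin> Col" for l x
      using that unfolding Col_def motion_def by (auto split: sum.split)
    show "rows_independent motion L"
    proof (rule rows_independentI[OF fin(3)])
      fix c l assume c: "\<And>x. (\<Sum>l\<in>L. c l * motion l x) = 0" and l: "l \<in> L"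
      \<comment> \<open>A single orbit tells the motions apart: there they are
        \<open>cross3 a (s X0)\<close> and \<open>a\<close>, which are nonzero and
        orthogonal.\<close>
      have "(\<Sum>l\<in>L. c l *\<^sub>R (if l = 0 then cross3 a (s X0) else a)) = 0"
      proof (subst Finite_Cartesian_Product.vec_eq_iff, rule allI)
        fix m show "(\<Sum>l\<in>L. c l *\<^sub>R (if l = 0 then cross3 a (s X0) else a)) $ m = 0 $ m"
          using c[of "Inl (X0, m)"] X0 by (simp add: motion_def)
      qed
      note eq = this
      have "\<forall>l\<in>L. l \<noteq> 0 \<longrightarrow> c l = 0"
        using arg_cong[OF eq, of "\<lambda>v. a \<bullet> v"] norm_a
        by (auto simp: L_def inner_add_right dot_cross_self norm_eq_1 split: if_splits)
      moreover from this have "c 0 = 0"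
        using eq cross_s_nonzero[OF X0] by (auto simp: L_def split: if_splits)
      ultimately show "c l = 0" using l by (cases "l = 0") auto
    qed
    show "(\<Sum>x\<in>Col. coloured_matrix w x * motion l x) = 0" if w: "w \<in> E0 <+> V0" and l: "l \<in> L" for w l
    proof (cases w)
      case (Inl e)
      then have e: "e \<in> E0" using w by auto
      have "(\<Sum>x\<in>Col. coloured_matrix w x * motion l x) = (s (src e) - tau (psi e) *v s (dst e)) \<bullet>
          (velocity (motion l) (src e) - tau (psi e) *v velocity (motion l) (dst e))"
        unfolding Inl Col_def by (rule orbit_edge_row[OF e finite_C])
      also have "velocity (motion l) (src e) - tau (psi e) *v velocity (motion l) (dst e) =
          (if l = 0 then cross3 a (s (src e) - tau (psi e) *v s (dst e)) else 0)"
        using edge_data[OF e] by (simp add: vel tau_cross_axis Cross3.right_diff_distrib)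
      finally show ?thesis by (simp add: dot_cross_self)
    next
      case (Inr X)
      then have X: "X \<in> V0" using w by auto
      have "(\<Sum>x\<in>Col. coloured_matrix w x * motion l x) = s X \<bullet> velocity (motion l) X +
          (case chi0 X of None \<Rightarrow> 0 | Some c \<Rightarrow> motion l (Inr c))"
        unfolding Inr Col_def by (rule coloured_vertex_row[OF X])
      also have "\<dots> = 0"
      proof (cases "l = 0")
        case True
        then show ?thesis using X by (auto simp: vel dot_cross_self motion_def split: option.split)
      next
        case False
        then have "?k = ?n" using l by (auto simp: L_def split: if_splits)
        then have "rho ` C = V0"
          using card_image[OF inj] im finite_V0 by (metis card_subset_eq)
        then obtain c where "c \<in> C" "X = rho c" using X by blast
        then show ?thesis using False X rho(2) by (simp add: vel motion_def inner_commute)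
      qed
      finally show ?thesis .
    qed
    show "\<exists>d. \<forall>x. z x = (\<Sum>l\<in>L. d l * motion l x)"
      if supp: "\<And>x. x \<notin> Col \<Longrightarrow> z x = 0"
        and orth: "\<And>w. w \<in> E0 <+> V0 \<Longrightarrow> (\<Sum>x\<in>Col. coloured_matrix w x * z x) = 0" for z
    proof -
      obtain \<alpha> \<beta> where ab: "\<And>X. X \<in> V0 \<Longrightarrow> velocity z X = \<alpha> *\<^sub>R cross3 a (s X) + \<beta> *\<^sub>R a"
        "?k \<noteq> ?n \<Longrightarrow> \<beta> = 0"
        using kernel_motion[OF rigid orth[unfolded Col_def]] by blast
      have L: "(\<Sum>l\<in>L. (if l = 0 then \<alpha> else \<beta>) * motion l x) = \<alpha> * motion 0 x + \<beta> * motion 1 x" for x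
        using ab(2) by (simp add: L_def)
      have "z x = \<alpha> * motion 0 x + \<beta> * motion 1 x" for x
      proof (cases x)
        case (Inl y)
        obtain X m where y: "y = (X, m)" by (cases y)
        show ?thesis
        proof (cases "X \<in> V0")
          case True
          have "z x = velocity z X $ m" by (simp add: velocity_def Inl y)
          then show ?thesis using ab(1)[OF True] True by (simp add: Inl y motion_def)
        next
          case False
          then show ?thesis using supp[of x] by (auto simp: Inl y motion_def Col_def)
        qed
      next
        case (Inr c)
        show ?thesis
        proof (cases "c \<in> C")
          case True
          have "s (rho c) \<bullet> velocity z (rho c) + z (Inr c) = 0"
            using orth[of "Inr (rho c)"] rho[OF True]
              coloured_vertex_row[OF rho(1)[OF True], of z]
            unfolding Col_def by (simp add: InrI)
          then show ?thesis using ab(1)[OF rho(1)[OF True]] True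
            by (simp add: Inr motion_def inner_add_right dot_cross_self inner_commute)
        next
          case False
          then show ?thesis using supp[of x] by (auto simp: Inr motion_def Col_def)
        qed
      qed
      then show ?thesis
        unfolding L[symmetric] by (intro exI[of _ "\<lambda>l. if l = 0 then \<alpha> else \<beta>"] allI)
    qed
  qed
  moreover have "card Col = 3 * ?n + ?k" "card (E0 <+> V0) = card E0 + ?n"
    using finite_V0 finite_E0 finite_C by (auto simp: Col_def card_Plus card_cartesian_product)
  moreover have "?n > 0" using V0_nonempty finite_V0 by (simp add: card_gt_0_iff)
  ultimately show ?thesis using kn by (auto simp: L_def min_def split: if_splits)
qed

subsection \<open>Counts on subgraphs\<close>

context
  fixes F X
  assumes F: "F \<subseteq> E0" and X: "X = verts_of src dst F"
begin

lemma X_V0: "X \<subseteq> V0"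
  using F edge_data unfolding X verts_of_def by blast

lemma finite_F: "finite F" using F finite_E0 finite_subset by blast

lemma finite_X: "finite X" using X_V0 finite_V0 finite_subset by blast

lemma colour_bound:
  "card F + card X \<le> row_rank (spherical_matrix s) (F <+> X) + num_colours_on C chi0 X"
proof -
  define K where "K = {c \<in> C. \<exists>i\<in>X. chi0 i = Some c}"
  have fK: "finite K" using finite_C by (simp add: K_def)
  have fW: "finite (F <+> X)" using finite_F finite_X by simp
  have "rows_independent coloured_matrix (F <+> X)"
    by (rule rows_independent_subset[OF coloured_rows_independent]) (use F X_V0 in auto)
  then obtain U where U: "U \<subseteq> F <+> X" "card (F <+> X) \<le> card U + card (Inr ` K :: ('v set \<times> 3 + 'c) set)"
    "rows_independent (\<lambda>w x. if x \<in> Inr ` K then 0 else coloured_matrix w x) U"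
    by (rule rows_independent_delete_columns[OF fW finite_imageI[OF fK]])
  have fU: "finite U" using U(1) fW finite_subset by blast
  have "rows_independent (spherical_matrix s) U"
  proof (rule rows_independentI[OF fU])
    fix c w assume c: "\<And>x. (\<Sum>w\<in>U. c w * spherical_matrix s w x) = 0" and w: "w \<in> U"
    have "(\<Sum>w\<in>U. c w * (if x \<in> Inr ` K then 0 else coloured_matrix w x)) = 0" for x
    proof (cases x)
      case (Inl y)
      have "(if x \<in> Inr ` K then 0 else coloured_matrix w x) = spherical_matrix s w (Inl y)" for w
        by (auto simp: Inl orbit_matrix_def split: sum.split)
      then show ?thesis using c[of "Inl y"] by simp
    next
      case (Inr d)
      \<comment> \<open>A colour column survives only if its colour does not occur on
        \<open>X\<close>, and then it is zero in these rows.\<close>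
      have "(if x \<in> Inr ` K then 0 else coloured_matrix w x) = 0" if "w \<in> U" for w
      proof (cases w)
        case (Inr j)
        then have "j \<in> X" using that U(1) by auto
        then have "d \<in> K" if "chi0 j = Some d"
          using that chi0_C X_V0 unfolding K_def by blast
        then show ?thesis by (auto simp: \<open>x = Inr d\<close> Inr orbit_matrix_def)
      qed (simp add: Inr orbit_matrix_def)
      then show ?thesis by (simp cong: sum.cong)
    qed
    then show "c w = 0" using rows_independentD[OF fU U(3), of c] w by blast
  qed
  then have "card U \<le> row_rank (spherical_matrix s) (F <+> X)"
    by (rule card_le_row_rank[OF fW]) (use U(1) in \<open>auto intro!: row_space.span_base\<close>)
  moreover have "card (Inr ` K :: ('v set \<times> 3 + 'c) set) = num_colours_on C chi0 X"
    unfolding num_colours_on_def K_def by (rule card_image) simp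
  moreover have "card (F <+> X) = card F + card X" using finite_F finite_X by (simp add: card_Plus)
  ultimately show ?thesis using U(2) by simp
qed

text \<open>The velocity fields \<open>t k\<close> are annihilated by the edge rows, so the vertex rows that they
  separate can be added to the edge rows.\<close>

lemma vertex_rows_bound:
  fixes t :: "'k \<Rightarrow> 'v set \<Rightarrow> real^3"
  assumes Y: "Y \<subseteq> X"
    and t: "\<And>k e. e \<in> F \<Longrightarrow> t k (src e) = tau (psi e) *v t k (dst e)"
    and sep: "\<And>d. (\<And>k. (\<Sum>i\<in>Y. d i * (s i \<bullet> t k i)) = 0) \<Longrightarrow> \<forall>i\<in>Y. d i = 0"
  shows "card F + card Y \<le> row_rank (spherical_matrix s) (F <+> X)"
proof -
  have fY: "finite Y" using Y finite_X finite_subset by blast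
  have fW: "finite (F <+> Y)" using finite_F fY by simp
  have "rows_independent (spherical_matrix s) (F <+> Y)"
  proof (rule rows_independentI[OF fW])
    fix c w assume c: "\<And>x. (\<Sum>w\<in>F <+> Y. c w * spherical_matrix s w x) = 0" and w: "w \<in> F <+> Y"
    have split: "(\<Sum>w\<in>F <+> Y. f w) = (\<Sum>e\<in>F. f (Inl e)) + (\<Sum>i\<in>Y. f (Inr i))" for f :: "_ \<Rightarrow> real"
      using finite_F fY by (simp add: sum.Plus)
    have "(\<Sum>i\<in>Y. c (Inr i) * (s i \<bullet> t k i)) = 0" for k
    proof -
      define z :: "'v set \<times> 3 + unit \<Rightarrow> real" where "z = case_sum (\<lambda>(i, m). t k i $ m) (\<lambda>_. 0)"
      have vz: "velocity z i = t k i" for i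
        by (simp add: velocity_def z_def)
      let ?Col = "(V0 \<times> (UNIV :: 3 set)) <+> ({} :: unit set)"
      have "0 = (\<Sum>x\<in>?Col. (\<Sum>w\<in>F <+> Y. c w * spherical_matrix s w x) * z x)" by (simp add: c)
      also have "\<dots> = (\<Sum>w\<in>F <+> Y. c w * (\<Sum>x\<in>?Col. spherical_matrix s w x * z x))"
        unfolding sum_distrib_left sum_distrib_right by (subst sum.swap) (simp add: mult.assoc)
      also have "\<dots> = (\<Sum>e\<in>F. c (Inl e) * (\<Sum>x\<in>?Col. spherical_matrix s (Inl e) x * z x)) +
          (\<Sum>i\<in>Y. c (Inr i) * (\<Sum>x\<in>?Col. spherical_matrix s (Inr i) x * z x))"
        by (rule split)
      also have "(\<Sum>e\<in>F. c (Inl e) * (\<Sum>x\<in>?Col. spherical_matrix s (Inl e) x * z x)) = 0"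
      proof (rule sum.neutral, rule ballI)
        fix e assume e: "e \<in> F"
        then have "e \<in> E0" using F by blast
        from orbit_edge_row[OF this finite.emptyI, of "\<lambda>_. None" s z]
        show "c (Inl e) * (\<Sum>x\<in>?Col. spherical_matrix s (Inl e) x * z x) = 0"
          using t[OF e, of k] by (simp add: vz)
      qed
      also have "(\<Sum>i\<in>Y. c (Inr i) * (\<Sum>x\<in>?Col. spherical_matrix s (Inr i) x * z x)) =
          (\<Sum>i\<in>Y. c (Inr i) * (s i \<bullet> t k i))"
      proof (rule sum.cong[OF refl])
        fix i assume "i \<in> Y"
        then have "i \<in> V0" using Y X_V0 by blast
        from spherical_vertex_row[OF this, of s z]
        show "c (Inr i) * (\<Sum>x\<in>?Col. spherical_matrix s (Inr i) x * z x) = c (Inr i) * (s i \<bullet> t k i)"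
          by (simp add: vz)
      qed
      finally show ?thesis by simp
    qed
    then have cY: "\<forall>i\<in>Y. c (Inr i) = 0" by (rule sep)
    \<comment> \<open>Only edge rows are left. They have no colour entries, so their independence is
      inherited from the coloured matrix.\<close>
    have cF: "(\<Sum>w\<in>Inl ` F. c w * coloured_matrix w x) = 0" for x
    proof (cases x)
      case (Inl y)
      have "(\<Sum>e\<in>F. c (Inl e) * spherical_matrix s (Inl e) (Inl y)) = 0"
        using c[of "Inl y"] cY unfolding split by simp
      then show ?thesis unfolding Inl by (simp add: sum.reindex orbit_matrix_def)
    next
      case (Inr d)
      then show ?thesis by (simp add: sum.reindex orbit_matrix_def)
    qed
    have "rows_independent coloured_matrix (Inl ` F)"
      by (rule rows_independent_subset[OF coloured_rows_independent]) (use F in auto)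
    then have "\<forall>w\<in>Inl ` F. c w = 0"
      using rows_independentD[of "Inl ` F" coloured_matrix c] finite_F cF by blast
    then show "c w = 0" using w cY by auto
  qed
  then have "card (F <+> Y) \<le> row_rank (spherical_matrix s) (F <+> X)"
    by (rule card_le_row_rank[rotated])
      (use Y finite_F finite_X in \<open>auto intro!: row_space.span_base\<close>)
  then show ?thesis using finite_F fY by (simp add: card_Plus)
qed

text \<open>The rotations fix \<open>a\<close>, so the constant field \<open>a\<close> is compatible
  with arbitrary gains. One vertex row detects it, because no generic point lies in the plane
  orthogonal to the axis.\<close>

lemma unbalanced_bound:
  assumes "F \<noteq> {}"
  shows "card F + 1 \<le> row_rank (spherical_matrix s) (F <+> X)"
proof -
  obtain e where e: "e \<in> F" using assms by blast
  then have i: "src e \<in> X" by (auto simp: X verts_of_def)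
  have "card F + card {src e} \<le> row_rank (spherical_matrix s) (F <+> X)"
  proof (rule vertex_rows_bound[where t = "\<lambda>_::unit. \<lambda>_. a"])
    show "a = tau (psi e) *v a" if "e \<in> F" for e using that F edge_data(3) by auto
    show "\<forall>i\<in>{src e}. d i = 0" if "\<And>k::unit. (\<Sum>i\<in>{src e}. d i * (s i \<bullet> a)) = 0" for d
      using that axis_s_nonzero[of "src e"] i X_V0 by (auto simp: inner_commute)
  qed (use i in auto)
  then show ?thesis by simp
qed

text \<open>A potential \<open>h\<close> lifts \<open>F\<close> to an isomorphic subgraph of the
  original graph in which \<open>i\<close> is represented by \<open>th (h i) (rep i)\<close>.
  Translating this lift by \<open>x\<close> moves the representative by the inverse rotation
  \<open>x v* tau (h i)\<close>. Space has three independent translations, hence the 3.\<close>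

lemma balanced_bound:
  assumes bal: "balanced Z src dst psi F"
  shows "card F + min 3 (card X) \<le> row_rank (spherical_matrix s) (F <+> X)"
proof -
  have psi: "psi e \<in> carrier Z" if "e \<in> F" for e using that F edge_data(3) by blast
  obtain h where h: "\<And>v. h v \<in> carrier Z" "\<And>e. e \<in> F \<Longrightarrow> h (dst e) = h (src e) \<otimes>\<^bsub>Z\<^esub> psi e"
    using balanced_potential[OF group_Z bal psi] by metis
  obtain Y where Y: "Y \<subseteq> X" "card Y = min 3 (card X)"
    using obtain_subset_with_card_n[of "min 3 (card X)" X] by (metis min.cobounded2)
  have "card F + card Y \<le> row_rank (spherical_matrix s) (F <+> X)"
  proof (rule vertex_rows_bound[OF Y(1), where t = "\<lambda>x i. x v* tau (h i)"])
    fix x e assume e: "e \<in> F"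
    have "tau (h (src e)) *v (tau (psi e) *v (x v* tau (h (dst e)))) = tau (h (dst e)) *v (x v* tau (h (dst e)))"
      using h(2)[OF e] tau_mult[OF h(1) psi[OF e]] by simp
    also have "\<dots> = x" using h(1) by simp
    finally show "x v* tau (h (src e)) = tau (psi e) *v (x v* tau (h (dst e)))"
      using tau_v_mult_tau[OF h(1)] by metis
  next
    fix d assume d: "\<And>x. (\<Sum>i\<in>Y. d i * (s i \<bullet> (x v* tau (h i)))) = 0"
    have YV: "i \<in> V0" if "i \<in> Y" for i using that Y X_V0 by blast
    \<comment> \<open>The conditions say that \<open>v\<close> is orthogonal to every
      \<open>x\<close>, and at most three rotated generic points are independent.\<close>
    define v where "v = (\<Sum>i\<in>Y. (d i * norm (s i)) *\<^sub>R (tau (h i) *v u i))"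
    have "v \<bullet> x = (\<Sum>i\<in>Y. d i * (s i \<bullet> (x v* tau (h i))))" for x
      unfolding v_def inner_sum_left
    proof (rule sum.cong[OF refl])
      fix i assume "i \<in> Y"
      have "d i * (s i \<bullet> (x v* tau (h i))) = d i * (x \<bullet> (tau (h i) *v s i))"
        by (simp add: inner_commute[of "s i"] dot_lmul_matrix)
      also have "tau (h i) *v s i = norm (s i) *\<^sub>R (tau (h i) *v u i)"
        by (subst s_eq[OF YV[OF \<open>i \<in> Y\<close>]]) (rule matrix_vector_mult_scaleR)
      also have "d i * (x \<bullet> (norm (s i) *\<^sub>R (tau (h i) *v u i))) =
          ((d i * norm (s i)) *\<^sub>R (tau (h i) *v u i)) \<bullet> x"
        by (simp add: inner_commute)
      finally show "((d i * norm (s i)) *\<^sub>R (tau (h i) *v u i)) \<bullet> x = d i * (s i \<bullet> (x v* tau (h i)))" ..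
    qed
    then have "v \<bullet> v = 0" by (simp add: d)
    then have v0: "v = 0" by simp
    have YV0: "Y \<subseteq> V0" and Y3: "card Y \<le> 3" using YV Y by auto
    show "\<forall>i\<in>Y. d i = 0"
    proof
      fix i assume i: "i \<in> Y"
      have "d i * norm (s i) = 0"
        by (rule rotated_points_independent[OF YV0 Y3 h(1) v0[unfolded v_def] i])
      then show "d i = 0" using norm_s_pos[OF YV[OF i]] by auto
    qed
  qed
  then show ?thesis by (simp add: Y(2))
qed

lemma rank_normalise:
  "row_rank (spherical_matrix s) (F <+> X) \<le> row_rank (spherical_matrix u) (F <+> X)"
proof -
  let ?W = "F <+> X"
  have fW: "finite ?W" using finite_F finite_X by simp
  obtain U where U: "U \<subseteq> ?W" "rows_independent (spherical_matrix s) U"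
    "card U = row_rank (spherical_matrix s) ?W"
    by (rule row_rank_basis)
  have fU: "finite U" using U(1) fW finite_subset by blast
  \<comment> \<open>Multiplying the columns of \<open>i\<close> by \<open>norm (s i)\<close> makes
    the coefficient of \<open>tau (psi e) *v u (dst e)\<close> symmetric in the two ends of an edge;
    what remains is a multiple of \<open>u i\<close>, that is, of a vertex row.\<close>
  define scale where "scale = case_sum (\<lambda>(i, m :: 3). norm (s i)) (\<lambda>_ :: unit. 1)"
  define B where "B w x = scale x * spherical_matrix s w x" for w x
  have "rows_independent B U"
  proof (rule rows_independentI[OF fU])
    fix c w assume c: "\<And>x. (\<Sum>w\<in>U. c w * B w x) = 0" and w: "w \<in> U"
    have "(\<Sum>w\<in>U. c w * spherical_matrix s w x) = 0" for x
    proof (cases "scale x = 0")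
      \<comment> \<open>The norm is zero only for index sets outside \<open>V0\<close>, whose
        columns vanish.\<close>
      case True
      then obtain i m where x: "x = Inl (i, m)" "norm (s i) = 0"
        unfolding scale_def by (auto split: sum.splits)
      then have "i \<notin> V0" using norm_s_pos[of i] by auto
      then have "spherical_matrix s w x = 0" if "w \<in> U" for w
        using that U(1) X_V0 F edge_data unfolding x orbit_matrix_def edge_block_def
        by (auto split: sum.split simp: Let_def)
      then show ?thesis by simp
    next
      case False
      have "scale x * (\<Sum>w\<in>U. c w * spherical_matrix s w x) = 0"
        using c[of x] unfolding B_def sum_distrib_left by (simp add: ac_simps)
      then show ?thesis using False by simp
    qed
    then show "c w = 0" using rows_independentD[OF fU U(2), of c] w by blast
  qed
  moreover have "B w \<in> row_space.span (spherical_matrix u ` ?W)" if "w \<in> ?W" for w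
  proof (cases w)
    case (Inr j)
    then have j: "j \<in> X" using that by auto
    then have jV: "j \<in> V0" using X_V0 by blast
    have "B w = (\<lambda>x. (norm (s j))\<^sup>2 * spherical_matrix u (Inr j) x)"
    proof
      fix x show "B w x = (norm (s j))\<^sup>2 * spherical_matrix u (Inr j) x"
      proof (cases x)
        case x: (Inl y)
        obtain i m where y: "y = (i, m)" by (cases y)
        have "s j $ m = norm (s j) * u j $ m"
          using arg_cong[OF s_eq[OF jV], of "\<lambda>v. v $ m"] by simp
        then show ?thesis
          by (simp add: B_def Inr scale_def orbit_matrix_def x y power2_eq_square mult.assoc)
      qed (simp add: B_def Inr orbit_matrix_def)
    qed
    then show ?thesis using j by (simp, intro row_space.span_scale row_space.span_base) auto
  next
    case (Inl e)
    then have e: "e \<in> F" using that by auto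
    let ?i = "src e" and ?j = "dst e" and ?T = "tau (psi e)"
    have eE: "e \<in> E0" using e F by blast
    have ij: "?i \<in> X" "?j \<in> X" using e by (auto simp: X verts_of_def)
    have si: "s ?i = norm (s ?i) *\<^sub>R u ?i" and sj: "s ?j = norm (s ?j) *\<^sub>R u ?j"
      using s_eq edge_data[OF eE] by auto
    define ni nj where "ni = norm (s ?i)" and "nj = norm (s ?j)"
    have inv: "matrix_inv ?T *v (c *\<^sub>R x) = c *\<^sub>R (matrix_inv ?T *v x)" for c x
      by (rule matrix_vector_mult_scaleR)
    \<comment> \<open>The last two terms are the contributions of the two vertex rows. For a loop
      both norms agree and the corrections are zero.\<close>
    have block: "norm (s k) *\<^sub>R edge_block src dst psi tau s e k =
        (ni * nj) *\<^sub>R edge_block src dst psi tau u e k + (ni\<^sup>2 - ni * nj) *\<^sub>R (if k = ?i then u ?i else 0)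
        + (nj\<^sup>2 - ni * nj) *\<^sub>R (if k = ?j then u ?j else 0)" for k
    proof (cases "?i = ?j")
      case True
      then have "ni = nj" by (simp add: ni_def nj_def)
      have "2 *\<^sub>R s ?i - ?T *v s ?i - matrix_inv ?T *v s ?i =
          ni *\<^sub>R (2 *\<^sub>R u ?i - ?T *v u ?i - matrix_inv ?T *v u ?i)"
        unfolding ni_def by (subst (1 2 3) si)
          (simp only: matrix_vector_mult_scaleR scaleR_diff_right scaleR_left_commute)
      then show ?thesis
        using True \<open>ni = nj\<close>
        by (auto simp: edge_block_def Let_def power2_eq_square ni_def[symmetric] nj_def[symmetric])
    next
      case False
      have "ni *\<^sub>R (s ?i - ?T *v s ?j) = (ni * nj) *\<^sub>R (u ?i - ?T *v u ?j) + (ni\<^sup>2 - ni * nj) *\<^sub>R u ?i"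
        by (subst (1) si, subst (1) sj)
          (simp add: matrix_vector_mult_scaleR ni_def[symmetric] nj_def[symmetric] power2_eq_square algebra_simps)
      moreover have "nj *\<^sub>R (s ?j - matrix_inv ?T *v s ?i) =
          (ni * nj) *\<^sub>R (u ?j - matrix_inv ?T *v u ?i) + (nj\<^sup>2 - ni * nj) *\<^sub>R u ?j"
        by (subst (1) si, subst (1) sj)
          (simp add: matrix_vector_mult_scaleR ni_def[symmetric] nj_def[symmetric] power2_eq_square algebra_simps)
      ultimately show ?thesis
        using False by (auto simp: edge_block_def Let_def ni_def[symmetric] nj_def[symmetric])
    qed
    have "B w = (\<lambda>x. (ni * nj) * spherical_matrix u (Inl e) x) +
        (\<lambda>x. (ni\<^sup>2 - ni * nj) * spherical_matrix u (Inr ?i) x) +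
        (\<lambda>x. (nj\<^sup>2 - ni * nj) * spherical_matrix u (Inr ?j) x)"
    proof
      fix x
      show "B w x = ((\<lambda>x. (ni * nj) * spherical_matrix u (Inl e) x) +
          (\<lambda>x. (ni\<^sup>2 - ni * nj) * spherical_matrix u (Inr ?i) x) +
          (\<lambda>x. (nj\<^sup>2 - ni * nj) * spherical_matrix u (Inr ?j) x)) x"
      proof (cases x)
        case x: (Inl y)
        obtain k m where y: "y = (k, m)" by (cases y)
        show ?thesis
          using arg_cong[OF block[of k], of "\<lambda>v. v $ m"]
          unfolding B_def Inl scale_def x y orbit_matrix_def by (simp add: if_distrib[of "\<lambda>v. v $ m"])
      qed (simp add: B_def Inl orbit_matrix_def)
    qed
    also have "\<dots> \<in> row_space.span (spherical_matrix u ` ?W)"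
      by (intro row_space.span_add row_space.span_scale row_space.span_base imageI)
        (use e ij in auto)
    finally show ?thesis .
  qed
  ultimately have "card U \<le> row_rank (spherical_matrix u) ?W"
    using card_le_row_rank[OF fW, of B U] U(1) by blast
  then show ?thesis by (simp add: U(3))
qed

text \<open>A maximal independent set of rows at \<open>u\<close> stays independent at every generic
  configuration, because the matrix entries are polynomials over a ring containing the entries of
  the rotations.\<close>

lemma rank_generic:
  assumes y: "generic_on_unit_sphere X y"
  shows "row_rank (spherical_matrix u) (F <+> X) \<le> row_rank (spherical_matrix y) (F <+> X)"
proof -
  let ?W = "F <+> X"
  have fW: "finite ?W" using finite_F finite_X by simp
  obtain U where U: "U \<subseteq> ?W" "rows_independent (spherical_matrix u) U"
    "card U = row_rank (spherical_matrix u) ?W"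
    by (rule row_rank_basis)
  have fU: "finite U" using U(1) fW finite_subset by blast
  obtain K where K: "number_ring K" "\<And>g i j. g \<in> carrier Z \<Longrightarrow> tau g $ i $ j \<in> K"
    using number_ring_tau[OF algebraic] by blast
  let ?Col = "(X \<times> (UNIV :: 3 set)) <+> ({} :: unit set)"
  have zero: "(\<lambda>_. 0) \<in> coord_polys K X" and two: "2 \<in> K"
    using number_ring_rat_mem[OF K(1), of 0] number_ring_rat_mem[OF K(1), of 2]
    by (auto intro: coord_polys.const)
  have fCol: "finite ?Col" using finite_X by simp
  have "rows_independent (spherical_matrix y) U"
  proof (rule rows_independent_generic[OF K(1) y fU fCol])
    fix w x assume w: "w \<in> U" and "x \<in> ?Col"
    then obtain k m where x: "x = Inl (k, m)" "k \<in> X" by auto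
    show "(\<lambda>y. spherical_matrix y w x) \<in> coord_polys K X"
    proof (cases w)
      case (Inr j)
      have "(\<lambda>y. if k = j then y j $ m else 0) \<in> coord_polys K X"
        using x(2) zero by (cases "k = j") (auto intro: coord_polys.coord)
      then show ?thesis by (simp add: Inr x orbit_matrix_def)
    next
      case (Inl e)
      then have e: "e \<in> F" using w U(1) by auto
      then have ij: "src e \<in> X" "dst e \<in> X" by (auto simp: X verts_of_def)
      have psi: "psi e \<in> carrier Z" using e F edge_data(3) by blast
      note tau = coord_polys_tau[OF K psi]
      have "(\<lambda>y. edge_block src dst psi tau y e k $ m) \<in> coord_polys K X"
        unfolding edge_block_def Let_def matrix_inv_tau[OF psi]
        using ij zero two
        by (cases "src e = dst e"; cases "k = src e"; cases "k = dst e")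
          (auto simp del: transpose_matrix_vector intro!: coord_polys_diff[OF K(1)] tau coord_polys.coord coord_polys.mult[OF coord_polys.const])
      then show ?thesis by (simp add: Inl x orbit_matrix_def)
    qed
  next
    fix y w x assume "w \<in> U" "x \<notin> ?Col"
    then show "spherical_matrix y w x = 0"
      using U(1) unfolding X verts_of_def orbit_matrix_def edge_block_def
      by (auto split: sum.split simp: Let_def)
  next
    show "norm (u i) = 1" if "i \<in> X" for i
      using u_generic[OF X_V0] that by (simp add: generic_on_unit_sphere_def)
  qed (rule U(2))
  then have "card U \<le> row_rank (spherical_matrix y) ?W"
    by (rule card_le_row_rank[OF fW]) (use U(1) in \<open>auto intro!: row_space.span_base\<close>)
  then show ?thesis by (simp add: U(3))
qed

lemma spherical_rank_ge:
  "int (row_rank (spherical_matrix s) (F <+> X)) - int (card X) \<le> spherical_rank src dst psi tau F"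
proof -
  \<comment> \<open>The normalised configuration shows that generic ones exist, so the choice in
    \<open>spherical_rank\<close> is generic.\<close>
  have "generic_on_unit_sphere X (SOME y. generic_on_unit_sphere X y)"
    by (rule someI[of _ u]) (rule u_generic[OF X_V0])
  from rank_normalise rank_generic[OF this] show ?thesis
    by (simp add: spherical_rank_def Let_def X[symmetric])
qed

text \<open>The two arguments of each minimum come from separate lower bounds for the rank at
  \<open>s\<close>, one by colours and one by translations. The truncation \<open>max 0\<close>
  reflects \<open>min 3 (card X)\<close>: for a single edge between two orbits
  \<open>card X - 3\<close> is -1, and without truncation the number 1 would be bounded by at most
  0.\<close>

lemma subgraph_count:
  assumes "F \<noteq> {}"
  shows "balanced Z src dst psi F \<Longrightarrow> int (card F) \<le> spherical_rank src dst psi tau F +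
      min (int (num_colours_on C chi0 X)) (max 0 (int (card X) - 3))"
    and "int (card F) \<le> spherical_rank src dst psi tau F +
      min (int (num_colours_on C chi0 X)) (int (card X) - 1)"
  using spherical_rank_ge colour_bound unbalanced_bound[OF assms] balanced_bound by linarith+

end

end

text \<open>Nonemptiness of \<open>V\<close> excludes the empty graph, for which the edge count
  would read 0 = -2.\<close>

theorem corollary5p4:
  fixes q k :: nat
    and V :: "'v set" and E :: "'v set set" and C :: "'c set" and chi :: "'v \<Rightarrow> 'c option"
    and th :: "int \<Rightarrow> 'v \<Rightarrow> 'v" and tau :: "int \<Rightarrow> real^3^3"
    and r :: "'c \<Rightarrow> real" and p :: "'v \<Rightarrow> real^3"
    and rep :: "'v set \<Rightarrow> 'v" and src dst :: "'v set set \<Rightarrow> 'v set" and psi :: "'v set set \<Rightarrow> int"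
    and Z :: "int monoid" and V0 :: "'v set set" and E0 :: "'v set set set"
    and chi0 :: "'v set \<Rightarrow> 'c option"
  assumes q: "q \<ge> 2"
    and Z: "Z = integer_mod_group q"
    and graph: "finite_simple_graph V E" "V \<noteq> {}"
    and colours: "colouring V C chi" "card C = k"
    and action: "free_symmetry Z V E chi th"
    and rotation: "describes_rotation q tau" "algebraic_matrices (tau ` carrier Z)"
    and V0: "V0 = vertex_orbits Z V th"
    and E0: "E0 = edge_orbits Z E th"
    and quotient: "quotient_gain_graph Z V E th rep src dst psi"
    and chi0: "chi0 = (\<lambda>X. chi (rep X))"
    and framework: "framework V C chi r p" "symmetric_placement Z V th tau p"
    and generic: "generic_on_spheres V0 C chi0 r (\<lambda>X. p (rep X))"
    and isostatic: "symmetric_isostatic Z V E C chi th tau p rep src dst psi"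
  shows "int (card E0) = 2 * int (card V0) - 1 + min (int k) (int (card V0) - 1)
    \<and> (\<forall>F \<subseteq> E0. F \<noteq> {} \<longrightarrow>
        (balanced Z src dst psi F \<longrightarrow>
           int (card F) \<le> spherical_rank src dst psi tau F +
             min (int (num_colours_on C chi0 (verts_of src dst F)))
                 (max 0 (int (card (verts_of src dst F)) - 3))) \<and>
        (\<not> balanced Z src dst psi F \<longrightarrow>
           int (card F) \<le> spherical_rank src dst psi tau F +
             min (int (num_colours_on C chi0 (verts_of src dst F)))
                 (int (card (verts_of src dst F)) - 1)))"
proof -
  obtain a where a: "norm a = 1" "tau \<in> hom Z orthogonal_group3"
    "tau ` carrier Z = {rotation3 a (2 * pi * real m / real q) | m. m < q}"
    using rotation(1) unfolding describes_rotation_def Z by blast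
  interpret symmetric_framework q tau a Z V E C chi th r p rep src dst psi V0 E0 chi0 "\<lambda>X. p (rep X)"
    by unfold_locales
      (use assms a in \<open>auto simp: symmetric_isostatic_def\<close>)
  show ?thesis
    using edge_count subgraph_count[OF _ refl] isostatic colours(2)
    unfolding symmetric_isostatic_def by blast
qed

end
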